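(* Let $l$ be a prime number. There exist fields $F$ such that the commutator subgroup of the maximal quotient pro-$l$-group of the absolute Galois group of $F$ is not a free pro-$l$-group. Moreover, there are fields $F$ such that the commutator subgroup of the Sylow pro-$l$-subgroup of the absolute Galois group of $F$ is not a free pro-$l$-group.
   Context: The absolute Galois group of a field $F$ is the Galois group of a separable closure of $F$ over $F$. For a pro-finite group, the commutator subgroup is understood as the closed commutator subgroup. *)

theory Defs
  imports "HOL-Algebra.Algebra" "HOL-Analysis.Analysis"
begin

section \<open>Separable closures\<close>

text \<open>Polynomials in \<open>HOL-Algebra.Polynomials\<close> are coefficient lists with the leading coefficient
  first, so the derivative of \<open>[a\<^sub>n, \<dots>, a\<^sub>1, a\<^sub>0]\<close> is \<open>[n a\<^sub>n, \<dots>, 1 a\<^sub>1]\<close>, up to normalization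
  (\<open>map2\<close> drops the constant term).\<close>

definition (in ring) poly_deriv :: "'a list \<Rightarrow> 'a list" where
  "poly_deriv p = normalize (map2 (\<lambda>i a. add_pow R i a) (rev [1..<length p]) p)"

text \<open>Separable means relatively prime to the derivative.\<close>

definition (in ring) separable_poly :: "'a set \<Rightarrow> 'a list \<Rightarrow> bool" where
  "separable_poly K p \<longleftrightarrow> p \<in> carrier (K[X]) \<and>
     (\<exists>u\<in>carrier (K[X]). \<exists>v\<in>carrier (K[X]).
        (u \<otimes>\<^bsub>K[X]\<^esub> p) \<oplus>\<^bsub>K[X]\<^esub> (v \<otimes>\<^bsub>K[X]\<^esub> poly_deriv p) = \<one>\<^bsub>K[X]\<^esub>)"

locale separable_closure = field L + subfield K L for L (structure) and K +
  assumes algebraic_extension: "x \<in> carrier L \<Longrightarrow> (algebraic over K) x"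
    and separable_extension: "x \<in> carrier L \<Longrightarrow> separable_poly K (Irr K x)"
    and separably_closed: "separable_poly (carrier L) P \<Longrightarrow> splitted P"


section \<open>Pro-finite groups\<close>

record 'a topgroup = "'a monoid" +
  topo :: "'a topology"

definition topological_group :: "('a, 'b) topgroup_scheme \<Rightarrow> bool" where
  "topological_group G \<longleftrightarrow> group G \<and> topspace (topo G) = carrier G \<and>
     continuous_map (prod_topology (topo G) (topo G)) (topo G) (\<lambda>(x, y). x \<otimes>\<^bsub>G\<^esub> y) \<and>
     continuous_map (topo G) (topo G) (\<lambda>x. inv\<^bsub>G\<^esub> x)"

definition profinite_group :: "('a, 'b) topgroup_scheme \<Rightarrow> bool" where
  "profinite_group G \<longleftrightarrow> topological_group G \<and> compact_space (topo G) \<and> Hausdorff_space (topo G) \<and>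
     (\<forall>x\<in>carrier G. connected_component_of_set (topo G) x = {x})"

definition open_normal :: "('a, 'b) topgroup_scheme \<Rightarrow> 'a set \<Rightarrow> bool" where
  "open_normal G N \<longleftrightarrow> N \<lhd> G \<and> openin (topo G) N"

definition pro_group :: "nat \<Rightarrow> ('a, 'b) topgroup_scheme \<Rightarrow> bool" where
  "pro_group l G \<longleftrightarrow> profinite_group G \<and>
     (\<forall>N. open_normal G N \<longrightarrow> (\<exists>n. card (rcosets\<^bsub>G\<^esub> N) = l ^ n))"

definition restrict_topgroup :: "'a topgroup \<Rightarrow> 'a set \<Rightarrow> 'a topgroup" where
  "restrict_topgroup G H = G\<lparr>carrier := H, topo := subtopology (topo G) H\<rparr>"

definition quotient_topgroup :: "'a topgroup \<Rightarrow> 'a set \<Rightarrow> 'a set topgroup" where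
  "quotient_topgroup G N =
     \<lparr>carrier = carrier (G Mod N), monoid.mult = monoid.mult (G Mod N), one = one (G Mod N),
      topo = topology (\<lambda>U. U \<subseteq> carrier (G Mod N) \<and>
               openin (topo G) {x \<in> carrier G. N #>\<^bsub>G\<^esub> x \<in> U})\<rparr>"

lemma openin_quotient_topgroup:
  assumes "topspace (topo G) = carrier G"
  shows "openin (topo (quotient_topgroup G N)) U \<longleftrightarrow>
           U \<subseteq> carrier (G Mod N) \<and> openin (topo G) {x \<in> carrier G. N #>\<^bsub>G\<^esub> x \<in> U}"
proof -
  have "{x \<in> carrier G. N #>\<^bsub>G\<^esub> x \<in> S \<inter> T} =
          {x \<in> carrier G. N #>\<^bsub>G\<^esub> x \<in> S} \<inter> {x \<in> carrier G. N #>\<^bsub>G\<^esub> x \<in> T}" for S T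
    by auto
  moreover have "{x \<in> carrier G. N #>\<^bsub>G\<^esub> x \<in> \<Union>\<K>} =
          \<Union>((\<lambda>S. {x \<in> carrier G. N #>\<^bsub>G\<^esub> x \<in> S}) ` \<K>)" for \<K>
    by auto
  ultimately have "istopology (\<lambda>U. U \<subseteq> carrier (G Mod N) \<and>
      openin (topo G) {x \<in> carrier G. N #>\<^bsub>G\<^esub> x \<in> U})"
    unfolding istopology_def by (auto simp del: mem_Collect_eq)
  then show ?thesis
    by (simp add: quotient_topgroup_def)
qed

definition closed_commutator_subgroup :: "'a topgroup \<Rightarrow> 'a topgroup" where
  "closed_commutator_subgroup G =
     restrict_topgroup G (Abstract_Topology.closure_of (topo G) (derived G (carrier G)))"

definition max_pro_quotient :: "nat \<Rightarrow> 'a topgroup \<Rightarrow> 'a set topgroup" where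
  "max_pro_quotient l G =
     quotient_topgroup G (\<Inter>{N. open_normal G N \<and> (\<exists>n. card (rcosets\<^bsub>G\<^esub> N) = l ^ n)})"

text \<open>A Sylow pro-\<open>l\<close>-subgroup is a closed pro-\<open>l\<close>-subgroup \<open>P\<close> whose index, the supernatural
  number \<open>lcm {[G : PN]}\<close> over all open normal subgroups \<open>N\<close>, is prime to \<open>l\<close>.\<close>

definition sylow_pro_subgroup :: "nat \<Rightarrow> 'a topgroup \<Rightarrow> 'a set \<Rightarrow> bool" where
  "sylow_pro_subgroup l G P \<longleftrightarrow>
     subgroup P G \<and> closedin (topo G) P \<and> pro_group l (restrict_topgroup G P) \<and>
     (\<forall>N. open_normal G N \<longrightarrow> \<not> l dvd card (rcosets\<^bsub>G\<^esub> (P <#>\<^bsub>G\<^esub> N)))"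

text \<open>A free pro-\<open>l\<close>-group is one with a basis converging to \<open>1\<close>. Definitions cannot quantify over
  the types of the test groups \<open>H\<close>; but pro-\<open>l\<close>-groups are inverse limits of finite \<open>l\<close>-groups, so
  the universal property for finite \<open>H\<close>, all of which have copies over \<open>nat set\<close>, already
  implies it for all \<open>H\<close>.\<close>

definition converges_to_one :: "'x set \<Rightarrow> ('x \<Rightarrow> 'a) \<Rightarrow> ('a, 'b) topgroup_scheme \<Rightarrow> bool" where
  "converges_to_one B f G \<longleftrightarrow> f \<in> B \<rightarrow> carrier G \<and>
     (\<forall>N. open_normal G N \<longrightarrow> finite {x \<in> B. f x \<notin> N})"

definition free_pro_group_on :: "nat \<Rightarrow> 'a topgroup \<Rightarrow> 'a set \<Rightarrow> bool" where
  "free_pro_group_on l G B \<longleftrightarrow> pro_group l G \<and> converges_to_one B (\<lambda>x. x) G \<and>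
     (\<forall>(H :: nat set topgroup) f. pro_group l H \<longrightarrow> converges_to_one B f H \<longrightarrow>
        (\<exists>!h. h \<in> hom G H \<and> h \<in> extensional (carrier G) \<and>
              continuous_map (topo G) (topo H) h \<and> (\<forall>x\<in>B. h x = f x)))"

definition free_pro_group :: "nat \<Rightarrow> 'a topgroup \<Rightarrow> bool" where
  "free_pro_group l G \<longleftrightarrow> (\<exists>B. free_pro_group_on l G B)"


section \<open>Galois groups\<close>

definition galois_auts :: "('a, 'b) ring_scheme \<Rightarrow> 'a set \<Rightarrow> ('a \<Rightarrow> 'a) set" where
  "galois_auts L K = {s \<in> Bij (carrier L). s \<in> ring_hom L L \<and> (\<forall>x\<in>K. s x = x)}"

text \<open>The Galois group carries the Krull topology: the cosets of the subgroups fixing a finite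
  subextension \<open>E\<close> of \<open>L\<close> over \<open>K\<close> form a base.\<close>

definition galois_group :: "('a, 'b) ring_scheme \<Rightarrow> 'a set \<Rightarrow> ('a \<Rightarrow> 'a) topgroup" where
  "galois_group L K =
     \<lparr>carrier = galois_auts L K,
      monoid.mult = monoid.mult (BijGroup (carrier L)),
      one = one (BijGroup (carrier L)),
      topo = topology_generated_by
        {s <#\<^bsub>BijGroup (carrier L)\<^esub> galois_auts L E | s E.
           s \<in> galois_auts L K \<and> subfield E L \<and> K \<subseteq> E \<and> ring.finite_dimension L K E}\<rparr>"

text \<open>The fields in an existence statement have to range over the fields carried by subsets of
  some fixed type. This one has the cardinality of the power set of the continuum.\<close>

type_synonym universe = "nat set set"

end

theory Submission
  imports Defs "HOL-Number_Theory.Cong" "HOL-Algebra.Algebraic_Closure_Type"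
begin

text \<open>The counterexample is a field whose absolute Galois group is a pro-\<open>l\<close>-group containing
  \<open>\<int>\<^sub>l\<^sup>2 \<rtimes> \<int>\<^sub>l\<close>, where \<open>\<int>\<^sub>l\<close> acts through the cyclotomic character, as for \<open>k((x))((y))\<close> when \<open>k\<close> has
  a single generator \<open>\<phi>\<close> of its Galois group and contains the roots of unity of order \<open>l\<close>, but not those
  of order \<open>l\<^sup>2\<close>. Rank-one valuations suffice if \<open>x\<close> and \<open>y\<close> are powers of one variable whose exponents are
  independent over \<open>\<rat>\<close>: Levi-Civita series with real exponents over the algebraic numbers form an
  algebraically closed field, on which \<open>\<phi>\<close> acts through the coefficients and characters \<open>\<eta>\<close> of the
  exponent group act by \<open>t\<^sup>r \<mapsto> \<eta>(r) t\<^sup>r\<close>. The field is the fixed field of these automorphisms, and its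
  algebraic closure consists of the series with finite orbits. The commutators of \<open>\<phi>\<close> with two inertia
  generators commute with each other, but the Kummer characters of \<open>x\<^bsup>1/l\<^esup>\<close> and \<open>y\<^bsup>1/l\<^esup>\<close> separate them.
  In a free pro-\<open>l\<close>-group that is impossible: the pair of characters would lift to a homomorphism
  into the Heisenberg group modulo \<open>l\<close>.\<close>

section \<open>Embeddings of algebraic extensions of the rationals\<close>

text \<open>The absolute Galois group is never computed. It is reached only through the monoid
  \<Gamma> of explicit embeddings, which is dense in it, and it is pro-\<open>l\<close> because
  every element of \<Gamma> has \<open>l\<close>-power order on each series with a finite orbit.
  This is why \<phi> is taken as the \<open>l\<close>-part of an automorphism of the algebraic
  numbers and why the characters \<eta> have values of \<open>l\<close>-power order. A
  pro-\<open>l\<close> Galois group is its own Sylow pro-\<open>l\<close>-subgroup and, up to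
  passing to singletons, its own maximal pro-\<open>l\<close> quotient; one field therefore settles
  both claims. The commutator of \<phi> with \<eta> is the character \<phi>(\<eta>)/\<eta>. As
  \<phi> raises roots of unity of order \<open>l^2\<close> to the power \<open>1 + l\<close>, for
  the two inertia generators this commutator is trivial on \<open>x^(1/l)\<close> and
  \<open>y^(1/l)\<close>, and the \<open>l^2\<close>-th roots are the first to move, by roots of
  unity of order \<open>l\<close>. The Kummer characters are thus homomorphisms only on the
  stabiliser of \<open>x^(1/l)\<close> and \<open>y^(1/l)\<close>. It contains the commutator
  subgroup, since these roots are abelian over the base.\<close>

locale field_embedding =
  fixes h :: "'a :: field \<Rightarrow> 'b :: field"
  assumes add: "h (x + y) = h x + h y"
    and mult: "h (x * y) = h x * h y"
    and one: "h 1 = 1"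
begin

lemma zero: "h 0 = 0"
  by (metis add add_0_right add_left_cancel)

lemma uminus: "h (- x) = - h x"
  using add[of x "- x"] zero by (simp add: eq_neg_iff_add_eq_0 add.commute)

lemma diff: "h (x - y) = h x - h y"
  using add[of x "- y"] uminus by simp

lemma power: "h (x ^ n) = h x ^ n"
  by (induction n) (auto simp: one mult)

lemma eq_0_iff: "h x = 0 \<longleftrightarrow> x = 0"
proof
  assume "h x = 0"
  then have "h (x * inverse x) = 0"
    by (simp only: mult) simp
  then show "x = 0" using one by (cases "x = 0") auto
qed (simp add: zero)

lemma inj: "inj h"
  by (rule injI) (metis diff eq_0_iff right_minus_eq)

lemma eq_iff: "h x = h y \<longleftrightarrow> x = y"
  using inj by (simp add: inj_eq)

lemma inverse: "h (inverse x) = inverse (h x)"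
proof (cases "x = 0")
  case False
  then have "h x * h (inverse x) = 1"
    by (simp flip: mult add: one)
  then show ?thesis
    by (metis inverse_unique)
qed (simp add: zero)

lemma sum: "h (sum f A) = (\<Sum>i\<in>A. h (f i))"
  by (induction A rule: infinite_finite_induct) (auto simp: add zero)

lemma of_nat: "h (of_nat n) = of_nat n"
  by (induction n) (auto simp: add one zero)

lemma poly: "h (poly p x) = poly (map_poly h p) (h x)"
  by (induction p) (auto simp: zero add mult map_poly_pCons)

end

lemma field_embedding_of_int:
  assumes "field_embedding h"
  shows "h (of_int n) = of_int n"
proof -
  interpret field_embedding h by fact
  show ?thesis
    by (cases n rule: int_diff_cases) (simp add: of_nat diff)
qed

lemma field_embedding_of_rat:
  fixes h :: "'a :: field_char_0 \<Rightarrow> 'b :: field_char_0"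
  assumes "field_embedding h"
  shows "h (of_rat q) = of_rat q"
proof -
  interpret field_embedding h by fact
  obtain a b where "q = Rat.Fract a b" "b > 0"
    by (cases q) auto
  then show ?thesis
    by (auto simp: of_rat_rat divide_inverse mult inverse field_embedding_of_int[OF assms])
qed

lemma field_embedding_ratpoly:
  fixes h :: "'a :: field_char_0 \<Rightarrow> 'b :: field_char_0"
  assumes "field_embedding h"
  shows "h (poly (map_poly of_rat p) x) = poly (map_poly of_rat p) (h x)"
proof -
  interpret field_embedding h by fact
  have "map_poly h (map_poly of_rat p) = map_poly of_rat p"
    by (subst map_poly_map_poly) (auto simp: zero o_def field_embedding_of_rat[OF assms])
  then show ?thesis by (simp add: poly)
qed

text \<open>A subring of the product whose first projection is injective, that is, the graph of a
  ring homomorphism; Zorn's lemma is applied to these graphs.\<close>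

definition hom_graph :: "('a :: field_char_0 \<times> 'b :: field_char_0) set \<Rightarrow> bool" where
  "hom_graph R \<longleftrightarrow> (\<forall>q. (of_rat q, of_rat q) \<in> R) \<and>
     (\<forall>x y x' y'. (x, y) \<in> R \<longrightarrow> (x', y') \<in> R \<longrightarrow> (x + x', y + y') \<in> R) \<and>
     (\<forall>x y x' y'. (x, y) \<in> R \<longrightarrow> (x', y') \<in> R \<longrightarrow> (x * x', y * y') \<in> R) \<and>
     (\<forall>y. (0, y) \<in> R \<longrightarrow> y = 0)"

definition poly_graph :: "('a :: zero \<times> 'b :: zero) set \<Rightarrow> ('a poly \<times> 'b poly) set" where
  "poly_graph R = {(P, Q). \<forall>i. (coeff P i, coeff Q i) \<in> R}"

context
  fixes R :: "('a :: field_char_0 \<times> 'b :: field_char_0) set"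
  assumes R: "hom_graph R"
begin

lemma hom_graph_rat: "(of_rat q, of_rat q) \<in> R"
  using R by (auto simp: hom_graph_def)

lemma hom_graph_01: "(0, 0) \<in> R" "(1, 1) \<in> R"
  using hom_graph_rat[of 0] hom_graph_rat[of 1] by auto

lemma hom_graph_add: "(x, y) \<in> R \<Longrightarrow> (x', y') \<in> R \<Longrightarrow> (x + x', y + y') \<in> R"
  using R unfolding hom_graph_def by blast

lemma hom_graph_mult: "(x, y) \<in> R \<Longrightarrow> (x', y') \<in> R \<Longrightarrow> (x * x', y * y') \<in> R"
  using R unfolding hom_graph_def by blast

lemma hom_graph_uminus: "(x, y) \<in> R \<Longrightarrow> (- x, - y) \<in> R"
  using hom_graph_mult[of x y "- 1" "- 1"] hom_graph_rat[of "- 1"] by (simp add: of_rat_minus)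

lemma hom_graph_diff: "(x, y) \<in> R \<Longrightarrow> (x', y') \<in> R \<Longrightarrow> (x - x', y - y') \<in> R"
  using hom_graph_add[of x y "- x'" "- y'"] hom_graph_uminus[of x' y'] by simp

lemma hom_graph_unique: "(x, y) \<in> R \<Longrightarrow> (x, y') \<in> R \<Longrightarrow> y = y'"
  using hom_graph_diff[of x y x y'] R by (auto simp: hom_graph_def)

lemma hom_graph_sum:
  "(\<And>i. i \<in> A \<Longrightarrow> (f i, g i) \<in> R) \<Longrightarrow> (sum f A, sum g A) \<in> R"
  by (induction A rule: infinite_finite_induct) (auto simp: hom_graph_01 hom_graph_add)

lemma hom_graph_power: "(x, y) \<in> R \<Longrightarrow> (x ^ n, y ^ n) \<in> R"
  by (induction n) (auto simp: hom_graph_01 hom_graph_mult)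

lemma poly_graph_add: "(P, Q) \<in> poly_graph R \<Longrightarrow> (P', Q') \<in> poly_graph R \<Longrightarrow> (P + P', Q + Q') \<in> poly_graph R"
  by (auto simp: poly_graph_def hom_graph_add)

lemma poly_graph_diff: "(P, Q) \<in> poly_graph R \<Longrightarrow> (P', Q') \<in> poly_graph R \<Longrightarrow> (P - P', Q - Q') \<in> poly_graph R"
  by (auto simp: poly_graph_def hom_graph_diff)

lemma poly_graph_mult: "(P, Q) \<in> poly_graph R \<Longrightarrow> (P', Q') \<in> poly_graph R \<Longrightarrow> (P * P', Q * Q') \<in> poly_graph R"
  by (auto simp: poly_graph_def coeff_mult intro!: hom_graph_sum hom_graph_mult)

lemma poly_graph_monom: "(x, y) \<in> R \<Longrightarrow> (monom x n, monom y n) \<in> poly_graph R"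
  by (auto simp: poly_graph_def hom_graph_01)

lemma poly_graph_ratpoly: "(map_poly of_rat p, map_poly of_rat p) \<in> poly_graph R"
  by (auto simp: poly_graph_def coeff_map_poly hom_graph_rat)

lemma poly_graph_0: "(0, Q) \<in> poly_graph R \<Longrightarrow> Q = 0"
  using R by (auto simp: poly_graph_def hom_graph_def poly_eq_iff)

lemma poly_graph_poly: "(P, Q) \<in> poly_graph R \<Longrightarrow> (x, y) \<in> R \<Longrightarrow> (poly P x, poly Q y) \<in> R"
proof -
  assume PQ: "(P, Q) \<in> poly_graph R" and xy: "(x, y) \<in> R"
  define n where "n = max (degree P) (degree Q)"
  have "poly P x = (\<Sum>i\<le>n. coeff P i * x ^ i)" "poly Q y = (\<Sum>i\<le>n. coeff Q i * y ^ i)"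
    unfolding poly_altdef n_def
    by (intro sum.mono_neutral_left; auto simp: coeff_eq_0)+
  then show ?thesis
    using PQ xy by (auto simp: poly_graph_def intro!: hom_graph_sum hom_graph_mult hom_graph_power)
qed

text \<open>The inverse of a nonzero algebraic number is a rational polynomial in it: divide the
  relation by powers of \<open>x\<close> until its constant term is nonzero. So graphs of ring
  homomorphisms need no separate closure under inversion.\<close>

lemma hom_graph_inverse:
  assumes xy: "(x, y) \<in> R" and "x \<noteq> 0" and p: "p \<noteq> 0" "poly (map_poly of_rat p) x = 0"
  shows "\<exists>y'. (inverse x, y') \<in> R"
  using p
proof (induction p)
  case (pCons c p)
  show ?case
  proof (cases "c = 0")
    case True
    then have "p \<noteq> 0" "poly (map_poly of_rat p) x = 0"
      using pCons.prems \<open>x \<noteq> 0\<close> by (auto simp: map_poly_pCons)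
    then show ?thesis by (rule pCons.IH)
  next
    case False
    have "of_rat c + x * poly (map_poly of_rat p) x = 0"
      using pCons.prems by (simp add: map_poly_pCons)
    then have "inverse x = of_rat (- inverse c) * poly (map_poly of_rat p) x"
      using False \<open>x \<noteq> 0\<close>
      by (simp add: of_rat_minus of_rat_inverse add_eq_0_iff) (simp add: field_simps)
    moreover have "(of_rat (- inverse c) * poly (map_poly of_rat p) x,
        of_rat (- inverse c) * poly (map_poly of_rat p) y) \<in> R"
      by (intro hom_graph_mult hom_graph_rat poly_graph_poly poly_graph_ratpoly xy)
    ultimately show ?thesis by metis
  qed
qed auto

end

text \<open>The usual extension to a simple algebraic extension, with pairs of polynomials in place
  of a coefficient map: \<open>m\<close> is the minimal polynomial of \<open>a\<close> over the
  domain of \<open>R\<close>, \<open>m'\<close> its image, and \<open>b\<close> any root of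
  \<open>m'\<close>.\<close>

lemma hom_graph_adjoin:
  fixes R :: "('a :: field_char_0 \<times> 'b :: {field_char_0, alg_closed_field}) set"
  assumes R: "hom_graph R"
    and alg: "\<And>x :: 'a. \<exists>p :: rat poly. p \<noteq> 0 \<and> poly (map_poly of_rat p) x = 0"
  obtains R' b where "hom_graph R'" "R \<subseteq> R'" "(a, b) \<in> R'"
proof -
  note rules = hom_graph_rat[OF R] hom_graph_add[OF R] hom_graph_mult[OF R] hom_graph_01[OF R]
  define M where "M P \<longleftrightarrow> (\<exists>Q. (P, Q) \<in> poly_graph R) \<and> P \<noteq> 0 \<and> poly P a = 0" for P
  obtain p where p: "p \<noteq> 0" "poly (map_poly of_rat p) a = 0"
    using alg by blast
  then have "M (map_poly of_rat p)"
    unfolding M_def using poly_graph_ratpoly[OF R, of p]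
    by (auto simp: map_poly_eq_0_iff)
  then obtain m0 where m0: "M m0" "\<And>P. M P \<Longrightarrow> degree m0 \<le> degree P"
    using ex_has_least_nat[of M "map_poly of_rat p" degree] by blast
  obtain m0' where m0': "(m0, m0') \<in> poly_graph R" and "m0 \<noteq> 0" "poly m0 a = 0"
    using m0(1) by (auto simp: M_def)
  have lc: "(lead_coeff m0, coeff m0' (degree m0)) \<in> R"
    using m0' by (auto simp: poly_graph_def)
  obtain d where d: "(inverse (lead_coeff m0), d) \<in> R"
    using hom_graph_inverse[OF R lc] alg[of "lead_coeff m0"] \<open>m0 \<noteq> 0\<close> by auto
  define m where "m = monom (inverse (lead_coeff m0)) 0 * m0"
  define m' where "m' = monom d 0 * m0'"
  have mm': "(m, m') \<in> poly_graph R"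
    unfolding m_def m'_def by (intro poly_graph_mult[OF R] poly_graph_monom[OF R] d m0')
  have m: "degree m = degree m0" "coeff m (degree m) = 1" "poly m a = 0"
    using \<open>m0 \<noteq> 0\<close> \<open>poly m0 a = 0\<close> by (auto simp: m_def monom_0)
  have "degree m0 > 0"
    using \<open>m0 \<noteq> 0\<close> \<open>poly m0 a = 0\<close> by (cases "degree m0 = 0") (auto elim!: degree_eq_zeroE)
  \<comment> \<open>Single-valuedness of \<open>R\<close> forces the matching coefficient of
    \<open>m'\<close> to be 1, so \<open>m'\<close> has positive degree and hence a root.\<close>
  have "(1, coeff m' (degree m)) \<in> R"
    using mm' m(2) by (auto simp: poly_graph_def) metis
  then have "coeff m' (degree m) = 1"
    using hom_graph_unique[OF R] rules(5) by blast
  then have "degree m' > 0"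
    using \<open>degree m0 > 0\<close> m(1) by (metis le_degree less_le_trans one_neq_zero)
  then obtain b where b: "poly m' b = 0"
    using alg_closed_imp_poly_has_root by blast
  \<comment> \<open>Reducing by the monic \<open>m\<close> on both coordinates at once lowers the
    degree of \<open>P\<close>. This ends at zero, as no nonzero polynomial of degree below that of
    \<open>m\<close> vanishes at \<open>a\<close>.\<close>
  have single: "poly Q b = 0" if "(P, Q) \<in> poly_graph R" "poly P a = 0" for P Q
    using that
  proof (induction "degree P" arbitrary: P Q rule: less_induct)
    case less
    show ?case
    proof (cases "P = 0")
      case True
      then have "Q = 0" using less.prems poly_graph_0[OF R] by blast
      then show ?thesis by simp
    next
      case False
      then have "M P" using less.prems by (auto simp: M_def)
      then have le: "degree m \<le> degree P" using m0(2) m(1) by simp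
      define c where "c = lead_coeff P"
      define c' where "c' = coeff Q (degree P)"
      have cc': "(c, c') \<in> R"
        using less.prems by (auto simp: poly_graph_def c_def c'_def)
      let ?P = "P - monom c (degree P - degree m) * m"
      let ?Q = "Q - monom c' (degree P - degree m) * m'"
      have 1: "(?P, ?Q) \<in> poly_graph R"
        by (intro poly_graph_diff[OF R] poly_graph_mult[OF R] poly_graph_monom[OF R] mm' less.prems cc')
      have 2: "poly ?P a = 0"
        using less.prems m by simp
      have "degree P > 0"
        using le m(1) \<open>degree m0 > 0\<close> by simp
      have "degree (monom c (degree P - degree m) * m) = degree P"
        using False m \<open>degree m0 > 0\<close> le
        by (subst degree_mult_eq) (auto simp: c_def degree_monom_eq monom_eq_0_iff)
      moreover have "coeff (monom c (degree P - degree m) * m) (degree P) = c"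
        using le m(2) by (simp add: coeff_monom_mult)
      ultimately have "degree ?P \<le> degree P" "coeff ?P (degree P) = 0"
        by (auto simp: c_def intro: degree_diff_le)
      then have "degree ?P < degree P"
        using \<open>degree P > 0\<close> by (metis degree_0 le_neq_implies_less leading_coeff_0_iff)
      from less.hyps[OF this 1 2] show ?thesis using b by simp
    qed
  qed
  define R' where "R' = {(poly P a, poly Q b) | P Q. (P, Q) \<in> poly_graph R}"
  have "hom_graph R'"
    unfolding hom_graph_def
  proof (intro conjI allI impI)
    show "(of_rat q, of_rat q) \<in> R'" for q
      unfolding R'_def using poly_graph_monom[OF R rules(1)[of q], of 0]
      by (force simp: monom_0)
  next
    fix x y x' y' assume "(x, y) \<in> R'" "(x', y') \<in> R'"
    then obtain P Q P' Q' where *: "(P, Q) \<in> poly_graph R" "(P', Q') \<in> poly_graph R"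
      "x = poly P a" "y = poly Q b" "x' = poly P' a" "y' = poly Q' b"
      by (auto simp: R'_def)
    show "(x + x', y + y') \<in> R'"
      unfolding R'_def using poly_graph_add[OF R *(1,2)] * by force
    show "(x * x', y * y') \<in> R'"
      unfolding R'_def using poly_graph_mult[OF R *(1,2)] * by force
  next
    show "y = 0" if "(0, y) \<in> R'" for y
      using that single unfolding R'_def by force
  qed
  moreover have "R \<subseteq> R'"
  proof safe
    fix x y assume "(x, y) \<in> R"
    then show "(x, y) \<in> R'"
      unfolding R'_def using poly_graph_monom[OF R, of x y 0] by (force simp: monom_0)
  qed
  moreover have "(a, b) \<in> R'"
    unfolding R'_def using poly_graph_monom[OF R rules(5), of 1] by (force simp: monom_altdef)
  ultimately show thesis ..
qed

text \<open>By \<open>conj\<close>, sending \<open>a\<close> to \<open>b\<close> is well defined on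
  the ring generated by \<open>a\<close> over the rationals; its graph is \<open>R0\<close>. A
  maximal graph above \<open>R0\<close> has full domain, since otherwise one more element could be
  adjoined.\<close>

lemma ex_field_embedding:
  fixes a :: "'a :: field_char_0" and b :: "'b :: {field_char_0, alg_closed_field}"
  assumes alg: "\<And>x :: 'a. \<exists>p :: rat poly. p \<noteq> 0 \<and> poly (map_poly of_rat p) x = 0"
    and conj: "\<And>p :: rat poly. poly (map_poly of_rat p) a = 0 \<Longrightarrow> poly (map_poly of_rat p) b = 0"
  obtains h :: "'a \<Rightarrow> 'b" where "field_embedding h" "h a = b"
proof -
  define R0 where "R0 = {(poly (map_poly of_rat p) a, poly (map_poly of_rat p) b) | p. True}"
  have hom_rat: "poly (map_poly of_rat (p + q)) x = poly (map_poly of_rat p) x + poly (map_poly of_rat q) x"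
    "poly (map_poly of_rat (p * q)) x = poly (map_poly of_rat p) x * poly (map_poly of_rat q) x"
    for p q and x :: "'c :: field_char_0"
  proof -
    have "map_poly of_rat (p + q) = (map_poly of_rat p + map_poly of_rat q :: 'c poly)"
      by (rule poly_eqI) (simp add: coeff_map_poly of_rat_add)
    moreover have "map_poly of_rat (p * q) = (map_poly of_rat p * map_poly of_rat q :: 'c poly)"
      by (rule poly_eqI) (simp add: coeff_map_poly coeff_mult of_rat_sum of_rat_mult)
    ultimately show
     "poly (map_poly of_rat (p + q)) x = poly (map_poly of_rat p) x + poly (map_poly of_rat q) x"
     "poly (map_poly of_rat (p * q)) x = poly (map_poly of_rat p) x * poly (map_poly of_rat q) x"
      by simp_all
  qed
  have R0: "hom_graph R0"
    unfolding hom_graph_def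
  proof (intro conjI allI impI)
    have "(of_rat q, of_rat q) = (poly (map_poly of_rat [:q:]) a, poly (map_poly of_rat [:q:]) b)" for q
      by (simp add: map_poly_pCons)
    then show "(of_rat q, of_rat q) \<in> R0" for q
      unfolding R0_def by blast
  next
    fix x y x' y' assume "(x, y) \<in> R0" "(x', y') \<in> R0"
    then obtain p q where *: "x = poly (map_poly of_rat p) a" "y = poly (map_poly of_rat p) b"
      "x' = poly (map_poly of_rat q) a" "y' = poly (map_poly of_rat q) b"
      by (auto simp: R0_def)
    show "(x + x', y + y') \<in> R0" "(x * x', y * y') \<in> R0"
      unfolding R0_def * by (auto simp flip: hom_rat)
  next
    show "y = 0" if y: "(0, y) \<in> R0" for y
    proof -
      obtain p where p: "(0, y) = (poly (map_poly of_rat p) a, poly (map_poly of_rat p) b)"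
        using y unfolding R0_def by blast
      have "poly (map_poly of_rat p) a = 0" "y = poly (map_poly of_rat p) b"
        using p by (metis fst_conv, metis snd_conv)
      then show ?thesis using conj by simp
    qed
  qed
  define \<A> where "\<A> = {R :: ('a \<times> 'b) set. hom_graph R \<and> R0 \<subseteq> R}"
  have "\<exists>U\<in>\<A>. \<forall>S\<in>C. S \<subseteq> U" if C: "C \<in> chains \<A>" for C
  proof (cases "C = {}")
    case True
    then show ?thesis using R0 by (auto simp: \<A>_def)
  next
    case False
    have sub: "\<And>R. R \<in> C \<Longrightarrow> hom_graph R \<and> R0 \<subseteq> R"
      using C by (auto simp: chains_def \<A>_def)
    have dir: "\<exists>R\<in>C. u \<in> R \<and> v \<in> R" if uv: "u \<in> \<Union>C" "v \<in> \<Union>C" for u v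
    proof -
      obtain R1 R2 where R12: "R1 \<in> C" "u \<in> R1" "R2 \<in> C" "v \<in> R2"
        using uv by blast
      then have "R1 \<subseteq> R2 \<or> R2 \<subseteq> R1"
        using C by (auto simp: chains_def chain_subset_def)
      then show ?thesis using R12 by blast
    qed
    have "hom_graph (\<Union>C)"
      unfolding hom_graph_def
    proof (intro conjI allI impI)
      show "(of_rat q, of_rat q) \<in> \<Union>C" for q
        using False sub hom_graph_rat by blast
    next
      fix x y x' y' assume "(x, y) \<in> \<Union>C" "(x', y') \<in> \<Union>C"
      then obtain R where R: "R \<in> C" "(x, y) \<in> R" "(x', y') \<in> R"
        using dir by blast
      then show "(x + x', y + y') \<in> \<Union>C" "(x * x', y * y') \<in> \<Union>C"
        using hom_graph_add hom_graph_mult sub by blast+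
    next
      show "y = 0" if "(0, y) \<in> \<Union>C" for y
        using that sub by (auto simp: hom_graph_def)
    qed
    moreover have "R0 \<subseteq> \<Union>C" using False sub by blast
    ultimately show ?thesis by (auto simp: \<A>_def)
  qed
  from Zorn_Lemma2[of \<A>] this obtain R where R: "hom_graph R" "R0 \<subseteq> R"
    and max: "\<And>S. hom_graph S \<Longrightarrow> R \<subseteq> S \<Longrightarrow> S = R"
    unfolding \<A>_def by (smt (verit) mem_Collect_eq order_trans)
  have "\<exists>y. (x, y) \<in> R" for x
    using hom_graph_adjoin[OF R(1) alg] max by metis
  then obtain h where h: "\<And>x. (x, h x) \<in> R"
    by metis
  have h_eq: "h x = y" if "(x, y) \<in> R" for x y
    using hom_graph_unique[OF R(1)] h that by blast
  have "field_embedding h"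
    by standard (intro h_eq hom_graph_add hom_graph_mult hom_graph_01 R(1) h)+
  moreover have "(a, b) = (poly (map_poly of_rat [:0, 1:]) a, poly (map_poly of_rat [:0, 1:]) b)"
    by (simp add: map_poly_pCons)
  then have "(a, b) \<in> R" using R(2) unfolding R0_def by blast
  ultimately show thesis using h_eq that by blast
qed

text \<open>The polynomial splits into linear factors over the algebraically closed domain, so all
  its roots in the codomain are images under \<open>h\<close>. This pulls complex roots of unity
  back to algebraic numbers.\<close>

lemma root_in_range_field_embedding:
  fixes h :: "'a :: {field_char_0, alg_closed_field} \<Rightarrow> 'b :: field_char_0"
  assumes h: "field_embedding h" and p: "p \<noteq> 0" "poly (map_poly of_rat p) z = 0"
  shows "z \<in> range h"
proof -
  interpret field_embedding h by fact
  have hp: "map_poly h (p * q) = map_poly h p * map_poly h q" for p q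
    by (rule poly_eqI) (simp add: coeff_map_poly coeff_mult zero sum mult)
  define P where "P = (map_poly of_rat p :: 'a poly)"
  have "P \<noteq> 0" using p by (auto simp: P_def map_poly_eq_0_iff)
  have "z \<in> range h" if "poly (map_poly h Q) z = 0" "Q \<noteq> 0" for Q
    using that
  proof (induction "degree Q" arbitrary: Q rule: less_induct)
    case less
    show ?case
    proof (cases "degree Q = 0")
      case True
      then obtain c where "Q = [:c:]" by (elim degree_eq_zeroE)
      then show ?thesis using less.prems by (simp add: map_poly_pCons zero eq_0_iff)
    next
      case False
      then obtain x where "poly Q x = 0"
        using alg_closed_imp_poly_has_root[of Q] by auto
      then obtain S where S: "Q = [:- x, 1:] * S"
        by (auto simp: poly_eq_0_iff_dvd elim: dvdE)
      then have "S \<noteq> 0" using less.prems by auto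
      then have "degree S < degree Q"
        unfolding S by (subst degree_mult_eq) auto
      moreover have "poly (map_poly h Q) z = (z - h x) * poly (map_poly h S) z"
        unfolding S hp by (simp add: map_poly_pCons zero one uminus algebra_simps)
      ultimately show ?thesis using less \<open>S \<noteq> 0\<close> by auto
    qed
  qed
  moreover have "map_poly h P = map_poly of_rat p"
    unfolding P_def by (subst map_poly_map_poly) (auto simp: zero o_def field_embedding_of_rat[OF h])
  ultimately show ?thesis
    using p \<open>P \<noteq> 0\<close> by metis
qed

section \<open>An automorphism moving the roots of unity of order \<open>l\<^sup>2\<close>\<close>

lemma map_poly_hom_mult:
  fixes h :: "'a :: comm_ring_1 \<Rightarrow> 'b :: comm_ring_1"
  assumes "h 0 = 0" "\<And>x y. h (x + y) = h x + h y" "\<And>x y. h (x * y) = h x * h y"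
  shows "map_poly h (p * q) = map_poly h p * map_poly h q"
proof (rule poly_eqI)
  have "h (sum f A) = (\<Sum>i\<in>A. h (f i))" for f and A :: "nat set"
    by (induction A rule: infinite_finite_induct) (auto simp: assms)
  then show "coeff (map_poly h (p * q)) n = coeff (map_poly h p * map_poly h q) n" for n
    by (simp add: coeff_map_poly coeff_mult assms)
qed

lemma map_poly_hom_add:
  fixes h :: "'a :: comm_ring_1 \<Rightarrow> 'b :: comm_ring_1"
  assumes "h 0 = 0" "\<And>x y. h (x + y) = h x + h y"
  shows "map_poly h (p + q) = map_poly h p + map_poly h q"
  by (rule poly_eqI) (simp add: coeff_map_poly assms)

section \<open>Irreducibility of the cyclotomic polynomial of order \<open>l^2\<close>\<close>

lemma prime_dvd_diff_power:
  fixes x y :: "'a :: comm_ring_1"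
  assumes "Factorial_Ring.prime l"
  shows "of_nat l dvd (x - y) ^ l - (x ^ l - y ^ l)"
proof -
  have "x ^ l = ((x - y) + y) ^ l" by simp
  also have "\<dots> = (\<Sum>k\<le>l. of_nat (l choose k) * (x - y) ^ k * y ^ (l - k))"
    by (rule binomial_ring)
  also have "\<dots> = (\<Sum>k\<in>{0, l} \<union> {0<..<l}. of_nat (l choose k) * (x - y) ^ k * y ^ (l - k))"
    by (intro sum.cong) auto
  also have "\<dots> = (y ^ l + (x - y) ^ l) +
      (\<Sum>k\<in>{0<..<l}. of_nat (l choose k) * (x - y) ^ k * y ^ (l - k))"
    using prime_gt_0_nat[OF assms] by (subst sum.union_disjoint) auto
  finally have "(x - y) ^ l - (x ^ l - y ^ l) =
      - (\<Sum>k\<in>{0<..<l}. of_nat (l choose k) * (x - y) ^ k * y ^ (l - k))"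
    by (simp add: algebra_simps)
  moreover have "of_nat l dvd (of_nat (l choose k) :: 'a)" if "k \<in> {0<..<l}" for k
    using that assms dvd_choose_prime[of k l] by (auto elim!: dvdE simp: of_nat_mult)
  ultimately show ?thesis
    by (auto intro!: dvd_sum dvd_mult2)
qed

lemma dvd_diff_power:
  fixes a b c :: "'a :: comm_ring_1"
  assumes "c dvd a - b"
  shows "c dvd a ^ n - b ^ n"
  using assms by (metis dvd_mult2 power_diff_sumr2)

text \<open>Modulo \<open>l\<close>, \<open>X^(l^2) - 1\<close> is a power of \<open>X - 1\<close>.
  If \<open>H(1)\<close> were a unit modulo \<open>l\<close>, the factors \<open>X - 1\<close> could
  be cancelled one at a time until \<open>H\<close> was invertible modulo \<open>l\<close>, which is
  impossible for positive degree and leading coefficient 1 or -1.\<close>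

lemma dvd_value_at_1_of_dvd_power_minus_1:
  fixes H :: "int poly"
  assumes l: "Factorial_Ring.prime l" and H: "H dvd monom 1 (l ^ 2) - 1" "degree H > 0"
  shows "int l dvd poly H 1"
proof (rule ccontr)
  assume nd: "\<not> int l dvd poly H 1"
  define L where "L = (of_nat l :: int poly)"
  have L: "L = [:int l:]"
    by (simp add: L_def of_nat_poly)
  have pL: "prime_elem L"
    using l by (simp add: L prime_elem_const_poly_iff prime_imp_prime_elem)
  define Y where "Y = ([:- 1, 1:] :: int poly)"
  have Y: "Y = monom 1 1 - 1"
    by (simp add: Y_def monom_altdef one_pCons)
  have "L dvd Y ^ l - (monom 1 l - 1)"
    using prime_dvd_diff_power[OF l, of "monom 1 1 :: int poly" 1]
    by (simp add: L_def Y monom_power)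
  then have "L dvd (Y ^ l) ^ l - (monom 1 l - 1) ^ l"
    by (rule dvd_diff_power)
  moreover have "L dvd (monom 1 l - 1) ^ l - (monom 1 (l ^ 2) - 1)"
    using prime_dvd_diff_power[OF l, of "monom 1 l :: int poly" 1]
    by (simp add: L_def monom_power power2_eq_square)
  ultimately have "L dvd ((Y ^ l) ^ l - (monom 1 l - 1) ^ l) + ((monom 1 l - 1) ^ l - (monom 1 (l ^ 2) - 1))"
    by (rule dvd_add)
  then have "L dvd Y ^ (l ^ 2) - (monom 1 (l ^ 2) - 1)"
    by (simp only: diff_add_cancel power_mult[symmetric] power2_eq_square[symmetric] add_diff_eq)
  then have "L dvd (monom 1 (l ^ 2) - 1) - Y ^ (l ^ 2)"
    by (metis dvd_minus_iff minus_diff_eq)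
  moreover obtain s where "monom 1 (l ^ 2) - 1 = H * s"
    using H(1) by (elim dvdE)
  ultimately have "L dvd H * s - Y ^ (l ^ 2)"
    by (simp only:)
  then have "\<exists>s. L dvd H * s - Y ^ (l ^ 2)" ..
  \<comment> \<open>At 1 the power of \<open>Y\<close> vanishes, so \<open>l\<close> divides
    \<open>H(1) s(1)\<close> and hence \<open>s(1)\<close>. Modulo \<open>l\<close> the polynomial
    \<open>s\<close> is then a multiple of \<open>Y\<close>, and the prime element \<open>L\<close>
    does not divide \<open>Y\<close>, so one \<open>Y\<close> cancels.\<close>
  have step: "\<exists>s. L dvd H * s - Y ^ n" if ex: "\<exists>s. L dvd H * s - Y ^ Suc n" for n
  proof -
    obtain s where s: "L dvd H * s - Y ^ Suc n" using ex by blast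
    then obtain w where "H * s - Y ^ Suc n = [:int l:] * w"
      unfolding L by (elim dvdE)
    then have "poly (H * s - Y ^ Suc n) 1 = int l * poly w 1"
      by simp
    then have "int l dvd poly (H * s - Y ^ Suc n) 1"
      by simp
    then have "int l dvd poly H 1 * poly s 1"
      by (simp add: Y_def)
    then have sl: "int l dvd poly s 1"
      using nd l prime_dvd_mult_iff[of "int l"] by (simp add: prime_int_nat_transfer)
    have "Y dvd s - [:poly s 1:]"
      by (simp add: Y_def flip: poly_eq_0_iff_dvd)
    then obtain s' where s': "s - [:poly s 1:] = Y * s'" by (elim dvdE)
    have "L dvd [:poly s 1:]"
      using sl by (simp add: L const_poly_dvd_const_poly_iff)
    then have "L dvd H * [:poly s 1:]" by (rule dvd_mult)
    moreover have "H * s - Y ^ Suc n = Y * (H * s' - Y ^ n) + H * [:poly s 1:]"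
    proof -
      have "s = Y * s' + [:poly s 1:]" using s' by (simp add: algebra_simps)
      then have "H * s = H * (Y * s' + [:poly s 1:])" by simp
      then show ?thesis by (simp only: algebra_simps power_Suc)
    qed
    ultimately have "L dvd Y * (H * s' - Y ^ n)"
      using s dvd_add_left_iff[of L "H * [:poly s 1:]"] by metis
    moreover have "\<not> L dvd Y"
    proof
      assume "L dvd Y"
      then have "int l dvd coeff Y 1"
        unfolding L by (simp add: const_poly_dvd_iff)
      then show False using l by (simp add: Y_def)
    qed
    ultimately show ?thesis
      using pL prime_elem_dvd_mult_iff by blast
  qed
  have "(\<exists>s. L dvd H * s - Y ^ n) \<Longrightarrow> \<exists>s. L dvd H * s - Y ^ 0" for n
    by (induction n) (use step in blast)+
  then have "\<exists>s. L dvd H * s - Y ^ 0"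
    using \<open>\<exists>s. L dvd H * s - Y ^ (l ^ 2)\<close> by blast
  \<comment> \<open>An inverse of \<open>H\<close> modulo \<open>l\<close> of least degree. As the
    leading coefficient of \<open>H\<close> is a unit, \<open>l\<close> divides that of
    \<open>s\<close>, and dropping the leading term of \<open>s\<close> leaves a smaller inverse, or
    zero.\<close>
  then obtain s where s: "L dvd H * s - 1" and min: "\<And>s'. L dvd H * s' - 1 \<Longrightarrow> degree s \<le> degree s'"
    using ex_has_least_nat[of "\<lambda>s. L dvd H * s - 1" _ degree] by auto
  have nL1: "\<not> L dvd 1"
    using pL by (simp add: prime_elem_not_unit)
  obtain r where r: "monom 1 (l ^ 2) - 1 = H * r"
    using H(1) by (elim dvdE)
  have "lead_coeff (monom 1 (l ^ 2) - 1 :: int poly) = 1"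
  proof -
    have "degree (monom 1 (l ^ 2) - 1 :: int poly) = l ^ 2"
      using l prime_gt_0_nat[OF l] by (subst diff_conv_add_uminus, subst degree_add_eq_left) (auto simp: degree_monom_eq)
    then show ?thesis using prime_gt_0_nat[OF l] by (simp add: coeff_1)
  qed
  then have "lead_coeff H * lead_coeff r = 1"
    unfolding r by (simp add: lead_coeff_mult)
  then have lcH: "lead_coeff H dvd 1" by (metis dvd_triv_left)
  have "s \<noteq> 0" using s nL1 by auto
  have "degree (H * s) > 0"
    using H \<open>s \<noteq> 0\<close> by (subst degree_mult_eq) auto
  moreover have "int l dvd coeff (H * s - 1) (degree (H * s))"
    using s by (simp add: L const_poly_dvd_iff)
  ultimately have "int l dvd lead_coeff H * lead_coeff s"
    by (simp add: lead_coeff_mult coeff_1)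
  then have ls: "int l dvd lead_coeff s"
    using lcH by (metis dvd_mult_unit_iff mult.commute)
  define s' where "s' = s - monom (lead_coeff s) (degree s)"
  have "L dvd monom (lead_coeff s) (degree s)"
    using ls by (simp add: L const_poly_dvd_iff)
  from dvd_diff[OF s dvd_mult[OF this, of H]]
  have "L dvd (H * s - 1) - H * monom (lead_coeff s) (degree s)" .
  then have L': "L dvd H * s' - 1"
    by (simp add: s'_def algebra_simps)
  have "degree s' < degree s \<or> s' = 0"
  proof (cases "degree s = 0")
    case True
    then show ?thesis by (auto simp: s'_def monom_0 elim!: degree_eq_zeroE)
  next
    case False
    have "degree s' \<le> degree s" "coeff s' (degree s) = 0"
      unfolding s'_def by (auto intro: degree_diff_le degree_monom_le)
    then show ?thesis by (metis le_neq_implies_less leading_coeff_0_iff)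
  qed
  then show False
    using min[OF L'] L' nL1 by auto
qed

definition int_eval :: "int poly \<Rightarrow> 'a :: field_char_0 \<Rightarrow> 'a" where
  "int_eval p x = poly (map_poly of_int p) x"

lemma int_eval_simps:
  "int_eval (p + q) x = int_eval p x + int_eval q x"
  "int_eval (p * q) x = int_eval p x * int_eval q x"
  "int_eval (smult c p) x = of_int c * int_eval p x"
  "int_eval (pCons c p) x = of_int c + x * int_eval p x"
  "int_eval 0 x = 0" "int_eval 1 x = 1" "int_eval (monom c n) x = of_int c * x ^ n"
proof -
  show *: "int_eval (p * q) x = int_eval p x * int_eval q x" for p q
    by (simp add: int_eval_def map_poly_hom_mult)
  show "int_eval (p + q) x = int_eval p x + int_eval q x"
    by (simp add: int_eval_def map_poly_hom_add)
  show "int_eval (pCons c p) x = of_int c + x * int_eval p x" for c p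
    by (simp add: int_eval_def map_poly_pCons)
  show "int_eval (smult c p) x = of_int c * int_eval p x"
    using *[of "[:c:]" p] by (simp add: int_eval_def map_poly_pCons)
  show "int_eval 0 x = 0" "int_eval 1 x = 1" "int_eval (monom c n) x = of_int c * x ^ n"
    by (auto simp: int_eval_def poly_monom map_poly_monom)
qed

lemma int_eval_sum: "int_eval (sum f A) x = (\<Sum>i\<in>A. int_eval (f i) x)"
  by (induction A rule: infinite_finite_induct) (auto simp: int_eval_simps)

lemma clear_denominators:
  fixes p :: "rat poly"
  shows "\<exists>d P. d \<noteq> 0 \<and> (\<forall>x :: 'a :: field_char_0. int_eval P x = of_int d * poly (map_poly of_rat p) x)"
proof (induction p)
  case 0
  show ?case by (intro exI[of _ 1] exI[of _ 0]) (simp add: int_eval_simps)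
next
  case (pCons c p)
  then obtain d P where d: "d \<noteq> 0" "\<forall>x :: 'a. int_eval P x = of_int d * poly (map_poly of_rat p) x"
    by blast
  obtain a b where ab: "c = Rat.Fract a b" "b > 0"
    by (cases c) auto
  have "of_int b * of_rat c = (of_int a :: 'a)"
    using ab by (simp add: of_rat_rat)
  then have "int_eval (pCons (a * d) (smult b P)) x = of_int (d * b) * poly (map_poly of_rat (pCons c p)) x" for x :: 'a
    using d(2) by (simp add: int_eval_simps map_poly_pCons algebra_simps)
  then show ?case
    using d(1) ab(2) by (intro exI[of _ "d * b"] exI[of _ "pCons (a * d) (smult b P)"]) auto
qed

text \<open>The polynomial \<Phi> is the cyclotomic polynomial of order \<open>l^2\<close>. It is
  irreducible because every nonconstant factor has a value at 1 divisible by \<open>l\<close>,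
  whereas \<Phi>(1) = \<open>l\<close>. So the primitive integer polynomial \<open>G\<close> of
  least degree vanishing at \<zeta> is \<Phi> up to a constant, and \<open>\<zeta>^(l+1)\<close> is
  another root of \<Phi>.\<close>

lemma cyclotomic_conjugate:
  fixes \<zeta> :: "'a :: field_char_0"
  assumes l: "Factorial_Ring.prime l" and \<zeta>: "\<zeta> ^ (l ^ 2) = 1" "\<zeta> ^ l \<noteq> 1"
    and p: "poly (map_poly of_rat p) \<zeta> = 0"
  shows "poly (map_poly of_rat p) (\<zeta> ^ Suc l) = 0"
proof -
  define I where "I = {P :: int poly. int_eval P \<zeta> = 0}"
  define \<Phi> where "\<Phi> = (\<Sum>i<l. monom 1 (l * i) :: int poly)"
  have \<Phi>_eval: "int_eval \<Phi> x * (x ^ l - 1) = x ^ (l ^ 2) - 1" for x :: 'a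
  proof -
    have "int_eval \<Phi> x = (\<Sum>i<l. (x ^ l) ^ i)"
      by (simp add: \<Phi>_def int_eval_sum int_eval_simps power_mult)
    then show ?thesis
      using power_diff_1_eq[of "x ^ l" l] by (simp add: mult.commute power_mult[symmetric] power2_eq_square)
  qed
  have \<Phi>_dvd: "\<Phi> dvd monom 1 (l ^ 2) - 1"
  proof -
    have "\<Phi> = (\<Sum>i<l. (monom 1 l) ^ i)"
      by (simp add: \<Phi>_def monom_power)
    then have "monom 1 (l ^ 2) - 1 = (monom 1 l - 1) * \<Phi>"
      using power_diff_1_eq[of "monom 1 l :: int poly" l] by (simp add: monom_power power2_eq_square)
    then show ?thesis by simp
  qed
  have \<Phi>1: "poly \<Phi> 1 = int l"
    by (simp add: \<Phi>_def poly_sum poly_monom)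
  have "int_eval \<Phi> \<zeta> = 0"
    using \<Phi>_eval[of \<zeta>] \<zeta> by auto
  then have "\<Phi> \<in> I" by (simp add: I_def)
  have "\<Phi> \<noteq> 0" using \<Phi>1 prime_gt_0_nat[OF l] by auto
  obtain G0 where G0: "G0 \<in> I" "G0 \<noteq> 0" "\<And>P. P \<in> I \<Longrightarrow> P \<noteq> 0 \<Longrightarrow> degree G0 \<le> degree P"
    using ex_has_least_nat[of "\<lambda>P. P \<in> I \<and> P \<noteq> 0" \<Phi> degree] \<open>\<Phi> \<in> I\<close> \<open>\<Phi> \<noteq> 0\<close> by auto
  define G where "G = primitive_part G0"
  have "of_int (content G0) * int_eval G \<zeta> = 0"
    using G0(1) by (simp add: I_def G_def flip: int_eval_simps(3))
  then have G: "G \<in> I" "G \<noteq> 0" "degree G = degree G0" "content G = 1"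
    using G0(2) by (auto simp: I_def G_def content_primitive_part)
  \<comment> \<open>Pseudo-division stays in the integers at the price of a factor \<open>a\<close>.
    Since \<open>G\<close> is primitive it is coprime to \<open>a\<close>, and the factor can be
    removed.\<close>
  have gen: "G dvd P" if P: "P \<in> I" for P
  proof -
    obtain a q where aq: "a \<noteq> 0" "smult a P = G * q + pseudo_mod P G"
      and deg: "pseudo_mod P G = 0 \<or> degree (pseudo_mod P G) < degree G"
      using pseudo_mod[OF G(2), of P] by blast
    have "of_int a * int_eval P \<zeta> = int_eval G \<zeta> * int_eval q \<zeta> + int_eval (pseudo_mod P G) \<zeta>"
      unfolding int_eval_simps(3)[symmetric] aq by (simp add: int_eval_simps)
    then have "pseudo_mod P G \<in> I"
      using P G(1) by (simp add: I_def)
    then have "pseudo_mod P G = 0"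
      using deg G0(3) G(3) by fastforce
    then have "smult a P = G * q" using aq(2) by simp
    then have "G dvd [:a:] * P" by simp
    moreover have "coprime G [:a:]"
    proof (rule coprimeI)
      fix c assume c: "c dvd G" "c dvd [:a:]"
      then have "degree c = 0"
        using dvd_imp_degree_le[of c "[:a:]"] aq(1) by simp
      then obtain c0 where c0: "c = [:c0:]" by (elim degree_eq_zeroE)
      then have "c0 dvd content G"
        using c(1) by (simp add: const_poly_dvd_iff_dvd_content)
      then show "is_unit c" using G(4) c0 by (simp add: is_unit_const_poly_iff)
    qed
    ultimately show ?thesis using coprime_dvd_mult_right_iff[of G "[:a:]" P] by blast
  qed
  have "degree G > 0"
  proof (rule ccontr)
    assume "\<not> degree G > 0"
    then obtain c where "G = [:c:]" by (auto elim: degree_eq_zeroE)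
    then show False using G by (simp add: I_def int_eval_simps)
  qed
  obtain Q where Q: "\<Phi> = G * Q" using gen[OF \<open>\<Phi> \<in> I\<close>] by (elim dvdE)
  have "degree Q = 0"
  proof (rule ccontr)
    assume "degree Q \<noteq> 0"
    moreover have "G dvd monom 1 (l ^ 2) - 1" "Q dvd monom 1 (l ^ 2) - 1"
      using \<Phi>_dvd unfolding Q by (meson dvd_mult_left dvd_mult_right)+
    ultimately have "int l dvd poly G 1" "int l dvd poly Q 1"
      using dvd_value_at_1_of_dvd_power_minus_1[OF l] \<open>degree G > 0\<close> by auto
    then have "int l * int l dvd poly \<Phi> 1"
      unfolding Q poly_mult by (rule mult_dvd_mono)
    then show False
      using \<Phi>1 prime_gt_1_nat[OF l] by (simp flip: of_nat_mult)
  qed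
  then obtain c where c: "Q = [:c:]" by (elim degree_eq_zeroE)
  then have "c \<noteq> 0" using Q \<open>\<Phi> \<noteq> 0\<close> by auto
  obtain d P where P: "d \<noteq> 0" "\<And>x :: 'a. int_eval P x = of_int d * poly (map_poly of_rat p) x"
    using clear_denominators by metis
  have "P \<in> I" using P p by (simp add: I_def)
  from gen[OF this] obtain S where S: "P = G * S" by (elim dvdE)
  let ?\<xi> = "\<zeta> ^ Suc l"
  have "?\<xi> ^ (l ^ 2) = 1"
    by (metis \<zeta>(1) mult.commute power_mult power_one)
  moreover have "?\<xi> ^ l = \<zeta> ^ l"
    using \<zeta>(1) by (simp add: power_mult_distrib power2_eq_square flip: power_mult)
  ultimately have "int_eval \<Phi> ?\<xi> = 0"
    using \<Phi>_eval[of ?\<xi>] \<zeta>(2) by auto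
  then have "int_eval G ?\<xi> = 0"
    using \<open>c \<noteq> 0\<close> unfolding Q c by (simp add: int_eval_simps)
  then have "int_eval P ?\<xi> = 0"
    unfolding S by (simp add: int_eval_simps)
  then show ?thesis using P by simp
qed

text \<open>Approximations of the idempotent of \<open>\<Prod>\<^sub>p \<int>\<^sub>p\<close> that projects onto \<open>\<int>\<^sub>l\<close>: raising to the power
  \<open>N j\<close> extracts the \<open>l\<close>-part of an element whose order divides \<open>j!\<close>.\<close>

lemma ex_l_idempotent:
  assumes l: "Factorial_Ring.prime (l :: nat)"
  obtains N :: "nat \<Rightarrow> nat" where
    "\<And>i j. j \<le> i \<Longrightarrow> [N i = N j] (mod fact j)"
    "\<And>j. \<exists>n. fact j dvd l ^ n * N j"
    "\<And>a j. l ^ a dvd fact j \<Longrightarrow> [N j = 1] (mod l ^ a)"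
proof -
  have "\<exists>a b x. fact j = l ^ a * b \<and> coprime l b \<and> [x = 1] (mod l ^ a) \<and> [x = 0] (mod b)" for j
  proof -
    obtain b where b: "fact j = l ^ multiplicity l (fact j) * b" "\<not> l dvd b"
      using l by (metis fact_nonzero multiplicity_decompose' not_prime_unit)
    then have c: "coprime l b" using l by (simp add: prime_imp_coprime)
    then have "coprime (l ^ multiplicity l (fact j)) b" by simp
    then show ?thesis using b c binary_chinese_remainder_nat by metis
  qed
  then obtain a b N where N: "\<And>j. fact j = l ^ a j * b j" "\<And>j. coprime l (b j)"
    "\<And>j. [N j = 1] (mod l ^ a j)" "\<And>j. [N j = (0::nat)] (mod b j)"
    by metis
  show thesis
  proof
    fix i j :: nat assume "j \<le> i"
    then have d: "(fact j :: nat) dvd fact i" by (rule fact_dvd)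
    have "l ^ a j dvd l ^ a i * b i"
      using d by (metis N(1) dvd_mult_left)
    then have "l ^ a j dvd l ^ a i"
      using N(2) by (simp add: coprime_dvd_mult_left_iff)
    then have 1: "[N i = N j] (mod l ^ a j)"
      using N(3) by (meson cong_dvd_modulus_nat cong_sym cong_trans)
    have "b j dvd l ^ a i * b i"
      using d by (metis N(1) dvd_mult_right)
    then have "b j dvd b i"
      using N(2) by (metis coprime_commute coprime_dvd_mult_right_iff coprime_power_right_iff)
    then have 2: "[N i = N j] (mod b j)"
      using N(4) by (meson cong_dvd_modulus_nat cong_sym cong_trans)
    show "[N i = N j] (mod fact j)"
      using 1 2 N(1,2) by (simp add: coprime_cong_mult_nat)
  next
    fix j show "\<exists>n. fact j dvd l ^ n * N j"
      using N(1,4) by (metis cong_0_iff dvd_refl mult_dvd_mono)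
  next
    fix c j assume "l ^ c dvd fact j"
    then have "l ^ c dvd l ^ a j"
      using N(1,2) by (metis coprime_dvd_mult_left_iff coprime_power_left_iff)
    then show "[N j = 1] (mod l ^ c)"
      using N(3) cong_dvd_modulus_nat by blast
  qed
qed

section \<open>The \<open>l\<close>-part of an automorphism, and an \<open>l\<close>-primary
  character of the rationals\<close>

lemma funpow_periodic:
  assumes "inj f" "finite (range (\<lambda>n :: nat. (f ^^ n) x))"
  obtains n where "n > 0" "(f ^^ n) x = x"
proof -
  have "\<not> inj (\<lambda>n :: nat. (f ^^ n) x)"
    using assms(2) finite_imageD infinite_UNIV_nat by blast
  then obtain i j where ij: "i < j" "(f ^^ i) x = (f ^^ j) x"
    by (metis injI linorder_neqE_nat)
  then have "(f ^^ i) ((f ^^ (j - i)) x) = (f ^^ i) x"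
    by (metis comp_apply funpow_add le_add_diff_inverse less_imp_le_nat)
  then have "(f ^^ (j - i)) x = x"
    using inj_fn[OF assms(1)] by (simp add: inj_eq)
  then show thesis using that ij(1) by (metis zero_less_diff)
qed

lemma funpow_cong:
  assumes "(f ^^ p) x = x" "[a = b] (mod p)"
  shows "(f ^^ a) x = (f ^^ b) x"
  using assms by (metis cong_def funpow_mod_eq)

text \<open>The powers of \<psi> have a procyclic closure, and \<phi> is the
  \<open>l\<close>-component of \<psi> there: on \<open>x\<close> it is \<open>\<psi>^(N j)\<close>
  for any \<open>j\<close> with \<open>\<psi>^(j!) x = x\<close>. The congruences between the
  \<open>N j\<close> make the choice of \<open>j\<close> immaterial, so one \<open>j\<close> serves
  two arguments at once and \<phi> inherits additivity and multiplicativity.\<close>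

lemma ex_l_part:
  fixes \<psi> :: "'a :: field \<Rightarrow> 'a"
  assumes l: "Factorial_Ring.prime (l :: nat)" and \<psi>: "field_embedding \<psi>"
    and per: "\<And>x. \<exists>n>0. (\<psi> ^^ n) x = x"
  obtains \<phi> where "field_embedding \<phi>" "\<And>x. \<exists>n. (\<phi> ^^ (l ^ n)) x = x"
    "\<And>x a. (\<psi> ^^ (l ^ a)) x = x \<Longrightarrow> \<phi> x = \<psi> x"
proof -
  interpret field_embedding \<psi> by fact
  obtain N :: "nat \<Rightarrow> nat" where N:
    "\<And>i j. j \<le> i \<Longrightarrow> [N i = N j] (mod fact j)"
    "\<And>j. \<exists>n. fact j dvd l ^ n * N j"
    "\<And>a j. l ^ a dvd fact j \<Longrightarrow> [N j = 1] (mod l ^ a)"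
    using ex_l_idempotent[OF l] by blast
  have fix_mult: "(\<psi> ^^ m) x = x" if "(\<psi> ^^ n) x = x" "n dvd m" for n m x
    using funpow_cong[of n \<psi> x m 0] that by (simp add: cong_0_iff)
  define J where "J x = (SOME j. (\<psi> ^^ fact j) x = x)" for x
  define \<phi> where "\<phi> x = (\<psi> ^^ N (J x)) x" for x
  have ex_J: "\<exists>j. \<forall>i\<ge>j. (\<psi> ^^ fact i) x = x" for x
  proof -
    obtain n where "n > 0" "(\<psi> ^^ n) x = x" using per by blast
    then show ?thesis
      by (metis dvd_fact fix_mult One_nat_def Suc_leI)
  qed
  have J: "(\<psi> ^^ fact (J x)) x = x" for x
    unfolding J_def using ex_J[of x] someI_ex[of "\<lambda>j. (\<psi> ^^ fact j) x = x"] by blast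
  have \<phi>: "\<phi> x = (\<psi> ^^ N j) x" if "(\<psi> ^^ fact j) x = x" for x j
  proof (cases "j \<le> J x")
    case True
    then show ?thesis
      unfolding \<phi>_def using funpow_cong[OF that N(1)] by blast
  next
    case False
    then show ?thesis
      unfolding \<phi>_def using funpow_cong[OF J N(1)] by (metis nat_le_linear)
  qed
  have emb: "field_embedding (\<psi> ^^ n)" for n
    by (induction n) (auto simp: field_embedding_def add mult one)
  have hom: "\<phi> (x + y) = \<phi> x + \<phi> y \<and> \<phi> (x * y) = \<phi> x * \<phi> y" for x y
  proof -
    obtain i i' where "\<forall>k\<ge>i. (\<psi> ^^ fact k) x = x" "\<forall>k\<ge>i'. (\<psi> ^^ fact k) y = y"
      using ex_J by blast
    then obtain j where j: "(\<psi> ^^ fact j) x = x" "(\<psi> ^^ fact j) y = y"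
      by (metis nat_le_linear)
    then have "(\<psi> ^^ fact j) (x + y) = x + y" "(\<psi> ^^ fact j) (x * y) = x * y"
      using emb by (auto simp: field_embedding_def)
    then show ?thesis
      using emb[of "N j"] \<phi>[of j] j by (auto simp: field_embedding_def)
  qed
  have "\<phi> 1 = 1"
    using emb by (simp add: \<phi>_def field_embedding_def)
  then have "field_embedding \<phi>"
    using hom by (simp add: field_embedding_def)
  moreover have "\<exists>n. (\<phi> ^^ (l ^ n)) x = x" for x
  proof -
    define j where "j = J x"
    have pow: "(\<phi> ^^ m) x = (\<psi> ^^ (m * N j)) x" for m
    proof (induction m)
      case (Suc m)
      have "(\<psi> ^^ fact j) ((\<psi> ^^ (m * N j)) x) = (\<psi> ^^ (m * N j)) ((\<psi> ^^ fact j) x)"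
        by (metis add.commute comp_apply funpow_add)
      then have "\<phi> ((\<psi> ^^ (m * N j)) x) = (\<psi> ^^ N j) ((\<psi> ^^ (m * N j)) x)"
        using J[of x] by (intro \<phi>) (simp add: j_def)
      then show ?case using Suc by (simp add: funpow_add)
    qed simp
    obtain n where "fact j dvd l ^ n * N j" using N(2) by blast
    then show ?thesis using pow fix_mult[OF J[of x]] unfolding j_def by metis
  qed
  moreover have "\<phi> x = \<psi> x" if a: "(\<psi> ^^ (l ^ a)) x = x" for x a
  proof -
    have "l ^ a dvd fact (l ^ a)"
      using prime_gt_0_nat[OF l] by (intro dvd_fact) auto
    then have "(\<psi> ^^ fact (l ^ a)) x = x" "[N (l ^ a) = 1] (mod l ^ a)"
      using a fix_mult N(3) by blast+
    then have "\<phi> x = (\<psi> ^^ 1) x"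
      using \<phi> funpow_cong[OF a] by metis
    then show ?thesis by simp
  qed
  ultimately show thesis using that by blast
qed

text \<open>The map projects \<rat>/\<int> onto its \<open>l\<close>-primary part and then applies
  the exponential: \<open>E q\<close> is \<open>exp(2 \<pi> i N q)\<close> with \<open>N\<close>
  approximating the idempotent. It is defined on all rationals, not only on those with
  \<open>l\<close>-power denominator, because its arguments will be rational coordinates of
  arbitrary real exponents.\<close>

lemma ex_l_primary_character:
  assumes l: "Factorial_Ring.prime (l :: nat)"
  obtains E :: "rat \<Rightarrow> complex" where "\<And>q r. E (q + r) = E q * E r" "\<And>q. \<exists>n. E q ^ (l ^ n) = 1"
    "E 1 = 1" "E (1 / of_nat l) \<noteq> 1"
proof -
  obtain N :: "nat \<Rightarrow> nat" where N:
    "\<And>i j. j \<le> i \<Longrightarrow> [N i = N j] (mod fact j)"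
    "\<And>j. \<exists>n. fact j dvd l ^ n * N j"
    "\<And>a j. l ^ a dvd fact j \<Longrightarrow> [N j = 1] (mod l ^ a)"
    using ex_l_idempotent[OF l] by blast
  have of_rat_fact: "(of_rat (fact j) :: real) = fact j" for j
    by (metis of_nat_fact of_rat_of_nat_eq)
  define J where "J q = (SOME j. q * fact j \<in> \<int>)" for q :: rat
  define e where "e j q = cis (2 * pi * (of_rat q * N j))" for j and q :: rat
  have ex_J: "\<exists>j. \<forall>i\<ge>j. q * fact i \<in> \<int>" for q :: rat
  proof -
    obtain a b where ab: "q = Rat.Fract a b" "b > 0" by (cases q) auto
    have "q * fact i \<in> \<int>" if "nat b \<le> i" for i
    proof -
      have "nat b dvd fact i" using that ab by (intro dvd_fact) auto
      then obtain c where "fact i = nat b * c" by (elim dvdE)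
      then have "(fact i :: rat) = of_nat (nat b * c)" by (metis of_nat_fact)
      then have "q * fact i = of_int (a * int c)"
        using ab by (simp add: Fract_of_int_quotient)
      then show ?thesis by simp
    qed
    then show ?thesis by blast
  qed
  have J: "q * fact (J q) \<in> \<int>" for q
    unfolding J_def using ex_J[of q] someI_ex[of "\<lambda>j. q * fact j \<in> \<int>"] by blast
  have e_le: "e i q = e j q" if le: "j \<le> i" and q: "q * fact j \<in> \<int>" for i j q
  proof -
    obtain k where "int (N i) - int (N j) = fact j * k"
      using N(1)[OF le] by (metis cong_iff_dvd_diff cong_int_iff dvdE of_nat_fact)
    then have "real (N i) - real (N j) = fact j * of_int k"
      by (metis of_int_diff of_int_fact of_int_mult of_int_of_nat_eq)
    then have "real (N i) = real (N j) + fact j * of_int k"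
      by simp
    then have "of_rat q * real (N i) = of_rat q * real (N j) + of_rat (q * fact j) * of_int k"
      by (simp add: of_rat_mult distrib_left of_rat_fact)
    moreover have "(of_rat (q * fact j) :: real) * of_int k \<in> \<int>"
      using q by (auto elim!: Ints_cases)
    ultimately show ?thesis
      unfolding e_def by (simp add: distrib_left cis_multiple_2pi flip: cis_mult)
  qed
  define E where "E q = e (J q) q" for q
  have E: "E q = e j q" if "q * fact j \<in> \<int>" for q j
    unfolding E_def using e_le[OF _ that] e_le[OF _ J] by (metis nat_le_linear)
  show thesis
  proof
    fix q r :: rat
    obtain i i' where "\<forall>k\<ge>i. q * fact k \<in> \<int>" "\<forall>k\<ge>i'. r * fact k \<in> \<int>"
      using ex_J by metis
    then obtain j where j: "q * fact j \<in> \<int>" "r * fact j \<in> \<int>"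
      by (metis nat_le_linear)
    then have "(q + r) * fact j \<in> \<int>" by (simp add: distrib_right)
    from E[OF this] E[OF j(1)] E[OF j(2)] show "E (q + r) = E q * E r"
      by (simp add: e_def of_rat_add cis_mult algebra_simps)
  next
    fix q :: rat
    obtain n c where "l ^ n * N (J q) = fact (J q) * c"
      using N(2) by (metis dvdE)
    then have "real (l ^ n) * real (N (J q)) = fact (J q) * real c"
      by (metis of_nat_fact of_nat_mult)
    then have "real (l ^ n) * (of_rat q * real (N (J q))) = of_rat (q * fact (J q)) * real c"
      by (simp add: of_rat_mult of_rat_fact)
    moreover have "(of_rat (q * fact (J q)) :: real) * real c \<in> \<int>"
      using J[of q] by (auto elim!: Ints_cases)
    ultimately have "cis (2 * pi * (real (l ^ n) * (of_rat q * real (N (J q))))) = 1"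
      using cis_multiple_2pi by metis
    moreover have "E q ^ (l ^ n) = cis (real (l ^ n) * (2 * pi * (of_rat q * real (N (J q)))))"
      unfolding E_def e_def by (rule Complex.DeMoivre)
    ultimately have "E q ^ (l ^ n) = 1"
      by (metis mult.left_commute)
    then show "\<exists>n. E q ^ (l ^ n) = 1" ..
  next
    have "E 1 = e 0 1" by (rule E) simp
    also have "\<dots> = 1" by (simp add: e_def cis_multiple_2pi)
    finally show "E 1 = 1" .
  next
    obtain c :: nat where c: "fact l = l * c"
      using prime_gt_0_nat[OF l] dvd_fact[of l l] by (auto elim: dvdE)
    then have "(fact l :: rat) = of_nat l * of_nat c"
      by (metis of_nat_fact of_nat_mult)
    then have "(1 / of_nat l :: rat) * fact l = of_nat c"
      using prime_gt_0_nat[OF l] by simp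
    then have 1: "E (1 / of_nat l) = e l (1 / of_nat l)"
      by (intro E) simp
    \<comment> \<open>As \<open>N l\<close> is 1 modulo \<open>l\<close>, the projection does not
      disturb \<open>1/l\<close>, and \<open>E (1/l)\<close> is the standard primitive
      \<open>l\<close>-th root of unity.\<close>
    have "[N l = 1] (mod l ^ 1)"
      using c by (intro N(3)) simp
    then obtain k where "int (N l) - 1 = int l * k"
      by (metis cong_iff_dvd_diff cong_int_iff dvdE of_nat_1 power_one_right)
    then have "real (N l) = 1 + real l * of_int k"
      by (metis add.commute diff_add_cancel of_int_add of_int_mult of_int_of_nat_eq of_int_1)
    moreover have "of_rat (1 / of_nat l) = 1 / real l"
      by (simp add: of_rat_divide)
    ultimately have "of_rat (1 / of_nat l) * real (N l) = 1 / real l * (1 + real l * of_int k)"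
      by (simp only:)
    also have "\<dots> = 1 / real l + of_int k"
      using prime_gt_0_nat[OF l] by (simp add: distrib_left)
    finally have *: "of_rat (1 / of_nat l) * real (N l) = 1 / real l + of_int k" .
    have "E (1 / of_nat l) = cis (2 * pi * (1 / l)) * cis (2 * pi * of_int k)"
      unfolding 1 e_def * by (simp only: distrib_left cis_mult)
    then have "E (1 / of_nat l) = cis (2 * pi / l)"
      by (simp add: cis_multiple_2pi)
    moreover have "cis (2 * pi / l) \<noteq> 1"
    proof
      assume "cis (2 * pi / l) = 1"
      then have "cos (2 * pi / l) = 1" by (metis cis.simps(1) one_complex.simps(1))
      then obtain n :: int where "2 * pi / l = of_int n * 2 * pi"
        using cos_one_2pi_int by auto
      then have "(2 * pi) * (1 / real l) = (2 * pi) * of_int n" by simp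
      then have "1 / real l = of_int n"
        by (subst (asm) mult_left_cancel) auto
      then have "1 = of_int n * real l"
        using prime_gt_0_nat[OF l] by (simp add: field_simps)
      then have "real_of_int (n * int l) = real_of_int 1" by simp
      then have "n * int l = 1" by (simp only: of_int_eq_iff)
      then show False using prime_gt_1_nat[OF l] by (simp add: zmult_eq_1_iff)
    qed
    ultimately show "E (1 / of_nat l) \<noteq> 1" by simp
  qed
qed

section \<open>The algebraic numbers with their automorphism and character\<close>

type_synonym qbar = "rat alg_closure"

lemma qbar_algebraic:
  fixes x :: qbar
  shows "\<exists>p :: rat poly. p \<noteq> 0 \<and> poly (map_poly of_rat p) x = 0"
proof -
  have "to_ac q = of_rat q" for q
  proof (cases q)
    case (Fract a b)
    then have "of_int b * q = (of_int a :: rat)" "b \<noteq> 0"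
      by (auto simp: Fract_of_int_quotient)
    then have "of_int b * to_ac q = of_int a" "b \<noteq> 0"
      by (metis to_ac_mult to_ac_of_int)+
    then show ?thesis
      using Fract by (simp add: of_rat_rat field_simps)
  qed
  then have "to_ac = (of_rat :: rat \<Rightarrow> qbar)" by blast
  then show ?thesis using alg_closure_algebraic[of x] by metis
qed

text \<open>The prescribed pair is the trivial one, 0 to 0. The complex numbers supply the
  exponential function behind \<open>E\<close> and, at the end, a bound on the number of algebraic
  numbers.\<close>

lemma ex_embedding_into_complex:
  obtains h :: "qbar \<Rightarrow> complex" where "field_embedding h"
proof (rule ex_field_embedding[of "0 :: qbar" "0 :: complex"])
  fix p :: "rat poly"
  assume "poly (map_poly of_rat p) (0 :: qbar) = 0"
  then show "poly (map_poly of_rat p) (0 :: complex) = 0"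
    by (simp add: poly_0_coeff_0 coeff_map_poly)
qed (use qbar_algebraic that in auto)

text \<open>The exponent \<open>1 + l\<close> moves \<zeta> but fixes \<open>\<zeta>^l\<close>.
  Since \<open>(1 + l)^n\<close> is \<open>1 + n l\<close> modulo \<open>l^2\<close>, the
  automorphism \<psi> has order \<open>l\<close> on \<zeta>, and its \<open>l\<close>-part \<phi>
  agrees with it there. The values of \<open>E\<close> are roots of unity and therefore come from
  \<open>qbar\<close>.\<close>

lemma ex_automorphism_and_character:
  assumes l: "Factorial_Ring.prime (l :: nat)"
  obtains \<phi> :: "qbar \<Rightarrow> qbar" and e :: "rat \<Rightarrow> qbar" where
    "field_embedding \<phi>" "\<And>x. \<exists>n. (\<phi> ^^ (l ^ n)) x = x"
    "\<And>q r. e (q + r) = e q * e r" "\<And>q. \<exists>n. e q ^ (l ^ n) = 1" "e 1 = 1" "e (1 / of_nat l) \<noteq> 1"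
    "\<phi> (e (1 / of_nat l ^ 2)) = e (1 / of_nat l ^ 2) ^ Suc l"
proof -
  obtain h :: "qbar \<Rightarrow> complex" where h: "field_embedding h"
    by (rule ex_embedding_into_complex)
  interpret h: field_embedding h by fact
  obtain E :: "rat \<Rightarrow> complex" where E: "\<And>q r. E (q + r) = E q * E r" "\<And>q. \<exists>n. E q ^ (l ^ n) = 1"
    "E 1 = 1" "E (1 / of_nat l) \<noteq> 1"
    by (rule ex_l_primary_character[OF l]) blast
  have "\<exists>x. h x = E q" for q
  proof -
    obtain n where n: "E q ^ (l ^ n) = 1" using E(2) by blast
    define p where "p = monom 1 (l ^ n) - (1 :: rat poly)"
    have "poly p 0 \<noteq> 0"
      using prime_gt_0_nat[OF l] by (auto simp: p_def poly_monom power_0_left)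
    then have "p \<noteq> 0" by auto
    moreover have "map_poly of_rat p = monom 1 (l ^ n) - (1 :: complex poly)"
      by (rule poly_eqI) (simp add: p_def coeff_map_poly of_rat_diff coeff_1)
    then have "poly (map_poly of_rat p) (E q) = 0"
      using n by (simp add: poly_monom)
    ultimately show ?thesis using root_in_range_field_embedding[OF h] by (metis rangeE)
  qed
  then obtain e where e: "\<And>q. h (e q) = E q" by metis
  have e_add: "e (q + r) = e q * e r" for q r
    by (simp add: e E h.mult flip: h.eq_iff)
  have e_l: "\<exists>n. e q ^ (l ^ n) = 1" for q
    using E(2)[of q] by (simp add: e h.power h.one flip: h.eq_iff)
  have e_1: "e 1 = 1" by (simp add: e E h.one flip: h.eq_iff)
  have e_neq: "e (1 / of_nat l) \<noteq> 1" using E(4) by (simp add: e h.one flip: h.eq_iff)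
  have e_of_nat: "e (of_nat n * q) = e q ^ n" for n q
  proof (induction n)
    case 0
    have "e 0 = e 0 * e 0" using e_add[of 0 0] by simp
    moreover have "e 0 \<noteq> 0" using e_add[of 0 1] e_1 by auto
    ultimately show ?case by simp
  next
    case (Suc n)
    then show ?case by (simp add: e_add distrib_right)
  qed
  define \<zeta> where "\<zeta> = e (1 / of_nat l ^ 2)"
  have l0: "l > 0" using prime_gt_0_nat[OF l] .
  have \<zeta>: "\<zeta> ^ (l ^ 2) = 1" "\<zeta> ^ l \<noteq> 1"
    using e_of_nat[of "l ^ 2" "1 / of_nat l ^ 2"] e_of_nat[of l "1 / of_nat l ^ 2"] e_1 e_neq l0
    by (auto simp: \<zeta>_def power2_eq_square)
  obtain \<psi> :: "qbar \<Rightarrow> qbar" where \<psi>: "field_embedding \<psi>" "\<psi> \<zeta> = \<zeta> ^ Suc l"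
    using ex_field_embedding[OF qbar_algebraic cyclotomic_conjugate[OF l \<zeta>]] by metis
  interpret \<psi>: field_embedding \<psi> by fact
  have per: "\<exists>n>0. (\<psi> ^^ n) x = x" for x
  proof -
    obtain p :: "rat poly" where p: "p \<noteq> 0" "poly (map_poly of_rat p) x = 0"
      using qbar_algebraic by blast
    have "poly (map_poly of_rat p) ((\<psi> ^^ n) x) = 0" for n
      by (induction n) (auto simp: p \<psi>.zero simp flip: field_embedding_ratpoly[OF \<psi>(1)])
    then have "range (\<lambda>n. (\<psi> ^^ n) x) \<subseteq> {y. poly (map_poly of_rat p) y = 0}" by auto
    moreover have "finite {y :: qbar. poly (map_poly of_rat p) y = 0}"
      using p(1) by (intro poly_roots_finite) (simp add: map_poly_eq_0_iff)
    ultimately show ?thesis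
      using funpow_periodic[OF \<psi>.inj] finite_subset by metis
  qed
  obtain \<phi> where \<phi>: "field_embedding \<phi>" "\<And>x. \<exists>n. (\<phi> ^^ (l ^ n)) x = x"
    "\<And>x a. (\<psi> ^^ (l ^ a)) x = x \<Longrightarrow> \<phi> x = \<psi> x"
    by (rule ex_l_part[OF l \<psi>(1) per]) blast
  have "(\<psi> ^^ n) \<zeta> = \<zeta> ^ (1 + n * l)" for n
  proof (induction n)
    case (Suc n)
    have "(\<zeta> ^ Suc l) ^ (1 + n * l) = \<zeta> ^ (1 + Suc n * l + l\<^sup>2 * n)"
      unfolding power_mult[symmetric] by (rule arg_cong[of _ _ "power \<zeta>"]) (simp add: algebra_simps power2_eq_square)
    also have "\<dots> = \<zeta> ^ (1 + Suc n * l)"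
      by (simp add: power_add power_mult \<zeta>(1))
    finally show ?case using Suc by (simp add: \<psi>.power \<psi>(2) del: power_Suc)
  qed simp
  then have "(\<psi> ^^ (l ^ 1)) \<zeta> = \<zeta> * \<zeta> ^ (l ^ 2)"
    by (simp add: power2_eq_square)
  then have "(\<psi> ^^ (l ^ 1)) \<zeta> = \<zeta>"
    using \<zeta>(1) by simp
  from \<phi>(3)[OF this] have "\<phi> \<zeta> = \<zeta> ^ Suc l"
    using \<psi>(2) by simp
  then show thesis
    using that \<phi>(1,2) e_add e_l e_1 e_neq unfolding \<zeta>_def by blast
qed

section \<open>Levi-Civita series\<close>

text \<open>Finiteness below every bound, in place of the well-ordered supports of Hahn series,
  makes each coefficient of a product a finite sum and makes limits of sequences sufficient for
  completeness.\<close>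

definition left_finite :: "(real \<Rightarrow> 'a :: zero) \<Rightarrow> bool" where
  "left_finite f \<longleftrightarrow> (\<forall>r. finite {x. x \<le> r \<and> f x \<noteq> 0})"

lemma left_finite_lower_bound:
  assumes "left_finite f"
  obtains m where "\<And>x. x < m \<Longrightarrow> f x = 0"
proof -
  let ?S = "{x. x \<le> 0 \<and> f x \<noteq> 0}"
  have fin: "finite (insert 0 ?S)" using assms by (auto simp: left_finite_def)
  show thesis
  proof (rule that)
    fix x assume x: "x < Min (insert 0 ?S)"
    then have "x < 0" using fin by auto
    show "f x = 0"
    proof (rule ccontr)
      assume "f x \<noteq> 0"
      then have "x \<in> insert 0 ?S" using \<open>x < 0\<close> by auto
      then show False using x fin by (meson Min_le leD)
    qed
  qed
qed

lemma left_finite_subset: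
  assumes "left_finite f" "\<And>x. g x \<noteq> 0 \<Longrightarrow> f x \<noteq> 0"
  shows "left_finite g"
  unfolding left_finite_def
proof
  fix r show "finite {x. x \<le> r \<and> g x \<noteq> 0}"
    by (rule finite_subset[of _ "{x. x \<le> r \<and> f x \<noteq> 0}"])
       (use assms in \<open>auto simp: left_finite_def\<close>)
qed

definition conv :: "(real \<Rightarrow> 'a :: comm_ring_1) \<Rightarrow> (real \<Rightarrow> 'a) \<Rightarrow> real \<Rightarrow> 'a" where
  "conv f g c = (\<Sum>a | f a \<noteq> 0 \<and> g (c - a) \<noteq> 0. f a * g (c - a))"

lemma conv_support_finite:
  assumes "left_finite f" "left_finite g"
  shows "finite {a. f a \<noteq> 0 \<and> g (c - a) \<noteq> 0}"
proof -
  obtain m where m: "\<And>x. x < m \<Longrightarrow> g x = 0"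
    by (rule left_finite_lower_bound[OF assms(2)]) blast
  have "{a. f a \<noteq> 0 \<and> g (c - a) \<noteq> 0} \<subseteq> {a. a \<le> c - m \<and> f a \<noteq> 0}"
  proof safe
    fix a assume "g (c - a) \<noteq> 0"
    then have "\<not> c - a < m" using m by blast
    then show "a \<le> c - m" by linarith
  qed
  then show ?thesis
    by (rule finite_subset) (use assms(1) in \<open>auto simp: left_finite_def\<close>)
qed

lemma conv_eq:
  assumes "finite A" "{a. f a \<noteq> 0 \<and> g (c - a) \<noteq> 0} \<subseteq> A"
  shows "conv f g c = (\<Sum>a\<in>A. f a * g (c - a))"
  unfolding conv_def by (rule sum.mono_neutral_left) (use assms in auto)

lemma conv_nonzero:
  assumes "conv f g c \<noteq> 0"
  obtains a b where "f a \<noteq> 0" "g b \<noteq> 0" "c = a + b"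
proof -
  obtain a where "a \<in> {a. f a \<noteq> 0 \<and> g (c - a) \<noteq> 0}"
    using assms unfolding conv_def by (rule sum.not_neutral_contains_not_neutral)
  then show thesis using that[of a "c - a"] by auto
qed

lemma left_finite_conv:
  assumes "left_finite f" "left_finite g"
  shows "left_finite (conv f g)"
  unfolding left_finite_def
proof
  fix r
  obtain m where m: "\<And>x. x < m \<Longrightarrow> f x = 0"
    by (rule left_finite_lower_bound[OF assms(1)]) blast
  obtain n where n: "\<And>x. x < n \<Longrightarrow> g x = 0"
    by (rule left_finite_lower_bound[OF assms(2)]) blast
  let ?A = "{a. a \<le> r - n \<and> f a \<noteq> 0}" and ?B = "{b. b \<le> r - m \<and> g b \<noteq> 0}"
  have "{c. c \<le> r \<and> conv f g c \<noteq> 0} \<subseteq> (\<lambda>(a, b). a + b) ` (?A \<times> ?B)"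
  proof safe
    fix c assume c: "c \<le> r" "conv f g c \<noteq> 0"
    obtain a b where ab: "f a \<noteq> 0" "g b \<noteq> 0" "c = a + b"
      by (rule conv_nonzero[OF c(2)]) blast
    then have "m \<le> a" "n \<le> b" using m n by (meson not_le)+
    then show "c \<in> (\<lambda>(a, b). a + b) ` (?A \<times> ?B)"
      using ab c by (intro image_eqI[of _ _ "(a, b)"]) auto
  qed
  moreover have "finite (?A \<times> ?B)"
    using assms by (auto simp: left_finite_def)
  ultimately show "finite {c. c \<le> r \<and> conv f g c \<noteq> 0}"
    by (metis (lifting) finite_imageI finite_subset)
qed

lemma conv_commute:
  assumes "left_finite f" "left_finite g"
  shows "conv f g c = conv g f c"
  unfolding conv_def
  by (rule sum.reindex_bij_witness[of _ "\<lambda>a. c - a" "\<lambda>a. c - a"]) (auto simp: mult.commute)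

lemma conv_add_left:
  assumes "left_finite f" "left_finite f'" "left_finite g"
  shows "conv (\<lambda>x. f x + f' x) g c = conv f g c + conv f' g c"
proof -
  let ?A = "{a. f a \<noteq> 0 \<and> g (c - a) \<noteq> 0} \<union> {a. f' a \<noteq> 0 \<and> g (c - a) \<noteq> 0}"
  have fin: "finite ?A" using conv_support_finite assms by blast
  have "conv (\<lambda>x. f x + f' x) g c = (\<Sum>a\<in>?A. (f a + f' a) * g (c - a))"
    by (rule conv_eq[OF fin]) auto
  also have "\<dots> = (\<Sum>a\<in>?A. f a * g (c - a)) + (\<Sum>a\<in>?A. f' a * g (c - a))"
    by (simp add: distrib_right sum.distrib)
  also have "\<dots> = conv f g c + conv f' g c"
    by (intro arg_cong2[of _ _ _ _ "(+)"] conv_eq[symmetric] fin) auto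
  finally show ?thesis .
qed

text \<open>Lower bounds of the three supports confine the indices contributing to \<open>c\<close>
  to the finite sets \<open>A\<close> and \<open>D\<close>. Once both sums are extended to
  \<open>A\<close> and \<open>B = A + D\<close>, the summations can be exchanged.\<close>

lemma conv_assoc:
  assumes f: "left_finite f" and g: "left_finite g" and h: "left_finite h"
  shows "conv (conv f g) h c = conv f (conv g h) c"
proof -
  obtain m where m: "\<And>x. x < m \<Longrightarrow> f x = 0"
    by (rule left_finite_lower_bound[OF f]) blast
  obtain n where n: "\<And>x. x < n \<Longrightarrow> g x = 0"
    by (rule left_finite_lower_bound[OF g]) blast
  obtain k where k: "\<And>x. x < k \<Longrightarrow> h x = 0"
    by (rule left_finite_lower_bound[OF h]) blast
  define A where "A = {a. a \<le> c - n - k \<and> f a \<noteq> 0}"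
  define D where "D = {d. d \<le> c - m - k \<and> g d \<noteq> 0}"
  define B where "B = (\<lambda>(a, d). a + d) ` (A \<times> D)"
  have fin: "finite A" "finite D" "finite B"
    using f g by (auto simp: left_finite_def A_def D_def B_def)
  have in_AD: "a \<in> A \<and> d \<in> D" if "f a \<noteq> 0" "g d \<noteq> 0" "h (c - (a + d)) \<noteq> 0" for a d
  proof -
    have "\<not> a < m" "\<not> d < n" "\<not> c - (a + d) < k"
      using that m n k by blast+
    then show ?thesis using that by (auto simp: A_def D_def)
  qed
  have "conv (conv f g) h c = (\<Sum>b\<in>B. conv f g b * h (c - b))"
  proof (rule conv_eq[OF fin(3)], safe)
    fix b assume b: "conv f g b \<noteq> 0" "h (c - b) \<noteq> 0"
    obtain a d where "f a \<noteq> 0" "g d \<noteq> 0" "b = a + d"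
      by (rule conv_nonzero[OF b(1)]) blast
    then show "b \<in> B" using in_AD[of a d] b(2) unfolding B_def by force
  qed
  also have "\<dots> = (\<Sum>b\<in>B. \<Sum>a\<in>A. f a * g (b - a) * h (c - b))"
  proof (rule sum.cong[OF refl])
    fix b assume "b \<in> B"
    show "conv f g b * h (c - b) = (\<Sum>a\<in>A. f a * g (b - a) * h (c - b))"
    proof (cases "h (c - b) = 0")
      case False
      have "conv f g b = (\<Sum>a\<in>A. f a * g (b - a))"
      proof (rule conv_eq[OF fin(1)], safe)
        fix a assume "f a \<noteq> 0" "g (b - a) \<noteq> 0"
        then show "a \<in> A" using in_AD[of a "b - a"] False by simp
      qed
      then show ?thesis by (simp add: sum_distrib_right)
    qed simp
  qed
  also have "\<dots> = (\<Sum>a\<in>A. \<Sum>b\<in>B. f a * g (b - a) * h (c - b))"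
    by (rule sum.swap)
  also have "\<dots> = (\<Sum>a\<in>A. f a * conv g h (c - a))"
  proof (rule sum.cong[OF refl])
    fix a assume a: "a \<in> A"
    have "conv g h (c - a) = (\<Sum>d\<in>(\<lambda>b. b - a) ` B. g d * h (c - a - d))"
    proof (rule conv_eq, use fin in blast, safe)
      fix d assume d: "g d \<noteq> 0" "h (c - a - d) \<noteq> 0"
      moreover have "f a \<noteq> 0" using a by (simp add: A_def)
      ultimately have "a \<in> A" "d \<in> D" using in_AD[of a d] by (auto simp: algebra_simps)
      then have "a + d \<in> B" by (force simp: B_def)
      then show "d \<in> (\<lambda>b. b - a) ` B" by force
    qed
    also have "\<dots> = (\<Sum>b\<in>B. g (b - a) * h (c - b))"
      by (subst sum.reindex) (auto simp: inj_on_def)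
    finally show "(\<Sum>b\<in>B. f a * g (b - a) * h (c - b)) = f a * conv g h (c - a)"
      by (simp add: sum_distrib_left mult.assoc)
  qed
  also have "\<dots> = conv f (conv g h) c"
  proof (rule conv_eq[symmetric, OF fin(1)], safe)
    fix a assume a: "f a \<noteq> 0" "conv g h (c - a) \<noteq> 0"
    obtain d b where "g d \<noteq> 0" "h b \<noteq> 0" "c - a = d + b"
      by (rule conv_nonzero[OF a(2)]) blast
    then have "c - (a + d) = b" by simp
    then show "a \<in> A" using in_AD[of a d] a(1) \<open>g d \<noteq> 0\<close> \<open>h b \<noteq> 0\<close> by simp
  qed
  finally show ?thesis .
qed

section \<open>The ring of left-finite series\<close>

typedef (overloaded) 'a lc = "{f :: real \<Rightarrow> 'a :: zero. left_finite f}"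
  morphisms lc_coeff Abs_lc
  by (rule exI[of _ "\<lambda>_. 0"]) (simp add: left_finite_def)

setup_lifting type_definition_lc

lemma left_finite_lc_coeff: "left_finite (lc_coeff f)"
  using lc_coeff[of f] by simp

lemma lc_eq_iff: "f = g \<longleftrightarrow> (\<forall>x. lc_coeff f x = lc_coeff g x)"
  by (auto simp flip: lc_coeff_inject)

lift_definition lc_monom :: "'a :: zero \<Rightarrow> real \<Rightarrow> 'a lc" is
  "\<lambda>c r x. if x = r then c else 0"
proof -
  fix c :: 'a and r :: real
  have "finite {x. x \<le> s \<and> (if x = r then c else 0) \<noteq> 0}" for s
    by (rule finite_subset[of _ "{r}"]) auto
  then show "left_finite (\<lambda>x. if x = r then c else 0)"
    by (simp add: left_finite_def)
qed

lemma lc_coeff_monom: "lc_coeff (lc_monom c r) x = (if x = r then c else 0)"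
  by transfer simp

lemma left_finite_add:
  fixes f g :: "real \<Rightarrow> 'a :: ab_group_add"
  assumes "left_finite f" "left_finite g"
  shows "left_finite (\<lambda>x. f x + g x)" "left_finite (\<lambda>x. f x - g x)"
proof -
  have s1: "{x. x \<le> r \<and> f x + g x \<noteq> 0} \<subseteq> {x. x \<le> r \<and> f x \<noteq> 0} \<union> {x. x \<le> r \<and> g x \<noteq> 0}"
    and s2: "{x. x \<le> r \<and> f x - g x \<noteq> 0} \<subseteq> {x. x \<le> r \<and> f x \<noteq> 0} \<union> {x. x \<le> r \<and> g x \<noteq> 0}" for r
    by auto
  have "finite ({x. x \<le> r \<and> f x \<noteq> 0} \<union> {x. x \<le> r \<and> g x \<noteq> 0})" for r
    using assms by (simp add: left_finite_def)
  then show "left_finite (\<lambda>x. f x + g x)" "left_finite (\<lambda>x. f x - g x)"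
    unfolding left_finite_def using finite_subset[OF s1] finite_subset[OF s2] by auto
qed

instantiation lc :: (comm_ring_1) comm_ring_1
begin

lift_definition zero_lc :: "'a lc" is "\<lambda>_. 0"
  by (simp add: left_finite_def)

definition one_lc :: "'a lc" where "1 = lc_monom 1 0"

lift_definition plus_lc :: "'a lc \<Rightarrow> 'a lc \<Rightarrow> 'a lc" is "\<lambda>f g x. f x + g x"
  by (simp add: left_finite_add)

lift_definition minus_lc :: "'a lc \<Rightarrow> 'a lc \<Rightarrow> 'a lc" is "\<lambda>f g x. f x - g x"
  by (simp add: left_finite_add)

lift_definition uminus_lc :: "'a lc \<Rightarrow> 'a lc" is "\<lambda>f x. - f x"
  by (simp add: left_finite_def)

lift_definition times_lc :: "'a lc \<Rightarrow> 'a lc \<Rightarrow> 'a lc" is conv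
  by (rule left_finite_conv)

instance
proof
  fix f g h :: "'a lc"
  show "f * g * h = f * (g * h)"
    by transfer (simp add: conv_assoc fun_eq_iff)
  show "f * g = g * f"
    by transfer (simp add: conv_commute fun_eq_iff)
  show "(f + g) * h = f * h + g * h"
    by transfer (simp add: conv_add_left fun_eq_iff)
  have "conv (\<lambda>x. if x = 0 then 1 else 0) u c = u c" for u :: "real \<Rightarrow> 'a" and c
    by (subst conv_eq[of "{0}"]) auto
  then show "1 * f = f"
    unfolding one_lc_def by transfer (simp add: fun_eq_iff)
  have "lc_coeff (0 :: 'a lc) 0 \<noteq> lc_coeff 1 0"
    by (simp add: one_lc_def zero_lc.rep_eq lc_coeff_monom)
  then show "(0 :: 'a lc) \<noteq> 1" by auto
qed (transfer; simp add: algebra_simps)+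

end

lemmas lc_coeff_simps = zero_lc.rep_eq plus_lc.rep_eq minus_lc.rep_eq uminus_lc.rep_eq lc_coeff_monom

lemma lc_coeff_1: "lc_coeff 1 x = (if x = 0 then 1 else 0)"
  by (simp add: one_lc_def lc_coeff_monom)

lemma lc_coeff_sum: "lc_coeff (sum f A) x = (\<Sum>i\<in>A. lc_coeff (f i) x)"
  by (induction A rule: infinite_finite_induct) (auto simp: lc_coeff_simps)

lemma lc_coeff_monom_mult: "lc_coeff (lc_monom c r * f) x = c * lc_coeff f (x - r)"
proof (transfer fixing: c r x)
  fix f :: "real \<Rightarrow> 'a"
  show "conv (\<lambda>x. if x = r then c else 0) f x = c * f (x - r)"
    by (subst conv_eq[of "{r}"]) auto
qed

lemma lc_monom_mult: "lc_monom c r * lc_monom d s = lc_monom (c * d) (r + s)"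
  by (auto simp: lc_eq_iff lc_coeff_monom_mult lc_coeff_monom)

lemma lc_monom_add: "lc_monom c r + lc_monom d r = lc_monom (c + d) r"
  by (auto simp: lc_eq_iff lc_coeff_simps)

lemma lc_monom_power: "lc_monom c r ^ n = lc_monom (c ^ n) (of_nat n * r)"
  by (induction n) (auto simp: lc_monom_mult algebra_simps one_lc_def)

lemma lc_monom_eq_0_iff: "lc_monom c r = 0 \<longleftrightarrow> c = 0"
  by (auto simp: lc_eq_iff lc_coeff_simps)

section \<open>The valuation, completeness and inverses\<close>

text \<open>The statement that the valuation of \<open>f\<close> is at least \<open>r\<close>. As a
  relation it requires no value at the zero series.\<close>

definition vge :: "real \<Rightarrow> 'a :: zero lc \<Rightarrow> bool" where
  "vge r f \<longleftrightarrow> (\<forall>x<r. lc_coeff f x = 0)"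

lemma vge_mono: "vge r f \<Longrightarrow> s \<le> r \<Longrightarrow> vge s f"
  by (auto simp: vge_def)

lemma vge_0: "vge r 0"
  by (auto simp: vge_def lc_coeff_simps)

lemma vge_add: "vge r f \<Longrightarrow> vge r g \<Longrightarrow> vge r (f + g)"
  and vge_diff: "vge r f \<Longrightarrow> vge r g \<Longrightarrow> vge r (f - g)"
  and vge_uminus: "vge r f \<Longrightarrow> vge r (- f)"
  by (auto simp: vge_def lc_coeff_simps)

lemma vge_sum: "(\<And>i. i \<in> A \<Longrightarrow> vge r (f i)) \<Longrightarrow> vge r (sum f A)"
  by (auto simp: vge_def lc_coeff_sum)

lemma vge_monom: "vge r (lc_monom c r)"
  by (auto simp: vge_def lc_coeff_simps)

lemma vge_mult: "vge r f \<Longrightarrow> vge s g \<Longrightarrow> vge (r + s) (f * g)"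
proof -
  assume f: "vge r f" and g: "vge s g"
  have "conv (lc_coeff f) (lc_coeff g) x = 0" if "x < r + s" for x
  proof (rule ccontr)
    assume *: "conv (lc_coeff f) (lc_coeff g) x \<noteq> 0"
    obtain a b where "lc_coeff f a \<noteq> 0" "lc_coeff g b \<noteq> 0" "x = a + b"
      by (rule conv_nonzero[OF *]) blast
    then have "\<not> a < r" "\<not> b < s" using f g by (auto simp: vge_def)
    then show False using \<open>x = a + b\<close> that by linarith
  qed
  then show ?thesis by (simp add: vge_def times_lc.rep_eq)
qed

lemma vge_mult_0: "vge r f \<Longrightarrow> vge 0 g \<Longrightarrow> vge r (f * g)"
  using vge_mult[of r f 0 g] by simp

lemma vge_multiples_imp_0:
  assumes "\<epsilon> > 0" "\<And>n :: nat. vge (of_nat n * \<epsilon>) f"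
  shows "f = 0"
proof -
  have "lc_coeff f x = 0" for x
  proof -
    obtain n :: nat where "x < of_nat n * \<epsilon>" using assms(1) reals_Archimedean3 by blast
    then show ?thesis using assms(2) by (auto simp: vge_def)
  qed
  then show ?thesis by (simp add: lc_eq_iff lc_coeff_simps)
qed

lemma lc_leading_term:
  assumes "f \<noteq> 0"
  obtains r where "vge r f" "lc_coeff f r \<noteq> 0"
proof -
  obtain y where y: "lc_coeff f y \<noteq> 0" using assms by (auto simp: lc_eq_iff lc_coeff_simps)
  let ?S = "{x. x \<le> y \<and> lc_coeff f x \<noteq> 0}"
  have S: "finite ?S" "y \<in> ?S" using left_finite_lc_coeff[of f] y by (auto simp: left_finite_def)
  then have "Min ?S \<in> ?S" by (metis (lifting) Min_in empty_iff)
  moreover have "vge (Min ?S) f"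
    unfolding vge_def
  proof (intro allI impI, rule ccontr)
    fix x assume x: "x < Min ?S" "lc_coeff f x \<noteq> 0"
    then have "x \<in> ?S" using Min_le[OF S] by auto
    then show False using x S by (meson Min_le leD)
  qed
  ultimately show thesis using that by auto
qed

lemma vge_pos:
  fixes f :: "'a :: comm_ring_1 lc"
  assumes "vge 0 f" "lc_coeff f 0 = 0"
  shows "\<exists>\<epsilon>>0. vge \<epsilon> f"
proof (cases "f = 0")
  case True
  then show ?thesis using vge_0 zero_less_one by metis
next
  case False
  obtain r where r: "vge r f" "lc_coeff f r \<noteq> 0" by (rule lc_leading_term[OF False]) blast
  then have "r > 0" using assms unfolding vge_def by (metis linorder_neqE_linordered_idom)
  then show ?thesis using r by blast
qed

text \<open>Completeness for approximations that improve by a fixed \<epsilon> per step: the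
  coefficient at \<open>x\<close> is frozen once \<open>n \<epsilon> > x\<close>. Up to a bound
  \<open>r\<close> the limit coincides with a single \<open>F n\<close>, whence it is
  left-finite.\<close>

lemma vge_limit:
  fixes F :: "nat \<Rightarrow> 'a :: comm_ring_1 lc"
  assumes "\<epsilon> > 0" and F: "\<And>n. vge (of_nat n * \<epsilon>) (F (Suc n) - F n)"
  shows "\<exists>f. \<forall>n. vge (of_nat n * \<epsilon>) (f - F n)"
proof -
  have le: "vge (of_nat n * \<epsilon>) (F m - F n)" if "n \<le> m" for n m
    using that
  proof (induction m rule: dec_induct)
    case base
    show ?case by (simp add: vge_0)
  next
    case (step m)
    have "vge (of_nat n * \<epsilon>) (F (Suc m) - F m)"
      by (rule vge_mono[OF F]) (use step assms(1) in auto)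
    from vge_add[OF this step.IH] show ?case by simp
  qed
  have stable: "lc_coeff (F m) x = lc_coeff (F n) x" if "n \<le> m" "x < of_nat n * \<epsilon>" for m n x
    using le[OF that(1)] that(2) by (simp add: vge_def lc_coeff_simps)
  define N where "N x = (SOME n :: nat. x < of_nat n * \<epsilon>)" for x
  have N: "x < of_nat (N x) * \<epsilon>" for x
    unfolding N_def using reals_Archimedean3[OF assms(1)] by (metis (mono_tags) someI_ex)
  define f where "f x = lc_coeff (F (N x)) x" for x
  have f: "f x = lc_coeff (F n) x" if "x < of_nat n * \<epsilon>" for x n
    unfolding f_def using stable[OF _ that] stable[OF _ N] by (metis nat_le_linear)
  have "left_finite f"
    unfolding left_finite_def
  proof
    fix r
    have "{x. x \<le> r \<and> f x \<noteq> 0} = {x. x \<le> r \<and> lc_coeff (F (N r)) x \<noteq> 0}"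
      using f N[of r] by (metis (mono_tags, opaque_lifting) le_less_trans)
    then show "finite {x. x \<le> r \<and> f x \<noteq> 0}"
      using left_finite_lc_coeff[of "F (N r)"] by (simp add: left_finite_def)
  qed
  then have "lc_coeff (Abs_lc f) = f" by (simp add: Abs_lc_inverse)
  then have "\<forall>n. vge (of_nat n * \<epsilon>) (Abs_lc f - F n)"
    using f by (simp add: vge_def lc_coeff_simps)
  then show ?thesis ..
qed

text \<open>Scaling by the inverse of the leading term turns the series into \<open>1 - e\<close>
  with \<open>e\<close> of positive valuation, and the geometric series in \<open>e\<close>
  converges.\<close>

lemma lc_inverse_exists:
  fixes f :: "'a :: field lc"
  assumes "f \<noteq> 0"
  shows "\<exists>g. f * g = 1"
proof -
  obtain r where r: "vge r f" "lc_coeff f r \<noteq> 0" by (rule lc_leading_term[OF assms]) blast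
  define u where "u = lc_monom (inverse (lc_coeff f r)) (- r)"
  define e where "e = 1 - u * f"
  have "vge 0 (u * f)"
    using vge_mult[OF vge_monom[of "- r" "inverse (lc_coeff f r)"] r(1)] by (simp add: u_def)
  moreover have "vge 0 (1 :: 'a lc)" unfolding one_lc_def by (rule vge_monom)
  ultimately have "vge 0 e" unfolding e_def by (intro vge_diff)
  moreover have "lc_coeff e 0 = 0"
    using r(2) by (simp add: e_def u_def lc_coeff_simps lc_coeff_1 lc_coeff_monom_mult)
  ultimately obtain \<epsilon> where \<epsilon>: "\<epsilon> > 0" "vge \<epsilon> e" using vge_pos by blast
  have pow: "vge (of_nat n * \<epsilon>) (e ^ n)" for n
  proof (induction n)
    case (Suc n)
    then show ?case using vge_mult[OF \<epsilon>(2) Suc] by (simp add: algebra_simps)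
  qed (use \<open>vge 0 (1 :: 'a lc)\<close> in simp)
  define F where "F n = (\<Sum>i<n. e ^ i)" for n
  obtain g where g: "\<And>n. vge (of_nat n * \<epsilon>) (g - F n)"
    using vge_limit[OF \<epsilon>(1), of F] pow by (auto simp: F_def)
  have "vge (of_nat n * \<epsilon>) (u * f * g - 1)" for n
  proof -
    have "u * f * F n = 1 - e ^ n"
      using one_diff_power_eq[of e n] by (simp add: F_def e_def)
    then have "u * f * g - 1 = (g - F n) * (u * f) - e ^ n"
      by (simp add: algebra_simps)
    then show ?thesis
      using vge_diff[OF vge_mult_0[OF g[of n] \<open>vge 0 (u * f)\<close>] pow[of n]] by simp
  qed
  then have "u * f * g - 1 = 0" by (rule vge_multiples_imp_0[OF \<epsilon>(1)])
  then have "f * (u * g) = 1" by (simp add: algebra_simps)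
  then show ?thesis ..
qed

instantiation lc :: (field) field
begin

definition inverse_lc :: "'a lc \<Rightarrow> 'a lc" where
  "inverse_lc f = (if f = 0 then 0 else (SOME g. f * g = 1))"

definition divide_lc :: "'a lc \<Rightarrow> 'a lc \<Rightarrow> 'a lc" where
  "divide_lc f g = f * inverse g"

instance
proof
  fix f g :: "'a lc"
  show "f \<noteq> 0 \<Longrightarrow> inverse f * f = 1"
    using someI_ex[OF lc_inverse_exists, of f] by (simp add: inverse_lc_def mult.commute)
qed (auto simp: inverse_lc_def divide_lc_def)

end

lemma lc_of_nat: "of_nat n = lc_monom (of_nat n) 0"
  by (induction n) (auto simp: lc_eq_iff lc_coeff_simps lc_coeff_1)

instance lc :: (field_char_0) field_char_0
proof
  show "inj (of_nat :: nat \<Rightarrow> 'a lc)"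
    by (rule injI) (auto simp: lc_of_nat lc_eq_iff lc_coeff_simps split: if_splits)
qed

subsection \<open>Hensel's lemma and algebraic closedness\<close>

text \<open>The residue field sits in the series as the constants, so lifting coefficients is a ring
  homomorphism. Its counterpart \<open>lc_red\<close> is the reduction map on polynomials whose
  coefficients have nonnegative valuation.\<close>

abbreviation lc_lift :: "'a :: comm_ring_1 poly \<Rightarrow> 'a lc poly" where
  "lc_lift \<equiv> map_poly (\<lambda>c. lc_monom c 0)"

abbreviation lc_red :: "'a :: comm_ring_1 lc poly \<Rightarrow> 'a poly" where
  "lc_red \<equiv> map_poly (\<lambda>f. lc_coeff f 0)"

lemma lc_monom_0: "lc_monom (0 :: 'a :: comm_ring_1) r = 0"
  by (simp add: lc_monom_eq_0_iff)

lemma coeff_lc_lift: "coeff (lc_lift p) i = lc_monom (coeff p i) 0"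
  by (simp add: coeff_map_poly lc_monom_eq_0_iff)

lemma coeff_lc_red: "coeff (lc_red p) i = lc_coeff (coeff p i) 0"
  by (simp add: coeff_map_poly lc_coeff_simps)

lemma lc_lift_add: "lc_lift (p + q) = lc_lift p + lc_lift q"
  by (rule poly_eqI) (simp add: coeff_lc_lift lc_monom_add)

lemma lc_lift_mult: "lc_lift (p * q) = lc_lift p * lc_lift q"
  by (rule map_poly_hom_mult) (auto simp: lc_monom_add lc_monom_mult lc_monom_eq_0_iff)

definition vge_poly :: "real \<Rightarrow> 'a :: comm_ring_1 lc poly \<Rightarrow> bool" where
  "vge_poly r p \<longleftrightarrow> (\<forall>i. vge r (coeff p i))"

lemma vge_poly_mono: "vge_poly r p \<Longrightarrow> s \<le> r \<Longrightarrow> vge_poly s p"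
  by (auto simp: vge_poly_def intro: vge_mono)

lemma vge_poly_0: "vge_poly r 0"
  by (simp add: vge_poly_def vge_0)

lemma vge_poly_add: "vge_poly r p \<Longrightarrow> vge_poly r q \<Longrightarrow> vge_poly r (p + q)"
  and vge_poly_diff: "vge_poly r p \<Longrightarrow> vge_poly r q \<Longrightarrow> vge_poly r (p - q)"
  and vge_poly_uminus: "vge_poly r p \<Longrightarrow> vge_poly r (- p)"
  by (auto simp: vge_poly_def intro: vge_add vge_diff vge_uminus)

lemma vge_poly_mult: "vge_poly r p \<Longrightarrow> vge_poly s q \<Longrightarrow> vge_poly (r + s) (p * q)"
  by (auto simp: vge_poly_def coeff_mult intro!: vge_sum vge_mult)

lemma vge_poly_lift: "vge_poly 0 (lc_lift p)"
  by (auto simp: vge_poly_def coeff_lc_lift intro: vge_monom)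

lemma vge_poly_sum: "(\<And>i. i \<in> A \<Longrightarrow> vge_poly r (f i)) \<Longrightarrow> vge_poly r (sum f A)"
  by (auto simp: vge_poly_def coeff_sum intro!: vge_sum)

lemma vge_poly_smult: "vge r c \<Longrightarrow> vge_poly s p \<Longrightarrow> vge_poly (r + s) (smult c p)"
  by (auto simp: vge_poly_def intro: vge_mult)

lemma vge_poly_multiples_imp_0:
  fixes p :: "'a :: comm_ring_1 lc poly"
  assumes "\<epsilon> > 0" "\<And>n :: nat. vge_poly (of_nat n * \<epsilon>) p"
  shows "p = 0"
proof (rule poly_eqI)
  fix i
  have "coeff p i = 0"
    by (rule vge_multiples_imp_0[OF assms(1)]) (use assms(2) in \<open>simp add: vge_poly_def\<close>)
  then show "coeff p i = coeff 0 i" by simp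
qed

lemma vge_poly_pos:
  fixes p :: "'a :: comm_ring_1 lc poly"
  assumes "vge_poly 0 p" "lc_red p = 0"
  shows "\<exists>\<epsilon>>0. vge_poly \<epsilon> p"
proof -
  have "lc_coeff (coeff p i) 0 = 0" for i
    using assms(2) by (metis coeff_lc_red coeff_0)
  then have "\<forall>i. \<exists>\<epsilon>>0. vge \<epsilon> (coeff p i)"
    using assms(1) vge_pos unfolding vge_poly_def by blast
  then obtain e where e: "\<And>i. e i > 0" "\<And>i. vge (e i) (coeff p i)" by metis
  define \<epsilon> where "\<epsilon> = Min (e ` {..degree p})"
  have "\<epsilon> > 0" using e(1) by (simp add: \<epsilon>_def)
  moreover have "vge \<epsilon> (coeff p i)" for i
  proof (cases "i \<le> degree p")
    case True
    then have "\<epsilon> \<le> e i" by (auto simp: \<epsilon>_def)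
    then show ?thesis using e(2) vge_mono by blast
  qed (simp add: coeff_eq_0 vge_0)
  ultimately show ?thesis by (auto simp: vge_poly_def)
qed

lemma vge_poly_limit:
  fixes P :: "nat \<Rightarrow> 'a :: comm_ring_1 lc poly"
  assumes "\<epsilon> > 0" and P: "\<And>n. vge_poly (of_nat n * \<epsilon>) (P (Suc n) - P n)" and d: "\<And>n. degree (P n) \<le> d"
  shows "\<exists>Q. degree Q \<le> d \<and> (\<forall>n. vge_poly (of_nat n * \<epsilon>) (Q - P n))"
proof -
  have "\<exists>f. \<forall>n. vge (of_nat n * \<epsilon>) (f - coeff (P n) i)" for i
    using vge_limit[OF assms(1), of "\<lambda>n. coeff (P n) i"] P by (simp add: vge_poly_def)
  then obtain f where f: "\<And>i n. vge (of_nat n * \<epsilon>) (f i - coeff (P n) i)" by metis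
  define Q where "Q = (\<Sum>i\<le>d. monom (f i) i)"
  have Q: "coeff Q i = (if i \<le> d then f i else 0)" for i
    by (simp add: Q_def coeff_sum if_distrib cong: if_cong)
  have "vge (of_nat n * \<epsilon>) (coeff (Q - P n) i)" for n i
    using f[of n i] d[of n] by (auto simp: Q coeff_eq_0 vge_0)
  then have "\<forall>n. vge_poly (of_nat n * \<epsilon>) (Q - P n)" by (simp add: vge_poly_def)
  moreover have "degree Q \<le> d" by (rule degree_le) (simp add: Q)
  ultimately show ?thesis by blast
qed

lemma bezout_power:
  fixes f g :: "'a :: comm_ring_1"
  assumes "a * f + b * g = 1"
  shows "\<exists>a b. a * f + b * g ^ m = 1"
proof (induction m)
  case 0
  show ?case by (intro exI[of _ 0] exI[of _ 1]) simp
next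
  case (Suc m)
  then obtain c d where cd: "c * f + d * g ^ m = 1" by blast
  have "(a * f + b * g) * (c * f + d * g ^ m) = 1" using assms cd by simp
  then have "(a * (c * f + d * g ^ m) + b * g * c) * f + (b * d) * g ^ Suc m = 1"
    by (simp add: algebra_simps)
  then show ?case by blast
qed

text \<open>Reduce the first cofactor modulo \<open>g\<close> and move the quotient into the second;
  the equation then bounds the degree of \<open>w\<close>. Truncated subtraction in
  \<open>degree f - 1\<close> admits a constant \<open>f\<close>; for positive degree the bound is
  strict.\<close>

lemma bezout_bounded:
  fixes f g p :: "'a :: field poly"
  assumes bez: "a * f + b * g = 1" and g: "degree g > 0" and f: "f \<noteq> 0" and p: "degree p < degree f + degree g"
  shows "\<exists>u w. u * f + w * g = p \<and> degree u < degree g \<and> degree w \<le> degree f - 1"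
proof -
  define u where "u = (a * p) mod g"
  define w where "w = b * p + ((a * p) div g) * f"
  have eq: "u * f + w * g = p"
  proof -
    have "u * f + w * g = (a * p div g * g + a * p mod g) * f + b * p * g"
      unfolding u_def w_def by (simp only: algebra_simps)
    also have "\<dots> = (a * f + b * g) * p"
      unfolding div_mult_mod_eq by (simp add: algebra_simps)
    finally show ?thesis using bez by simp
  qed
  have u: "degree u < degree g"
  proof -
    have "g \<noteq> 0" using g by auto
    from degree_mod_less[OF this, of "a * p"] show ?thesis
      unfolding u_def using g by (elim disjE) simp_all
  qed
  have "degree w \<le> degree f - 1"
  proof (cases "w = 0")
    case False
    have "degree (w * g) = degree (p - u * f)" using eq by (metis add_diff_cancel_left')
    also have "\<dots> < degree f + degree g"
    proof (rule degree_diff_less[OF p])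
      show "degree (u * f) < degree f + degree g"
        using degree_mult_le[of u f] u by simp
    qed
    finally have "degree (w * g) < degree f + degree g" .
    moreover have "g \<noteq> 0" using g by auto
    ultimately show ?thesis using False by (simp add: degree_mult_eq)
  qed simp
  then show ?thesis using eq u by blast
qed

text \<open>Hensel's lemma with linear convergence: each correction gains a fixed \<epsilon>, a
  positive lower bound for the valuation of the initial error, which is the rate that
  \<open>vge_poly_limit\<close> asks for. The corrections have smaller degree than \<open>g0\<close>
  and \<open>h0\<close>, so the degrees of the approximations stay bounded by those of
  \<open>g0\<close> and \<open>h0\<close>.\<close>

lemma hensel_factorization:
  fixes F :: "'a :: field lc poly"
  assumes F: "vge_poly 0 F" "lc_red F = g0 * h0" "lead_coeff F = 1" "degree F = degree g0 + degree h0"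
    and mon: "lead_coeff g0 = 1" "lead_coeff h0 = 1" and deg: "degree g0 > 0" "degree h0 > 0"
    and bez: "a * h0 + b * g0 = 1"
  shows "\<exists>G H. F = G * H \<and> degree G = degree g0 \<and> degree H = degree h0"
proof -
  define n where "n = degree F"
  \<comment> \<open>For positive \<open>d\<close> this is \<open>degree p < d\<close>, put in terms
    of coefficients so that sums, products and the zero polynomial need no case
    distinctions.\<close>
  define sm where "sm d p \<longleftrightarrow> (\<forall>i\<ge>d. coeff p i = 0)" for d :: nat and p :: "'a lc poly"
  have sm_deg: "sm d p \<longleftrightarrow> degree p < d" if "d > 0" for d p
    using that unfolding sm_def by (metis coeff_eq_0 degree_0 leI leading_coeff_0_iff less_le_trans)
  have sm_add: "sm d (p + q)" "sm d (p - q)" if "sm d p" "sm d q" for d p q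
    using that by (auto simp: sm_def)
  have sm_mult: "sm (d + e) (p * q)" if "sm d p" "sm e q" for d e p q
    unfolding sm_def coeff_mult
  proof (intro allI impI sum.neutral ballI)
    fix i j assume "d + e \<le> i" "j \<in> {..i}"
    then have "d \<le> j \<or> e \<le> i - j" by auto
    then show "coeff p j * coeff q (i - j) = 0" using that by (auto simp: sm_def)
  qed
  \<comment> \<open>The Bezout equation is solved over the residue field for monomials only. The
    maps \<open>u\<close> and \<open>w\<close> below extend these solutions linearly to error
    polynomials over the series.\<close>
  have "\<exists>u w. u * h0 + w * g0 = monom 1 i \<and> degree u < degree g0 \<and> degree w \<le> degree h0 - 1" if "i < n" for i
  proof -
    have "h0 \<noteq> 0" using deg by auto
    then show ?thesis
      using bezout_bounded[OF bez deg(1), of "monom 1 i"] that F(4)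
      by (simp add: n_def degree_monom_eq add.commute)
  qed
  then obtain U W where UW: "\<And>i. i < n \<Longrightarrow> U i * h0 + W i * g0 = monom 1 i"
    "\<And>i. i < n \<Longrightarrow> degree (U i) < degree g0" "\<And>i. i < n \<Longrightarrow> degree (W i) \<le> degree h0 - 1"
    by metis
  define u where "u E = (\<Sum>i<n. smult (coeff E i) (lc_lift (U i)))" for E
  define w where "w E = (\<Sum>i<n. smult (coeff E i) (lc_lift (W i)))" for E
  have uw: "u E * lc_lift h0 + w E * lc_lift g0 = E" if E: "sm n E" for E
  proof -
    have "u E * lc_lift h0 + w E * lc_lift g0 = (\<Sum>i<n. smult (coeff E i) (lc_lift (U i * h0 + W i * g0)))"
      by (simp add: u_def w_def sum_distrib_right lc_lift_add lc_lift_mult smult_add_right sum.distrib)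
    also have "\<dots> = (\<Sum>i<n. monom (coeff E i) i)"
      by (intro sum.cong refl) (auto simp: UW(1) map_poly_monom lc_monom_eq_0_iff smult_monom simp flip: one_lc_def)
    also have "\<dots> = E"
      using E by (intro poly_eqI) (auto simp: coeff_sum sm_def if_distrib cong: if_cong)
    finally show ?thesis .
  qed
  have u_sm: "sm (degree g0) (u E)" for E
    unfolding sm_def
  proof (intro allI impI)
    fix j assume "degree g0 \<le> j"
    then have "coeff (U i) j = 0" if "i < n" for i
      using UW(2)[OF that] by (simp add: coeff_eq_0)
    then show "coeff (u E) j = 0"
      by (simp add: u_def coeff_sum coeff_lc_lift lc_monom_0)
  qed
  have w_sm: "sm (degree h0) (w E)" for E
    unfolding sm_def
  proof (intro allI impI)
    fix j assume "degree h0 \<le> j"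
    then have "coeff (W i) j = 0" if "i < n" for i
      using UW(3)[OF that] deg(2) by (simp add: coeff_eq_0)
    then show "coeff (w E) j = 0"
      by (simp add: w_def coeff_sum coeff_lc_lift lc_monom_0)
  qed
  have v_uw: "vge_poly r (u E)" "vge_poly r (w E)" if "vge_poly r E" for r E
  proof -
    have "vge_poly (r + 0) (u E)" "vge_poly (r + 0) (w E)"
      unfolding u_def w_def using that
      by (intro vge_poly_sum vge_poly_smult vge_poly_lift; simp add: vge_poly_def)+
    then show "vge_poly r (u E)" "vge_poly r (w E)" by simp_all
  qed
  define E0 where "E0 = F - lc_lift g0 * lc_lift h0"
  have "lc_red E0 = 0"
    by (rule poly_eqI) (simp add: E0_def coeff_lc_red lc_coeff_simps coeff_lc_lift flip: F(2) lc_lift_mult)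
  moreover have "vge_poly 0 E0"
    unfolding E0_def using F(1) vge_poly_lift[of "g0 * h0"] by (simp add: lc_lift_mult vge_poly_diff)
  ultimately obtain \<epsilon> where \<epsilon>: "\<epsilon> > 0" "vge_poly \<epsilon> E0"
    using vge_poly_pos by blast
  define T where "T = (\<lambda>(G, H). let E = F - G * H in (G + u E, H + w E))"
  define S where "S k = (T ^^ k) (lc_lift g0, lc_lift h0)" for k
  define G where "G k = fst (S k)" for k
  define H where "H k = snd (S k)" for k
  define E where "E k = F - G k * H k" for k
  have GH0: "G 0 = lc_lift g0" "H 0 = lc_lift h0"
    by (simp_all add: G_def H_def S_def)
  have GHS: "G (Suc k) = G k + u (E k)" "H (Suc k) = H k + w (E k)" for k
    by (simp_all add: G_def H_def S_def T_def E_def case_prod_beta Let_def)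
  have inv: "vge_poly (of_nat (Suc k) * \<epsilon>) (E k) \<and> sm n (E k) \<and>
      vge_poly \<epsilon> (G k - lc_lift g0) \<and> vge_poly \<epsilon> (H k - lc_lift h0) \<and>
      sm (degree g0) (G k - lc_lift g0) \<and> sm (degree h0) (H k - lc_lift h0)" for k
  proof (induction k)
    case 0
    \<comment> \<open>Both \<open>F\<close> and the lift of \<open>g0 h0\<close> are monic of degree
      \<open>n\<close>, so their difference has lower degree and the linear maps \<open>u\<close>,
      \<open>w\<close> solve the equation for it.\<close>
    have "coeff E0 i = 0" if "n \<le> i" for i
    proof (cases "i = n")
      case True
      have "coeff (g0 * h0) n = 1"
        using mon F(4) by (simp add: n_def flip: lead_coeff_mult) (metis coeff_mult_degree_sum mult_1)
      then show ?thesis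
        using F(3) True by (simp add: E0_def n_def coeff_lc_lift one_lc_def flip: lc_lift_mult)
    next
      case False
      then have "i > n" "degree (g0 * h0) \<le> n"
        using that F(4) degree_mult_le[of g0 h0] by (auto simp: n_def)
      then show ?thesis
        by (simp add: E0_def n_def coeff_lc_lift coeff_eq_0 lc_monom_0 flip: lc_lift_mult)
    qed
    then have "sm n E0" by (simp add: sm_def)
    then show ?case
      using \<epsilon> by (simp add: GH0 E_def E0_def[symmetric] vge_poly_0) (simp add: sm_def)
  next
    case (Suc k)
    let ?r = "of_nat (Suc k) * \<epsilon>"
    have E: "vge_poly ?r (E k)" "sm n (E k)" using Suc by auto
    have le: "\<epsilon> \<le> ?r" using \<epsilon>(1) by (simp add: distrib_right)
    \<comment> \<open>The first-order part of the correction cancels \<open>E k\<close>. In each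
      remaining product one factor has the valuation of \<open>E k\<close> and the other at least
      \<epsilon>, so the error gains \<epsilon>.\<close>
    have eq: "E (Suc k) = - (u (E k) * (H k - lc_lift h0) + w (E k) * (G k - lc_lift g0) + u (E k) * w (E k))"
    proof -
      have "E (Suc k) = E k - (u (E k) * lc_lift h0 + w (E k) * lc_lift g0)
          - (u (E k) * (H k - lc_lift h0) + w (E k) * (G k - lc_lift g0) + u (E k) * w (E k))"
        unfolding E_def[of "Suc k"] GHS by (simp add: E_def[of k] algebra_simps)
      then show ?thesis by (simp add: uw[OF E(2)])
    qed
    have "vge_poly (?r + \<epsilon>) (E (Suc k))"
      unfolding eq using Suc v_uw[OF E(1)] vge_poly_mono[OF v_uw(2)[OF E(1)] le]
      by (intro vge_poly_uminus vge_poly_add vge_poly_mult) auto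
    moreover have "sm n (E (Suc k))"
    proof -
      have "sm n (u (E k) * (H k - lc_lift h0) + w (E k) * (G k - lc_lift g0) + u (E k) * w (E k))"
        using sm_mult[OF u_sm[of "E k"], of "degree h0" "H k - lc_lift h0"]
          sm_mult[OF w_sm[of "E k"], of "degree g0" "G k - lc_lift g0"]
          sm_mult[OF u_sm[of "E k"] w_sm[of "E k"]] Suc F(4)
        by (auto simp: n_def add.commute intro!: sm_add)
      then show ?thesis
        unfolding eq sm_def by (simp only: coeff_minus neg_equal_0_iff_equal simp_thms)
    qed
    moreover have "vge_poly \<epsilon> (G (Suc k) - lc_lift g0)" "vge_poly \<epsilon> (H (Suc k) - lc_lift h0)"
      using vge_poly_add[of \<epsilon> "G k - lc_lift g0" "u (E k)"] vge_poly_add[of \<epsilon> "H k - lc_lift h0" "w (E k)"]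
        Suc vge_poly_mono[OF v_uw(1)[OF E(1)] le] vge_poly_mono[OF v_uw(2)[OF E(1)] le]
      by (auto simp: GHS algebra_simps)
    moreover have "sm (degree g0) (G (Suc k) - lc_lift g0)" "sm (degree h0) (H (Suc k) - lc_lift h0)"
      using sm_add(1)[of "degree g0" "G k - lc_lift g0" "u (E k)"]
        sm_add(1)[of "degree h0" "H k - lc_lift h0" "w (E k)"] Suc u_sm w_sm
      by (auto simp: GHS algebra_simps)
    ultimately show ?case by (simp add: algebra_simps)
  qed
  have deg_lift: "degree (lc_lift p) = degree p" for p :: "'a poly"
    by (rule degree_map_poly) (simp add: lc_monom_eq_0_iff)
  have degG: "degree (G k) \<le> degree g0" for k
  proof -
    have "degree (G k - lc_lift g0) < degree g0" using inv[of k] sm_deg[OF deg(1)] by blast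
    then have "degree (G k - lc_lift g0 + lc_lift g0) \<le> degree g0"
      by (intro degree_add_le) (auto simp: deg_lift)
    then show ?thesis by simp
  qed
  have degH: "degree (H k) \<le> degree h0" for k
  proof -
    have "degree (H k - lc_lift h0) < degree h0" using inv[of k] sm_deg[OF deg(2)] by blast
    then have "degree (H k - lc_lift h0 + lc_lift h0) \<le> degree h0"
      by (intro degree_add_le) (auto simp: deg_lift)
    then show ?thesis by simp
  qed
  have vE: "vge_poly (of_nat k * \<epsilon>) (E k)" for k
    using inv[of k] by (auto intro: vge_poly_mono simp: distrib_right \<epsilon>(1) less_imp_le)
  have "vge_poly (of_nat k * \<epsilon>) (G (Suc k) - G k)" "vge_poly (of_nat k * \<epsilon>) (H (Suc k) - H k)" for k
    using v_uw[OF vE[of k]] by (simp_all add: GHS)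
  then obtain G' H' where G': "degree G' \<le> degree g0" "\<And>k. vge_poly (of_nat k * \<epsilon>) (G' - G k)"
    and H': "degree H' \<le> degree h0" "\<And>k. vge_poly (of_nat k * \<epsilon>) (H' - H k)"
    using vge_poly_limit[OF \<epsilon>(1), of G "degree g0"] vge_poly_limit[OF \<epsilon>(1), of H "degree h0"] degG degH
    by metis
  have v0: "vge_poly 0 (G k)" for k
    using vge_poly_add[of 0 "G k - lc_lift g0" "lc_lift g0"] inv[of k] vge_poly_lift[of g0]
      vge_poly_mono[of \<epsilon> _ 0] \<epsilon>(1) by fastforce
  have v1: "vge_poly 0 H'"
  proof -
    have "vge_poly 0 (H' - H 0)" using H'(2)[of 0] by simp
    then show ?thesis using vge_poly_add[of 0 "H' - H 0" "H 0"] vge_poly_lift[of h0] by (simp add: GH0)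
  qed
  have "F - G' * H' = 0"
  proof (rule vge_poly_multiples_imp_0[OF \<epsilon>(1)])
    fix k :: nat
    let ?r = "of_nat k * \<epsilon>"
    have "F - G' * H' = E k - ((G' - G k) * H' + G k * (H' - H k))"
      by (simp add: E_def algebra_simps)
    moreover have "vge_poly (?r + 0) ((G' - G k) * H')" "vge_poly (0 + ?r) (G k * (H' - H k))"
      by (intro vge_poly_mult G' H' v0 v1)+
    ultimately show "vge_poly ?r (F - G' * H')"
      using vge_poly_diff[OF vE[of k] vge_poly_add] by simp
  qed
  then have FGH: "F = G' * H'" by simp
  moreover have "degree F \<le> degree G' + degree H'" unfolding FGH by (rule degree_mult_le)
  ultimately show ?thesis using G'(1) H'(1) F(4) by (metis add_le_mono le_antisym add_le_cancel_left add_le_cancel_right order_trans)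
qed

text \<open>Split off a root \<open>c\<close> with its full multiplicity; the cofactor does not
  vanish at \<open>c\<close> and is coprime to \<open>X - c\<close>. If it were constant,
  \<open>r\<close> would be \<open>(X - c)^m\<close>, whose subleading coefficient is
  \<open>- m c\<close>. In characteristic 0 its vanishing gives \<open>c = 0\<close> and
  \<open>r = X^m\<close>, against the coefficient at \<open>i0\<close>.\<close>

lemma residue_factorization:
  fixes r :: "'a :: {alg_closed_field, field_char_0} poly"
  assumes mon: "lead_coeff r = 1" and n: "degree r > 1" and c0: "coeff r (degree r - 1) = 0"
    and i0: "i0 < degree r" "coeff r i0 \<noteq> 0"
  obtains g h a b where "r = g * h" "lead_coeff g = 1" "lead_coeff h = 1" "degree g > 0" "degree h > 0"
    "a * h + b * g = 1"
proof -
  obtain c where c: "poly r c = 0" using alg_closed_imp_poly_has_root[of r] n by auto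
  have "r \<noteq> 0" using n by auto
  define m where "m = order c r"
  obtain h where h: "r = [:- c, 1:] ^ m * h" "\<not> [:- c, 1:] dvd h"
    using order_decomp[OF \<open>r \<noteq> 0\<close>, of c] by (auto simp: m_def)
  define g where "g = [:- c, 1:] ^ m"
  have m: "m > 0" using c \<open>r \<noteq> 0\<close> by (simp add: m_def order_gt_0_iff)
  have g: "lead_coeff g = 1" "degree g = m"
    by (simp_all add: g_def degree_power_eq coeff_linear_power)
  have lh: "lead_coeff h = 1" using mon g(1) h(1) by (simp add: lead_coeff_mult flip: g_def)
  have "degree h > 0"
  proof (rule ccontr)
    assume "\<not> degree h > 0"
    then have "h = 1" using lh by (auto elim!: degree_eq_zeroE simp: one_pCons)
    then have r: "r = [:- c, 1:] ^ m" "degree r = m" using h(1) g by (auto simp: g_def)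
    have "coeff r (m - 1) = of_nat (m choose (m - 1)) * (- c)"
      using m n r by (simp add: coeff_linear_poly_power)
    then have "c = 0" using c0 r(2) m by (auto simp: binomial_eq_0_iff)
    then have "r = monom 1 m" by (simp add: r(1) monom_altdef)
    then show False using i0 r(2) by simp
  qed
  have hc: "poly h c \<noteq> 0" using h(2) by (simp add: poly_eq_0_iff_dvd)
  have "[:- c, 1:] dvd h - [:poly h c:]" by (simp flip: poly_eq_0_iff_dvd)
  then obtain s where s: "h - [:poly h c:] = [:- c, 1:] * s" by (elim dvdE)
  have "[:inverse (poly h c):] * h + (- [:inverse (poly h c):] * s) * [:- c, 1:]
      = [:inverse (poly h c):] * (h - [:- c, 1:] * s)"
  proof -
    have "I * h + (- I * s) * J = I * (h - J * s)" for I J :: "'a poly"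
      by (simp add: algebra_simps)
    then show ?thesis .
  qed
  also have "h - [:- c, 1:] * s = [:poly h c:]" unfolding s[symmetric] by simp
  also have "[:inverse (poly h c):] * [:poly h c:] = 1" using hc by (simp add: one_pCons)
  finally obtain a b where "a * h + b * g = 1"
    unfolding g_def using bezout_power by blast
  then show thesis
    using that[of g h a b] h(1) g lh m \<open>degree h > 0\<close> by (simp add: g_def)
qed

text \<open>Induction on the degree. A substitution read off the Newton polygon makes the polynomial
  monic and integral with a reduction other than \<open>X^n\<close>; since its subleading
  coefficient vanishes, the reduction has coprime factors, and Hensel's lemma lifts them. Every real
  number is an exponent, so the scaling factor always exists.\<close>

instance lc :: ("{alg_closed_field, field_char_0}") alg_closed_field
proof
  fix p :: "'a lc poly"
  assume "lead_coeff p = 1" "degree p > 0"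
  then show "\<exists>x. poly p x = 0"
  proof (induction "degree p" arbitrary: p rule: less_induct)
    case less
    show ?case
    proof (cases "degree p = 1")
      case True
      then have "p = [:coeff p 0, coeff p 1:]"
        by (intro poly_eqI) (auto simp: coeff_pCons coeff_eq_0 split: nat.splits)
      then have "poly p (- coeff p 0) = 0"
        using less.prems True by (metis mult_1 poly_pCons poly_0 add.right_inverse mult_zero_right add_0_right mult.right_neutral One_nat_def)
      then show ?thesis ..
    next
      case False
      define n where "n = degree p"
      have n: "n > 1" using False less.prems by (simp add: n_def)
      \<comment> \<open>Tschirnhaus: kill the coefficient of \<open>X\<^sup>n\<^sup>-\<^sup>1\<close>, so that the residue polynomial below
        cannot be an \<open>n\<close>-th power.\<close>
      define s where "s = - coeff p (n - 1) / of_nat n"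
      define q where "q = pcompose p [:s, 1:]"
      have dq: "degree q = n" by (simp add: q_def n_def degree_pcompose)
      have q_coeff: "coeff q j = (\<Sum>i\<le>n. coeff p i * coeff ([:s, 1:] ^ i) j)" for j
      proof -
        have "degree (map_poly (\<lambda>x. [:x:]) p) = n"
          unfolding n_def by (rule degree_map_poly) simp
        then have "q = (\<Sum>i\<le>n. [:coeff p i:] * [:s, 1:] ^ i)"
          by (simp add: q_def pcompose_altdef poly_altdef coeff_map_poly)
        then show ?thesis by (simp add: coeff_sum)
      qed
      have lq: "lead_coeff q = 1"
        unfolding q_def using lead_coeff_comp[of "[:s, 1:]" p] less.prems by simp
      have "coeff q (n - 1) = (\<Sum>i\<in>{n - 1, n}. coeff p i * coeff ([:s, 1:] ^ i) (n - 1))"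
        unfolding q_coeff
      proof (rule sum.mono_neutral_right)
        show "\<forall>i\<in>{..n} - {n - 1, n}. coeff p i * coeff ([:s, 1:] ^ i) (n - 1) = 0"
        proof
          fix i assume "i \<in> {..n} - {n - 1, n}"
          then have "degree ([:s, 1:] ^ i) < n - 1" by (auto simp: degree_power_eq)
          then show "coeff p i * coeff ([:s, 1:] ^ i) (n - 1) = 0" by (simp add: coeff_eq_0)
        qed
      qed (use n in auto)
      also have "\<dots> = coeff p (n - 1) + of_nat n * s"
      proof -
        have "coeff ([:s, 1:] ^ (n - 1)) (n - 1) = 1" "coeff ([:s, 1:] ^ n) (n - 1) = of_nat n * s"
          using n binomial_symmetric[of "n - 1" n] by (auto simp: coeff_linear_poly_power)
        then show ?thesis using n less.prems by (simp add: n_def)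
      qed
      also have "\<dots> = 0" using n by (simp add: s_def)
      finally have q: "degree q = n" "lead_coeff q = 1" "coeff q (n - 1) = 0"
        using dq lq by simp_all
      have q_root: "\<exists>x. poly p x = 0" if "poly q x = 0" for x
        using that by (auto simp: q_def poly_pcompose)
      show ?thesis
      proof (cases "\<forall>i<n. coeff q i = 0")
        case True
        then have "coeff q 0 = 0" using n by simp
        then show ?thesis by (intro q_root[of 0]) (simp add: poly_0_coeff_0)
      next
        case False
        define I where "I = {i. i < n \<and> coeff q i \<noteq> 0}"
        have I: "finite I" "I \<noteq> {}" using False by (auto simp: I_def)
        have "\<exists>r. vge r (coeff q i) \<and> lc_coeff (coeff q i) r \<noteq> 0" if "i \<in> I" for i
          using that lc_leading_term[of "coeff q i"] unfolding I_def by blast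
        then obtain v where v: "\<And>i. i \<in> I \<Longrightarrow> vge (v i) (coeff q i)"
          "\<And>i. i \<in> I \<Longrightarrow> lc_coeff (coeff q i) (v i) \<noteq> 0" by metis
        \<comment> \<open>The least slope of the Newton polygon. It is the largest \<gamma> for
          which \<open>F\<close> below has integral coefficients, and at a minimiser
          \<open>i0\<close> the coefficient of \<open>F\<close> has valuation exactly 0.\<close>
        define \<gamma> where "\<gamma> = Min ((\<lambda>i. v i / (real n - real i)) ` I)"
        have \<gamma>_le: "\<gamma> * (real n - real i) \<le> v i" if "i \<in> I" for i
        proof -
          have "\<gamma> \<le> v i / (real n - real i)"
            unfolding \<gamma>_def using I that by (intro Min_le) auto
          then show ?thesis using that by (simp add: I_def pos_le_divide_eq)
        qed
        have "\<gamma> \<in> (\<lambda>i. v i / (real n - real i)) ` I"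
          unfolding \<gamma>_def using I by (intro Min_in) auto
        then obtain i0 where i0: "i0 \<in> I" "\<gamma> = v i0 / (real n - real i0)" by auto
        then have \<gamma>_i0: "\<gamma> * (real n - real i0) = v i0" by (simp add: I_def)
        define t where "t = lc_monom (1 :: 'a) \<gamma>"
        define F where "F = smult (lc_monom 1 (- real n * \<gamma>)) (pcompose q [:0, t:])"
        have F: "coeff F i = lc_monom 1 ((real i - real n) * \<gamma>) * coeff q i" for i
          by (simp add: F_def coeff_pcompose_linear t_def lc_monom_power lc_monom_mult algebra_simps flip: mult.assoc)
        have "coeff F n = 1"
          using q by (simp add: F one_lc_def)
        moreover have "coeff F i = 0" if "i > n" for i
          using that q by (simp add: F coeff_eq_0)
        ultimately have dF: "degree F = n" "lead_coeff F = 1"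
          by (metis degree_le le_antisym le_degree zero_neq_one)+
        have vF: "vge 0 (coeff F i)" for i
        proof (cases "i \<in> I")
          case True
          have "vge ((real i - real n) * \<gamma> + v i) (coeff F i)"
            unfolding F by (intro vge_mult vge_monom v True)
          then show ?thesis
            using \<gamma>_le[OF True] by (elim vge_mono) (simp add: algebra_simps)
        next
          case nI: False
          show ?thesis
          proof (cases "i = n")
            case True
            then show ?thesis using \<open>coeff F n = 1\<close> vge_monom[of 0 1] by (simp add: one_lc_def)
          next
            case False
            then have "coeff q i = 0"
              using nI q(1) by (cases "i < n") (auto simp: I_def coeff_eq_0)
            then show ?thesis by (simp add: F vge_0)
          qed
        qed
        define r where "r = lc_red F"
        have r: "coeff r i = lc_coeff (coeff q i) ((real n - real i) * \<gamma>)" for i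
          unfolding r_def coeff_lc_red F lc_coeff_monom_mult by (simp add: algebra_simps)
        have "coeff r n = 1"
          using dF by (simp add: r_def coeff_lc_red lc_coeff_1)
        moreover have "coeff r i = 0" if "i > n" for i
          using that q by (simp add: r coeff_eq_0 lc_coeff_simps)
        ultimately have dr: "degree r = n" "lead_coeff r = 1"
          by (metis degree_le le_antisym le_degree zero_neq_one)+
        have "coeff r i0 \<noteq> 0"
          using v(2)[OF i0(1)] \<gamma>_i0 by (simp add: r mult.commute)
        moreover have "coeff r (n - 1) = 0"
          using q(3) by (simp add: r lc_coeff_simps)
        ultimately have pre: "lead_coeff r = 1" "degree r > 1" "coeff r (degree r - 1) = 0"
          "i0 < degree r" "coeff r i0 \<noteq> 0"
          using dr n i0(1) by (simp_all add: I_def)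
        obtain g h a b where gh: "r = g * h" "lead_coeff g = 1" "lead_coeff h = 1"
          "degree g > 0" "degree h > 0" "a * h + b * g = 1"
          by (rule residue_factorization[OF pre])
        have "degree F = degree g + degree h"
          using dr dF gh by (metis degree_mult_eq leading_coeff_0_iff zero_neq_one)
        moreover have "vge_poly 0 F" "lc_red F = g * h"
          using vF gh(1) by (simp_all add: vge_poly_def r_def)
        ultimately obtain G H where GH: "F = G * H" "degree G = degree g" "degree H = degree h"
          using hensel_factorization[OF _ _ dF(2) _ gh(2-6)] by blast
        have "degree G < degree p"
          using GH gh(4,5) \<open>degree F = degree g + degree h\<close> dF by (simp add: n_def)
        define G1 where "G1 = smult (inverse (lead_coeff G)) G"
        have "lead_coeff G \<noteq> 0" using dF(2) GH(1) by auto
        then have "degree G1 = degree G" "lead_coeff G1 = 1" by (auto simp: G1_def)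
        then obtain x where "poly G1 x = 0"
          using less.hyps[of G1] \<open>degree G < degree p\<close> GH gh(4) by auto
        then have "poly G x = 0" using \<open>lead_coeff G \<noteq> 0\<close> by (simp add: G1_def)
        then have "poly F x = 0" by (simp add: GH(1))
        then have "poly q (t * x) = 0"
          by (simp add: F_def poly_pcompose lc_monom_eq_0_iff mult.commute)
        then show ?thesis by (rule q_root)
      qed
    qed
  qed
qed

section \<open>Monoids of embeddings and their locally finite part\<close>

text \<open>A monoid is enough, and \<phi> can enter through its natural powers: on a finite orbit
  an injective self-map is a permutation, so each member of \<Gamma> is bijective on
  \<open>fin_part\<close>.\<close>

locale embedding_monoid =
  fixes \<Gamma> :: "('a :: {field_char_0, alg_closed_field} \<Rightarrow> 'a) set"
  assumes emb: "\<gamma> \<in> \<Gamma> \<Longrightarrow> field_embedding \<gamma>"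
    and id_mem: "id \<in> \<Gamma>"
    and comp_mem: "\<gamma> \<in> \<Gamma> \<Longrightarrow> \<delta> \<in> \<Gamma> \<Longrightarrow> \<gamma> \<circ> \<delta> \<in> \<Gamma>"
begin

definition orb :: "'a \<Rightarrow> 'a set" where "orb z = (\<lambda>\<gamma>. \<gamma> z) ` \<Gamma>"

definition fin_part :: "'a set" where "fin_part = {z. finite (orb z)}"

definition fixed :: "'a set" where "fixed = {z. \<forall>\<gamma>\<in>\<Gamma>. \<gamma> z = z}"

lemma self_orb: "z \<in> orb z"
  unfolding orb_def by (rule image_eqI[of _ _ id]) (auto simp: id_mem)

lemma orb_mono: "w \<in> orb z \<Longrightarrow> orb w \<subseteq> orb z"
proof
  fix y assume "w \<in> orb z" "y \<in> orb w"
  then obtain \<gamma> \<delta> where "\<gamma> \<in> \<Gamma>" "w = \<gamma> z" "\<delta> \<in> \<Gamma>" "y = \<delta> w" by (auto simp: orb_def)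
  then have "y = (\<delta> \<circ> \<gamma>) z" "\<delta> \<circ> \<gamma> \<in> \<Gamma>" using comp_mem by auto
  then show "y \<in> orb z" unfolding orb_def by blast
qed

lemma orb_apply: "\<gamma> \<in> \<Gamma> \<Longrightarrow> \<gamma> z \<in> orb z"
  by (auto simp: orb_def)

lemma fixed_subset: "fixed \<subseteq> fin_part"
proof
  fix z assume "z \<in> fixed"
  then have "orb z \<subseteq> {z}" by (auto simp: orb_def fixed_def)
  then show "z \<in> fin_part" by (auto simp: fin_part_def intro: finite_subset)
qed

lemma orb_fin_part: "z \<in> fin_part \<Longrightarrow> w \<in> orb z \<Longrightarrow> w \<in> fin_part"
  using orb_mono by (auto simp: fin_part_def intro: finite_subset)

lemma permutes_orb:
  assumes "\<gamma> \<in> \<Gamma>" "z \<in> fin_part"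
  shows "\<gamma> ` orb z = orb z"
proof (rule card_subset_eq)
  show "finite (orb z)" using assms by (simp add: fin_part_def)
  show "\<gamma> ` orb z \<subseteq> orb z"
    using orb_mono orb_apply[OF assms(1)] by blast
  show "card (\<gamma> ` orb z) = card (orb z)"
    using field_embedding.inj[OF emb[OF assms(1)]] by (metis card_image inj_on_subset subset_UNIV)
qed

lemma bij_betw_fin_part:
  assumes "\<gamma> \<in> \<Gamma>"
  shows "bij_betw \<gamma> fin_part fin_part"
  unfolding bij_betw_def
proof
  show "inj_on \<gamma> fin_part"
    using field_embedding.inj[OF emb[OF assms]] by (metis inj_on_subset subset_UNIV)
  show "\<gamma> ` fin_part = fin_part"
  proof
    show "\<gamma> ` fin_part \<subseteq> fin_part" using orb_fin_part orb_apply[OF assms] by blast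
    show "fin_part \<subseteq> \<gamma> ` fin_part"
      using permutes_orb[OF assms] self_orb orb_fin_part by blast
  qed
qed

lemma fin_part_closed:
  "0 \<in> fin_part" "1 \<in> fin_part"
  "x \<in> fin_part \<Longrightarrow> y \<in> fin_part \<Longrightarrow> x + y \<in> fin_part"
  "x \<in> fin_part \<Longrightarrow> y \<in> fin_part \<Longrightarrow> x * y \<in> fin_part"
  "x \<in> fin_part \<Longrightarrow> - x \<in> fin_part"
  "x \<in> fin_part \<Longrightarrow> inverse x \<in> fin_part"
proof -
  have "0 \<in> fixed" "1 \<in> fixed"
    using emb by (auto simp: fixed_def field_embedding.zero field_embedding.one)
  then show "0 \<in> fin_part" "1 \<in> fin_part" using fixed_subset by auto
  have s1: "orb (x + y) \<subseteq> (\<lambda>(u, v). u + v) ` (orb x \<times> orb y)"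
    and s2: "orb (x * y) \<subseteq> (\<lambda>(u, v). u * v) ` (orb x \<times> orb y)" for x y
    using emb by (auto simp: orb_def field_embedding.add field_embedding.mult)
  then show "x \<in> fin_part \<Longrightarrow> y \<in> fin_part \<Longrightarrow> x + y \<in> fin_part"
    "x \<in> fin_part \<Longrightarrow> y \<in> fin_part \<Longrightarrow> x * y \<in> fin_part" for x y
    using finite_subset[OF s1] finite_subset[OF s2] by (auto simp: fin_part_def)
  have "orb (- x) = uminus ` orb x" "orb (inverse x) = inverse ` orb x" for x
    unfolding orb_def image_image
    by (intro image_cong refl field_embedding.uminus field_embedding.inverse emb; assumption)+
  then show "x \<in> fin_part \<Longrightarrow> - x \<in> fin_part" "x \<in> fin_part \<Longrightarrow> inverse x \<in> fin_part"
    by (auto simp: fin_part_def)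
qed

lemma fixed_closed:
  "0 \<in> fixed" "1 \<in> fixed"
  "x \<in> fixed \<Longrightarrow> y \<in> fixed \<Longrightarrow> x + y \<in> fixed"
  "x \<in> fixed \<Longrightarrow> y \<in> fixed \<Longrightarrow> x * y \<in> fixed"
  "x \<in> fixed \<Longrightarrow> - x \<in> fixed"
  "x \<in> fixed \<Longrightarrow> inverse x \<in> fixed"
  using emb by (auto simp: fixed_def field_embedding.zero field_embedding.one field_embedding.add
      field_embedding.mult field_embedding.uminus field_embedding.inverse)

lemma fixed_of_nat: "of_nat n \<in> fixed"
  using emb by (auto simp: fixed_def field_embedding.of_nat)

lemma fin_part_sum: "(\<And>i. i \<in> A \<Longrightarrow> f i \<in> fin_part) \<Longrightarrow> sum f A \<in> fin_part"
  by (induction A rule: infinite_finite_induct) (auto intro: fin_part_closed)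

lemma fin_part_power: "x \<in> fin_part \<Longrightarrow> x ^ n \<in> fin_part"
  by (induction n) (auto intro: fin_part_closed)

text \<open>The conjugates of a root are roots of the conjugate polynomials. There are finitely many
  of those, because each of the coefficients has a finite orbit.\<close>

lemma root_in_fin_part:
  assumes p: "\<And>i. coeff p i \<in> fin_part" "p \<noteq> 0" and x: "poly p x = 0"
  shows "x \<in> fin_part"
proof -
  define R where "R = (\<lambda>\<gamma>. map_poly \<gamma> p) ` \<Gamma>"
  have "finite (PiE {..degree p} (\<lambda>i. orb (coeff p i)))"
    using p(1) by (intro finite_PiE) (auto simp: fin_part_def)
  moreover have "R \<subseteq> (\<lambda>f. \<Sum>i\<le>degree p. monom (f i) i) ` PiE {..degree p} (\<lambda>i. orb (coeff p i))"
  proof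
    fix q assume "q \<in> R"
    then obtain \<gamma> where \<gamma>: "\<gamma> \<in> \<Gamma>" "q = map_poly \<gamma> p" by (auto simp: R_def)
    have "q = (\<Sum>i\<le>degree p. monom (restrict (\<lambda>i. \<gamma> (coeff p i)) {..degree p} i) i)"
      using \<gamma> field_embedding.zero[OF emb[OF \<gamma>(1)]]
      by (intro poly_eqI) (auto simp: coeff_sum coeff_map_poly coeff_eq_0 if_distrib cong: if_cong)
    moreover have "restrict (\<lambda>i. \<gamma> (coeff p i)) {..degree p} \<in> PiE {..degree p} (\<lambda>i. orb (coeff p i))"
      using \<gamma>(1) by (auto simp: orb_apply)
    ultimately show "q \<in> (\<lambda>f. \<Sum>i\<le>degree p. monom (f i) i) ` PiE {..degree p} (\<lambda>i. orb (coeff p i))"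
      by (rule image_eqI)
  qed
  ultimately have "finite R" by (meson finite_imageI finite_subset)
  have "q \<noteq> 0" if "q \<in> R" for q
    using that p(2) emb by (auto simp: R_def map_poly_eq_0_iff field_embedding.eq_0_iff)
  then have "finite (\<Union>q\<in>R. {y. poly q y = 0})"
    using \<open>finite R\<close> poly_roots_finite by blast
  moreover have "orb x \<subseteq> (\<Union>q\<in>R. {y. poly q y = 0})"
  proof
    fix y assume "y \<in> orb x"
    then obtain \<gamma> where \<gamma>: "\<gamma> \<in> \<Gamma>" "y = \<gamma> x" by (auto simp: orb_def)
    have "poly (map_poly \<gamma> p) y = \<gamma> (poly p x)"
      unfolding \<gamma>(2) by (rule field_embedding.poly[OF emb[OF \<gamma>(1)], symmetric])
    then have "poly (map_poly \<gamma> p) y = 0"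
      using x field_embedding.zero[OF emb[OF \<gamma>(1)]] by simp
    then show "y \<in> (\<Union>q\<in>R. {y. poly q y = 0})" using \<gamma>(1) by (auto simp: R_def)
  qed
  ultimately show ?thesis by (auto simp: fin_part_def intro: finite_subset)
qed

section \<open>Orbit polynomials and density\<close>

definition orb_poly :: "'a \<Rightarrow> 'a poly" where
  "orb_poly z = (\<Prod>w\<in>orb z. [:- w, 1:])"

text \<open>Artin's argument: the members of \<Gamma> permute the linear factors. Thus elements with
  finite orbit are algebraic over \<open>fixed\<close>, and by \<open>orb_poly_root\<close> every
  root of the orbit polynomial has the form \<open>\<gamma> z\<close>.\<close>

lemma orb_poly_coeff_fixed:
  assumes z: "z \<in> fin_part"
  shows "coeff (orb_poly z) i \<in> fixed"
proof -
  have "\<gamma> (coeff (orb_poly z) i) = coeff (orb_poly z) i" if \<gamma>: "\<gamma> \<in> \<Gamma>" for \<gamma>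
  proof -
    interpret field_embedding \<gamma> by (rule emb[OF \<gamma>])
    have "map_poly \<gamma> (\<Prod>w\<in>A. [:- w, 1:]) = (\<Prod>w\<in>A. [:- \<gamma> w, 1:])" for A
    proof (induction A rule: infinite_finite_induct)
      case (insert w A)
      have "map_poly \<gamma> ([:- w, 1:] * (\<Prod>w\<in>A. [:- w, 1:])) = map_poly \<gamma> [:- w, 1:] * map_poly \<gamma> (\<Prod>w\<in>A. [:- w, 1:])"
        by (rule map_poly_hom_mult) (simp_all add: zero add mult)
      also have "map_poly \<gamma> [:- w, 1:] = [:- \<gamma> w, 1:]"
        by (simp add: map_poly_pCons zero one uminus)
      finally show ?case
        unfolding prod.insert[OF insert.hyps] insert.IH .
    qed (simp_all add: one)
    then have "map_poly \<gamma> (orb_poly z) = (\<Prod>w\<in>orb z. [:- \<gamma> w, 1:])"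
      by (simp add: orb_poly_def)
    also have "\<dots> = (\<Prod>w\<in>\<gamma> ` orb z. [:- w, 1:])"
      using inj by (subst prod.reindex) (auto intro: inj_on_subset)
    finally have "map_poly \<gamma> (orb_poly z) = orb_poly z"
      by (simp add: permutes_orb[OF \<gamma> z] orb_poly_def)
    then show ?thesis by (metis coeff_map_poly zero)
  qed
  then show ?thesis by (simp add: fixed_def)
qed

lemma orb_poly_root:
  assumes "z \<in> fin_part"
  shows "poly (orb_poly z) x = 0 \<longleftrightarrow> x \<in> orb z" "orb_poly z \<noteq> 0"
  using assms by (auto simp: orb_poly_def poly_prod fin_part_def)

text \<open>Density of \<open>\<Gamma>\<close> in the Galois group of \<open>fin_part\<close> over \<open>fixed\<close>. Instead of a primitive element, all the
  elements \<open>\<Sum>\<^sub>i z\<^sub>i m\<^sup>i\<close>, for natural numbers \<open>m\<close>, are used at once.\<close>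

lemma ex_agreeing_embedding:
  assumes g: "\<And>x y. x \<in> fin_part \<Longrightarrow> y \<in> fin_part \<Longrightarrow> g (x + y) = g x + g y"
    "\<And>x y. x \<in> fin_part \<Longrightarrow> y \<in> fin_part \<Longrightarrow> g (x * y) = g x * g y"
    "\<And>x. x \<in> fixed \<Longrightarrow> g x = x"
    and Z: "finite Z" "Z \<subseteq> fin_part"
  obtains \<gamma> where "\<gamma> \<in> \<Gamma>" "\<And>z. z \<in> Z \<Longrightarrow> g z = \<gamma> z"
proof -
  obtain n and z :: "nat \<Rightarrow> 'a" where z: "Z = z ` {..<n}"
    using Z(1) by (metis finite_conv_nat_seg_image lessThan_def)
  have zf: "z i \<in> fin_part" if "i < n" for i using that Z(2) z by auto
  have g_sum: "g (sum f A) = (\<Sum>i\<in>A. g (f i))" if "\<And>i. i \<in> A \<Longrightarrow> f i \<in> fin_part" for f and A :: "nat set"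
    using that
  proof (induction A rule: infinite_finite_induct)
    case (insert i A)
    then show ?case by (simp add: g(1) fin_part_sum)
  qed (simp_all add: g(3) fixed_closed)
  define \<theta> where "\<theta> m = (\<Sum>i<n. z i * of_nat m ^ i)" for m
  have of_nat_fin: "of_nat m ^ i \<in> fin_part" "of_nat m ^ i \<in> fixed" for m i
    using fixed_of_nat[of "m ^ i"] fixed_subset by auto
  have \<theta>_fin: "\<theta> m \<in> fin_part" for m
    unfolding \<theta>_def using zf of_nat_fin by (intro fin_part_sum fin_part_closed) auto
  have g\<theta>: "g (\<theta> m) = (\<Sum>i<n. g (z i) * of_nat m ^ i)" for m
    unfolding \<theta>_def using zf of_nat_fin
    by (subst g_sum) (auto simp: g(2) g(3) intro!: fin_part_closed sum.cong)
  have "\<exists>\<gamma>\<in>\<Gamma>. g (\<theta> m) = \<gamma> (\<theta> m)" for m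
  proof -
    let ?p = "orb_poly (\<theta> m)"
    have c: "coeff ?p i \<in> fixed" for i by (rule orb_poly_coeff_fixed[OF \<theta>_fin])
    then have cf: "coeff ?p i \<in> fin_part" for i using fixed_subset by auto
    have pow: "g (\<theta> m ^ i) = g (\<theta> m) ^ i" for i
      by (induction i) (auto simp: g(2) g(3) \<theta>_fin fin_part_power fixed_closed)
    have "0 = g (poly ?p (\<theta> m))"
    proof -
      have "poly ?p (\<theta> m) = 0" using orb_poly_root(1)[OF \<theta>_fin] self_orb by blast
      then show ?thesis using g(3)[OF fixed_closed(1)] by simp
    qed
    also have "\<dots> = (\<Sum>i\<le>degree ?p. g (coeff ?p i * \<theta> m ^ i))"
      unfolding poly_altdef by (intro g_sum fin_part_closed cf fin_part_power \<theta>_fin)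
    also have "\<dots> = poly ?p (g (\<theta> m))"
      unfolding poly_altdef
      by (intro sum.cong refl) (simp add: g(2) cf c g(3) pow \<theta>_fin fin_part_power)
    finally have "g (\<theta> m) \<in> orb (\<theta> m)" using orb_poly_root(1)[OF \<theta>_fin] by metis
    then show ?thesis by (auto simp: orb_def)
  qed
  then obtain \<gamma> where \<gamma>: "\<And>m. \<gamma> m \<in> \<Gamma>" "\<And>m. g (\<theta> m) = \<gamma> m (\<theta> m)" by metis
  \<comment> \<open>The embedding that agrees with \<open>g\<close> on \<open>\<theta> m\<close> may
    vary with \<open>m\<close>, but its values on the \<open>z i\<close> form one of finitely many
    patterns. Some pattern occurs for infinitely many \<open>m\<close>.\<close>
  define F where "F m = restrict (\<lambda>i. \<gamma> m (z i)) {..<n}" for m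
  have "finite (PiE {..<n} (\<lambda>i. orb (z i)))"
    using zf by (intro finite_PiE) (auto simp: fin_part_def)
  moreover have "F ` UNIV \<subseteq> PiE {..<n} (\<lambda>i. orb (z i))"
    by (rule image_subsetI) (simp add: F_def restrict_PiE_iff orb_apply[OF \<gamma>(1)])
  ultimately have "finite (F ` UNIV)" by (rule finite_subset[rotated])
  then obtain m0 where m0: "infinite {m \<in> UNIV. F m = F m0}"
    using pigeonhole_infinite[of "UNIV :: nat set" F] infinite_UNIV_nat by blast
  \<comment> \<open>The coefficients of \<open>q\<close> are the differences to be shown zero. It
    vanishes at infinitely many natural numbers, which are distinct elements in characteristic
    0.\<close>
  define q where "q = (\<Sum>i<n. monom (g (z i) - \<gamma> m0 (z i)) i)"
  have "poly q (of_nat m) = 0" if "F m = F m0" for m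
  proof -
    have "\<gamma> m (z i) = \<gamma> m0 (z i)" if "i < n" for i
      using fun_cong[OF \<open>F m = F m0\<close>, of i] that by (simp add: F_def)
    then have "\<gamma> m (\<theta> m) = (\<Sum>i<n. \<gamma> m0 (z i) * of_nat m ^ i)"
      using emb[OF \<gamma>(1)[of m]]
      by (simp add: \<theta>_def field_embedding.sum field_embedding.mult field_embedding.power field_embedding.of_nat)
    then have "(\<Sum>i<n. g (z i) * of_nat m ^ i) - (\<Sum>i<n. \<gamma> m0 (z i) * of_nat m ^ i) = 0"
      using \<gamma>(2)[of m] g\<theta>[of m] by simp
    then show ?thesis
      by (simp add: q_def poly_sum poly_monom left_diff_distrib sum_subtractf)
  qed
  then have "of_nat ` {m. F m = F m0} \<subseteq> {x. poly q x = 0}" by auto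
  moreover have "infinite ((of_nat :: nat \<Rightarrow> 'a) ` {m. F m = F m0})"
    using m0 by (simp add: finite_image_iff inj_on_def)
  ultimately have "q = 0" using poly_roots_finite finite_subset by blast
  have "g (z i) = \<gamma> m0 (z i)" if "i < n" for i
  proof -
    have "coeff q i = g (z i) - \<gamma> m0 (z i)"
      using that by (simp add: q_def coeff_sum if_distrib cong: if_cong)
    then show ?thesis using \<open>q = 0\<close> by simp
  qed
  then show thesis using that[OF \<gamma>(1)[of m0]] z by auto
qed

end

section \<open>The Krull topology\<close>

lemma BijGroup_mult: "f \<in> Bij S \<Longrightarrow> g \<in> Bij S \<Longrightarrow> f \<otimes>\<^bsub>BijGroup S\<^esub> g = compose S f g"
  by (simp add: BijGroup_def)

locale algebraic_extension = field L + subfield K L for L :: "('a, 'b) ring_scheme" (structure) and K +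
  assumes algebraic: "x \<in> carrier L \<Longrightarrow> (algebraic over K) x"
begin

abbreviation "G \<equiv> galois_group L K"

text \<open>A finite set that contains \<open>x\<close> and is mapped into itself by the Galois
  group. It provides the factors for compactness and the finite sets whose pointwise stabilisers are
  open and normal.\<close>

definition conj_set :: "'a \<Rightarrow> 'a set" where
  "conj_set x = {y \<in> carrier L. eval (Irr K x) y = \<zero>}"

lemma carrier_G: "carrier G = galois_auts L K"
  by (simp add: galois_group_def)

lemma galD:
  assumes "s \<in> carrier G"
  shows "s \<in> Bij (carrier L)" "s \<in> ring_hom L L" "\<And>x. x \<in> K \<Longrightarrow> s x = x"
    "s \<in> extensional (carrier L)" "inj_on s (carrier L)" "\<And>x. x \<in> carrier L \<Longrightarrow> s x \<in> carrier L"
    "s ` carrier L = carrier L"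
  using assms by (auto simp: carrier_G galois_auts_def Bij_def bij_betw_def)

lemma gal_eqI:
  assumes "s \<in> carrier G" "t \<in> carrier G" "\<And>x. x \<in> carrier L \<Longrightarrow> s x = t x"
  shows "s = t"
  using assms galD(4) extensionalityI by metis

lemma mult_G: "s \<in> carrier G \<Longrightarrow> t \<in> carrier G \<Longrightarrow> s \<otimes>\<^bsub>G\<^esub> t = compose (carrier L) s t"
  using galD(1) by (simp add: galois_group_def BijGroup_mult)

lemma mult_G_apply:
  "s \<in> carrier G \<Longrightarrow> t \<in> carrier G \<Longrightarrow> x \<in> carrier L \<Longrightarrow> (s \<otimes>\<^bsub>G\<^esub> t) x = s (t x)"
  by (simp add: mult_G compose_eq)

lemma one_G_apply: "x \<in> carrier L \<Longrightarrow> \<one>\<^bsub>G\<^esub> x = x"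
  by (simp add: galois_group_def BijGroup_def)

lemma group_G: "group G"
proof -
  have closed: "s \<otimes>\<^bsub>G\<^esub> t \<in> carrier G" if s: "s \<in> carrier G" and t: "t \<in> carrier G" for s t
  proof -
    have "compose (carrier L) s t \<in> Bij (carrier L)"
      using galD(1)[OF s] galD(1)[OF t] compose_Bij by blast
    moreover have "compose (carrier L) s t \<in> ring_hom L L"
      using galD(2,6)[OF s] galD(2,6)[OF t]
      by (intro ring_hom_memI) (auto simp: compose_def ring_hom_mult ring_hom_add ring_hom_one)
    moreover have "compose (carrier L) s t x = x" if "x \<in> K" for x
      using galD(3)[OF s that] galD(3)[OF t that] subset that by (auto simp: compose_def)
    ultimately show ?thesis
      using s t by (simp add: mult_G) (simp add: carrier_G galois_auts_def)
  qed
  have one: "\<one>\<^bsub>G\<^esub> \<in> carrier G"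
    using subset by (auto simp: galois_group_def BijGroup_def galois_auts_def Bij_def ring_hom_def bij_betw_def inj_on_def)
  show ?thesis
  proof (rule groupI)
    show "s \<otimes>\<^bsub>G\<^esub> t \<otimes>\<^bsub>G\<^esub> u = s \<otimes>\<^bsub>G\<^esub> (t \<otimes>\<^bsub>G\<^esub> u)"
      if "s \<in> carrier G" "t \<in> carrier G" "u \<in> carrier G" for s t u
      by (rule gal_eqI) (use that galD(6) in \<open>simp_all add: closed mult_G_apply\<close>)
    show "\<one>\<^bsub>G\<^esub> \<otimes>\<^bsub>G\<^esub> s = s" if "s \<in> carrier G" for s
      by (rule gal_eqI) (use that one galD(6) in \<open>simp_all add: closed mult_G_apply one_G_apply\<close>)
    show "\<exists>t\<in>carrier G. t \<otimes>\<^bsub>G\<^esub> s = \<one>\<^bsub>G\<^esub>" if s: "s \<in> carrier G" for s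
    proof -
      define t where "t = restrict (inv_into (carrier L) s) (carrier L)"
      have tB: "t \<in> Bij (carrier L)"
        unfolding t_def using galD(1)[OF s] by (rule restrict_inv_into_Bij)
      have st: "s (t x) = x" "t x \<in> carrier L" if "x \<in> carrier L" for x
        using that galD(7)[OF s] by (auto simp: t_def f_inv_into_f inv_into_into)
      have ts: "t (s x) = x" if "x \<in> carrier L" for x
        using that galD(5,6)[OF s] by (simp add: t_def inv_into_f_f)
      have "t \<in> ring_hom L L"
      proof (rule ring_hom_memI)
        fix x y assume xy: "x \<in> carrier L" "y \<in> carrier L"
        show "t x \<in> carrier L" using st xy by blast
        have "t (s (t x \<otimes> t y)) = t x \<otimes> t y" "t (s (t x \<oplus> t y)) = t x \<oplus> t y"
          using xy st(2) by (intro ts; simp)+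
        moreover have "s (t x \<otimes> t y) = x \<otimes> y" "s (t x \<oplus> t y) = x \<oplus> y"
          using xy st galD(2)[OF s] by (simp_all add: ring_hom_mult ring_hom_add)
        ultimately show "t (x \<otimes> y) = t x \<otimes> t y" "t (x \<oplus> y) = t x \<oplus> t y" by simp_all
      next
        show "t \<one> = \<one>" using ts[of \<one>] ring_hom_one[OF galD(2)[OF s]] by simp
      qed
      moreover have "t x = x" if "x \<in> K" for x
        using ts[of x] galD(3)[OF s that] that subset by auto
      ultimately have t: "t \<in> carrier G" using tB by (simp add: carrier_G galois_auts_def)
      have "t \<otimes>\<^bsub>G\<^esub> s = \<one>\<^bsub>G\<^esub>"
      proof (rule extensionalityI[of _ "carrier L"])
        show "t \<otimes>\<^bsub>G\<^esub> s \<in> extensional (carrier L)" using s t by (simp add: mult_G)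
        show "\<one>\<^bsub>G\<^esub> \<in> extensional (carrier L)" by (simp add: galois_group_def BijGroup_def)
      qed (use s t ts in \<open>simp add: mult_G_apply one_G_apply\<close>)
      then show ?thesis using t by blast
    qed
  qed (use closed one in auto)
qed

sublocale G: group G by (rule group_G)

lemma inv_G_apply:
  assumes "s \<in> carrier G" "x \<in> carrier L"
  shows "s ((inv\<^bsub>G\<^esub> s) x) = x" "(inv\<^bsub>G\<^esub> s) (s x) = x" "(inv\<^bsub>G\<^esub> s) x \<in> carrier L"
  using assms mult_G_apply[of s "inv\<^bsub>G\<^esub> s" x] mult_G_apply[of "inv\<^bsub>G\<^esub> s" s x]
  by (simp_all add: one_G_apply galD(6))

lemma gal_hom:
  assumes "s \<in> carrier G" "x \<in> carrier L" "y \<in> carrier L"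
  shows "s (x \<otimes> y) = s x \<otimes> s y" "s (x \<oplus> y) = s x \<oplus> s y"
  using galD(2)[OF assms(1)] assms(2,3) by (simp_all add: ring_hom_mult ring_hom_add)

lemma gal_zero: "s \<in> carrier G \<Longrightarrow> s \<zero> = \<zero>"
  using galD(3) subfield_axioms subringE(2)[OF subfieldE(1)[OF subfield_axioms]] by blast

lemma gal_eval:
  assumes s: "s \<in> carrier G" and "set p \<subseteq> K" "x \<in> carrier L"
  shows "s (eval p x) = eval p (s x)"
  using assms(2)
proof (induction p)
  case Nil
  then show ?case using s by (simp add: gal_zero)
next
  case (Cons a p)
  have a: "a \<in> carrier L" "set p \<subseteq> carrier L" "s a = a" using Cons.prems subset galD(3)[OF s] by auto
  have pow: "s (x [^] n) = s x [^] n" for n :: nat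
    by (induction n) (auto simp: gal_hom s assms(3) ring_hom_one[OF galD(2)[OF s]])
  have "eval p x \<in> carrier L" using a assms(3) by (simp add: eval_in_carrier)
  then show ?case using Cons a assms(3) s by (simp add: gal_hom pow)
qed

lemma Irr_K: "x \<in> carrier L \<Longrightarrow> set (Irr K x) \<subseteq> K" "x \<in> carrier L \<Longrightarrow> Irr K x \<noteq> []"
  "x \<in> carrier L \<Longrightarrow> eval (Irr K x) x = \<zero>"
proof -
  assume x: "x \<in> carrier L"
  note * = IrrE[OF subfield_axioms x algebraic[OF x]]
  show "set (Irr K x) \<subseteq> K" using *(1) by (auto simp: univ_poly_def polynomial_def)
  show "Irr K x \<noteq> []" using *(2) pirreducibleE(1)[OF subfieldE(1)[OF subfield_axioms] *(1)] by blast
  show "eval (Irr K x) x = \<zero>" by fact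
qed

lemma finite_conj_set: "x \<in> carrier L \<Longrightarrow> finite (conj_set x)"
proof -
  assume x: "x \<in> carrier L"
  have "Irr K x \<in> carrier (poly_ring L)"
    using IrrE(1)[OF subfield_axioms x algebraic[OF x]] carrier_polynomial_shell[OF subfieldE(1)[OF subfield_axioms]]
    by blast
  then have "finite {y. is_root (Irr K x) y}" by (rule finite_number_of_roots)
  moreover have "conj_set x \<subseteq> {y. is_root (Irr K x) y}"
    using Irr_K(2)[OF x] by (auto simp: conj_set_def is_root_def)
  ultimately show ?thesis by (rule finite_subset[rotated])
qed

lemma conj_set_self: "x \<in> carrier L \<Longrightarrow> x \<in> conj_set x"
  by (simp add: conj_set_def Irr_K)

lemma gal_conj_set: "s \<in> carrier G \<Longrightarrow> x \<in> carrier L \<Longrightarrow> y \<in> conj_set x \<Longrightarrow> s y \<in> conj_set x"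
  using gal_eval[of s "Irr K x" y] by (auto simp: conj_set_def Irr_K gal_zero galD(6))

definition agree :: "'a set \<Rightarrow> ('a \<Rightarrow> 'a) \<Rightarrow> ('a \<Rightarrow> 'a) set" where
  "agree Z s = {t \<in> carrier G. \<forall>z\<in>Z. t z = s z}"

text \<open>The cosets that generate the Krull topology are sets of automorphisms with prescribed
  values on a subextension, a form in which finite subsets can replace finite subextensions.\<close>

lemma l_coset_galois_auts:
  assumes "s \<in> carrier G" "K \<subseteq> E" "E \<subseteq> carrier L"
  shows "s <#\<^bsub>BijGroup (carrier L)\<^esub> galois_auts L E = agree E s"
proof
  have sub: "galois_auts L E \<subseteq> carrier G" using assms by (auto simp: carrier_G galois_auts_def)
  have eq: "s \<otimes>\<^bsub>BijGroup (carrier L)\<^esub> h = s \<otimes>\<^bsub>G\<^esub> h" for h by (simp add: galois_group_def)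
  show "s <#\<^bsub>BijGroup (carrier L)\<^esub> galois_auts L E \<subseteq> agree E s"
  proof
    fix t assume "t \<in> s <#\<^bsub>BijGroup (carrier L)\<^esub> galois_auts L E"
    then obtain h where h: "h \<in> galois_auts L E" "t = s \<otimes>\<^bsub>G\<^esub> h" by (auto simp: l_coset_def eq)
    then have "h \<in> carrier G" using sub by auto
    moreover have "h x = x" if "x \<in> E" for x using h that by (simp add: galois_auts_def)
    ultimately show "t \<in> agree E s" using assms h by (auto simp: agree_def mult_G_apply)
  qed
  show "agree E s \<subseteq> s <#\<^bsub>BijGroup (carrier L)\<^esub> galois_auts L E"
  proof
    fix t assume t: "t \<in> agree E s"
    define h where "h = inv\<^bsub>G\<^esub> s \<otimes>\<^bsub>G\<^esub> t"
    have tG: "t \<in> carrier G" using t by (simp add: agree_def)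
    then have hG: "h \<in> carrier G" using assms by (simp add: h_def)
    have "h x = x" if "x \<in> E" for x
    proof -
      have "x \<in> carrier L" using that assms by auto
      then show ?thesis
        using t tG assms that by (simp add: h_def mult_G_apply agree_def inv_G_apply)
    qed
    then have "h \<in> galois_auts L E" using hG by (simp add: galois_auts_def carrier_G)
    moreover have "t = s \<otimes>\<^bsub>G\<^esub> h" using assms tG by (simp add: h_def G.m_assoc[symmetric])
    ultimately show "t \<in> s <#\<^bsub>BijGroup (carrier L)\<^esub> galois_auts L E" by (auto simp: l_coset_def eq)
  qed
qed

lemma finite_extension_subset_agree:
  assumes Z: "finite Z" "Z \<subseteq> carrier L"
  obtains E where "subfield E L" "K \<subseteq> E" "finite_dimension K E" "Z \<subseteq> E"
proof -
  obtain xs where xs: "set xs = Z" using finite_list[OF Z(1)] by blast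
  have alg: "\<And>x. x \<in> set xs \<Longrightarrow> (algebraic over K) x" and sub: "set xs \<subseteq> carrier L"
    using algebraic Z xs by auto
  show thesis
  proof (rule that)
    show "subfield (finite_extension K xs) L"
      by (rule finite_extension_is_subfield[OF subfield_axioms sub alg])
    show "K \<subseteq> finite_extension K xs"
      using finite_extension_incl[OF subset sub] .
    show "finite_dimension K (finite_extension K xs)"
      by (rule finite_extension_finite_dimension(1)[OF subfield_axioms sub alg])
    show "Z \<subseteq> finite_extension K xs"
      using finite_extension_mem[OF subfieldE(1)[OF subfield_axioms] sub] xs by simp
  qed
qed

lemma agree_finite_dimension:
  assumes E: "subfield E L" "finite_dimension K E" and s: "s \<in> carrier G"
  obtains Z where "finite Z" "Z \<subseteq> carrier L" "agree Z s \<subseteq> agree E s"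
proof -
  obtain n where "dimension n K E" using E(2) by (auto simp: finite_dimension_def)
  then obtain Us where Us: "set Us \<subseteq> carrier L" "Span K Us = E"
    using exists_base[OF subfield_axioms] by metis
  have "agree (set Us) s \<subseteq> agree E s"
  proof
    fix t assume t: "t \<in> agree (set Us) s"
    then have tG: "t \<in> carrier G" by (simp add: agree_def)
    have "t (combine Ks Vs) = s (combine Ks Vs)" if "set Ks \<subseteq> K" "set Vs \<subseteq> set Us" for Ks Vs
      using that
    proof (induction Ks Vs rule: combine.induct)
      case (1 k Ks u Vs)
      have k: "k \<in> carrier L" "u \<in> carrier L" "t k = k" "s k = k" "t u = s u"
        using 1 subset Us(1) galD(3)[OF tG] galD(3)[OF s] t by (auto simp: agree_def)
      moreover have "combine Ks Vs \<in> carrier L"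
        using 1 subset Us(1) by (intro combine_in_carrier) auto
      ultimately show ?case using 1 tG s by (simp add: gal_hom)
    qed (simp_all add: gal_zero tG s)
    then have "t x = s x" if "x \<in> E" for x
      using that Span_eq_combine_set[OF subfield_axioms Us(1)] unfolding Us(2) by auto
    then show "t \<in> agree E s" using tG by (simp add: agree_def)
  qed
  then show thesis using that Us(1) by blast
qed

text \<open>The Krull topology is that of pointwise convergence. A finite subextension is spanned by
  finitely many elements, whose images determine an automorphism on it; conversely finitely many
  algebraic elements generate a finite subextension.\<close>

lemma openin_G_iff:
  "openin (topo G) U \<longleftrightarrow> U \<subseteq> carrier G \<and>
    (\<forall>s\<in>U. \<exists>Z. finite Z \<and> Z \<subseteq> carrier L \<and> agree Z s \<subseteq> U)" (is "_ \<longleftrightarrow> ?open U")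
proof
  define \<B> where "\<B> = {s <#\<^bsub>BijGroup (carrier L)\<^esub> galois_auts L E | s E.
           s \<in> galois_auts L K \<and> subfield E L \<and> K \<subseteq> E \<and> finite_dimension K E}"
  have topo: "topo G = topology_generated_by \<B>" by (simp add: galois_group_def \<B>_def)
  have in_\<B>: "agree E s \<in> \<B>" if "s \<in> carrier G" "subfield E L" "K \<subseteq> E" "finite_dimension K E" for s E
    using that l_coset_galois_auts[of s E, symmetric] subfieldE(3)[OF that(2)] unfolding \<B>_def carrier_G by blast
  show "?open U" if "openin (topo G) U"
  proof -
    have "generate_topology_on \<B> U" using that by (simp add: topo openin_topology_generated_by_iff)
    then show ?thesis
    proof induction
      case Empty
      then show ?case by simp
    next
      case (Int A B)
      have "\<exists>Z. finite Z \<and> Z \<subseteq> carrier L \<and> agree Z s \<subseteq> A \<inter> B" if s: "s \<in> A \<inter> B" for s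
      proof -
        obtain Z Z' where "finite Z" "Z \<subseteq> carrier L" "agree Z s \<subseteq> A" "finite Z'" "Z' \<subseteq> carrier L" "agree Z' s \<subseteq> B"
          using Int s by blast
        then show ?thesis by (intro exI[of _ "Z \<union> Z'"]) (auto simp: agree_def)
      qed
      then show ?case using Int by blast
    next
      case (UN \<K>)
      then show ?case by (meson Sup_least Sup_upper UnionE subset_trans)
    next
      case (Basis B)
      then obtain s E where B: "B = s <#\<^bsub>BijGroup (carrier L)\<^esub> galois_auts L E" and
        s: "s \<in> carrier G" and E: "subfield E L" "K \<subseteq> E" "finite_dimension K E"
        by (auto simp: \<B>_def carrier_G)
      have B': "B = agree E s"
        using l_coset_galois_auts[OF s E(2) subfieldE(3)[OF E(1)]] B by simp
      have "\<exists>Z. finite Z \<and> Z \<subseteq> carrier L \<and> agree Z t \<subseteq> agree E s" if t: "t \<in> agree E s" for t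
      proof -
        have "t \<in> carrier G" "agree E t = agree E s" using t by (auto simp: agree_def)
        then show ?thesis using agree_finite_dimension[OF E(1,3)] by metis
      qed
      then show ?case unfolding B' by (auto simp: agree_def)
    qed
  qed
  show "openin (topo G) U" if U: "?open U"
  proof -
    have "\<exists>V. openin (topo G) V \<and> s \<in> V \<and> V \<subseteq> U" if "s \<in> U" for s
    proof -
      have s: "s \<in> carrier G" using U that by auto
      obtain Z where Z: "finite Z" "Z \<subseteq> carrier L" "agree Z s \<subseteq> U" using U \<open>s \<in> U\<close> by blast
      obtain E where E: "subfield E L" "K \<subseteq> E" "finite_dimension K E" "Z \<subseteq> E"
        by (rule finite_extension_subset_agree[OF Z(1,2)])
      have "openin (topo G) (agree E s)"
        unfolding topo by (rule topology_generated_by_Basis[OF in_\<B>[OF s E(1-3)]])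
      moreover have "s \<in> agree E s" "agree E s \<subseteq> U" using s E(4) Z(3) by (auto simp: agree_def)
      ultimately show ?thesis by blast
    qed
    then show ?thesis by (subst openin_subopen) blast
  qed
qed

lemma topspace_G: "topspace (topo G) = carrier G"
proof
  show "topspace (topo G) \<subseteq> carrier G" using openin_topspace[of "topo G"] openin_G_iff by blast
  have "openin (topo G) (carrier G)"
    unfolding openin_G_iff by (auto simp: agree_def)
  then show "carrier G \<subseteq> topspace (topo G)" by (rule openin_subset)
qed

lemma openin_agree:
  assumes "finite Z" "Z \<subseteq> carrier L"
  shows "openin (topo G) (agree Z s)"
  unfolding openin_G_iff using assms by (auto simp: agree_def intro!: exI[of _ Z])

lemma openin_value:
  assumes "x \<in> carrier L"
  shows "openin (topo G) {s \<in> carrier G. P (s x)}"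
  unfolding openin_G_iff using assms by (auto simp: agree_def intro!: exI[of _ "{x}"])

lemma closedin_value:
  assumes "x \<in> carrier L"
  shows "closedin (topo G) {s \<in> carrier G. P (s x)}"
proof -
  have "topspace (topo G) - {s \<in> carrier G. P (s x)} = {s \<in> carrier G. \<not> P (s x)}"
    by (auto simp: topspace_G)
  then show ?thesis using openin_value[OF assms] by (simp add: closedin_def topspace_G)
qed

lemma gal_neq:
  assumes "s \<in> carrier G" "t \<in> carrier G" "s \<noteq> t"
  obtains x where "x \<in> carrier L" "s x \<noteq> t x"
  using assms gal_eqI by blast

section \<open>The Galois group as a profinite group\<close>

lemma topological_group_G: "topological_group G"
  unfolding topological_group_def
proof (intro conjI group_G topspace_G)
  show "continuous_map (prod_topology (topo G) (topo G)) (topo G) (\<lambda>(x, y). x \<otimes>\<^bsub>G\<^esub> y)"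
    unfolding continuous_map_def
  proof (intro conjI allI impI)
    show "(\<lambda>(x, y). x \<otimes>\<^bsub>G\<^esub> y) \<in> topspace (prod_topology (topo G) (topo G)) \<rightarrow> topspace (topo G)"
      by (auto simp: topspace_G)
    fix U assume U: "openin (topo G) U"
    show "openin (prod_topology (topo G) (topo G))
        {p \<in> topspace (prod_topology (topo G) (topo G)). (case p of (x, y) \<Rightarrow> x \<otimes>\<^bsub>G\<^esub> y) \<in> U}"
      unfolding openin_prod_topology_alt
    proof (intro allI impI)
      fix s t assume "(s, t) \<in> {p \<in> topspace (prod_topology (topo G) (topo G)). (case p of (x, y) \<Rightarrow> x \<otimes>\<^bsub>G\<^esub> y) \<in> U}"
      then have st: "s \<in> carrier G" "t \<in> carrier G" "s \<otimes>\<^bsub>G\<^esub> t \<in> U" by (auto simp: topspace_G)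
      obtain Z where Z: "finite Z" "Z \<subseteq> carrier L" "agree Z (s \<otimes>\<^bsub>G\<^esub> t) \<subseteq> U"
        using U st(3) unfolding openin_G_iff by blast
      have "openin (topo G) (agree (t ` Z) s)" "openin (topo G) (agree Z t)"
        using Z(1,2) galD(6)[OF st(2)] by (auto intro!: openin_agree)
      moreover have "s \<in> agree (t ` Z) s" "t \<in> agree Z t" using st by (auto simp: agree_def)
      moreover have "agree (t ` Z) s \<times> agree Z t \<subseteq>
          {p \<in> topspace (prod_topology (topo G) (topo G)). (case p of (x, y) \<Rightarrow> x \<otimes>\<^bsub>G\<^esub> y) \<in> U}"
      proof safe
        fix g h assume gh: "g \<in> agree (t ` Z) s" "h \<in> agree Z t"
        then have "g \<otimes>\<^bsub>G\<^esub> h \<in> agree Z (s \<otimes>\<^bsub>G\<^esub> t)"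
          using st Z(2) by (auto simp: agree_def mult_G_apply subset_iff)
        then show "g \<otimes>\<^bsub>G\<^esub> h \<in> U" using Z(3) by auto
        show "(g, h) \<in> topspace (prod_topology (topo G) (topo G))"
          using gh by (auto simp: topspace_G agree_def)
      qed
      ultimately show "\<exists>A B. openin (topo G) A \<and> openin (topo G) B \<and> s \<in> A \<and> t \<in> B \<and>
          A \<times> B \<subseteq> {p \<in> topspace (prod_topology (topo G) (topo G)). (case p of (x, y) \<Rightarrow> x \<otimes>\<^bsub>G\<^esub> y) \<in> U}"
        by blast
    qed
  qed
  show "continuous_map (topo G) (topo G) (\<lambda>x. inv\<^bsub>G\<^esub> x)"
    unfolding continuous_map_def
  proof (intro conjI allI impI)
    show "(\<lambda>x. inv\<^bsub>G\<^esub> x) \<in> topspace (topo G) \<rightarrow> topspace (topo G)" by (auto simp: topspace_G)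
    fix U assume U: "openin (topo G) U"
    show "openin (topo G) {x \<in> topspace (topo G). inv\<^bsub>G\<^esub> x \<in> U}"
      unfolding openin_G_iff
    proof (intro conjI ballI)
      fix s assume "s \<in> {x \<in> topspace (topo G). inv\<^bsub>G\<^esub> x \<in> U}"
      then have s: "s \<in> carrier G" "inv\<^bsub>G\<^esub> s \<in> U" by (auto simp: topspace_G)
      obtain Z where Z: "finite Z" "Z \<subseteq> carrier L" "agree Z (inv\<^bsub>G\<^esub> s) \<subseteq> U"
        using U s(2) unfolding openin_G_iff by blast
      have "agree ((inv\<^bsub>G\<^esub> s) ` Z) s \<subseteq> {x \<in> topspace (topo G). inv\<^bsub>G\<^esub> x \<in> U}"
      proof
        fix g assume g: "g \<in> agree ((inv\<^bsub>G\<^esub> s) ` Z) s"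
        then have gG: "g \<in> carrier G" by (simp add: agree_def)
        have "(inv\<^bsub>G\<^esub> g) z = (inv\<^bsub>G\<^esub> s) z" if z: "z \<in> Z" for z
        proof -
          have zL: "z \<in> carrier L" using z Z(2) by auto
          have "g ((inv\<^bsub>G\<^esub> s) z) = z" using g z inv_G_apply(1)[OF s(1) zL] by (simp add: agree_def)
          then show ?thesis using inv_G_apply(2)[OF gG inv_G_apply(3)[OF s(1) zL]] by simp
        qed
        then have "inv\<^bsub>G\<^esub> g \<in> agree Z (inv\<^bsub>G\<^esub> s)" using gG by (simp add: agree_def)
        then show "g \<in> {x \<in> topspace (topo G). inv\<^bsub>G\<^esub> x \<in> U}" using Z(3) gG by (auto simp: topspace_G)
      qed
      moreover have "(inv\<^bsub>G\<^esub> s) ` Z \<subseteq> carrier L" using inv_G_apply(3)[OF s(1)] Z(2) by auto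
      ultimately show "\<exists>Z. finite Z \<and> Z \<subseteq> carrier L \<and> agree Z s \<subseteq> {x \<in> topspace (topo G). inv\<^bsub>G\<^esub> x \<in> U}"
        using Z(1) by blast
    qed (auto simp: topspace_G)
  qed
qed

lemma Hausdorff_space_G: "Hausdorff_space (topo G)"
  unfolding Hausdorff_space_def
proof (intro allI impI)
  fix s t assume "s \<in> topspace (topo G) \<and> t \<in> topspace (topo G) \<and> s \<noteq> t"
  then have st: "s \<in> carrier G" "t \<in> carrier G" "s \<noteq> t" by (auto simp: topspace_G)
  obtain x where x: "x \<in> carrier L" "s x \<noteq> t x" by (rule gal_neq[OF st])
  then have "openin (topo G) {g \<in> carrier G. g x = s x}" "openin (topo G) {g \<in> carrier G. g x = t x}"
    by (auto intro: openin_value)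
  moreover have "disjnt {g \<in> carrier G. g x = s x} {g \<in> carrier G. g x = t x}"
    using x by (auto simp: disjnt_def)
  ultimately show "\<exists>U V. openin (topo G) U \<and> openin (topo G) V \<and> s \<in> U \<and> t \<in> V \<and> disjnt U V"
    using st by blast
qed

lemma totally_disconnected_G:
  assumes s: "s \<in> carrier G"
  shows "connected_component_of_set (topo G) s = {s}"
proof
  show "connected_component_of_set (topo G) s \<subseteq> {s}"
  proof
    fix t assume "t \<in> connected_component_of_set (topo G) s"
    then obtain C where C: "connectedin (topo G) C" "s \<in> C" "t \<in> C"
      by (auto simp: connected_component_of_def)
    then have t: "t \<in> carrier G" using connectedin_subset_topspace topspace_G by blast
    show "t \<in> {s}"
    proof (rule ccontr)
      assume "t \<notin> {s}"
      then obtain x where x: "x \<in> carrier L" "s x \<noteq> t x" using gal_neq[OF s t] by auto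
      have "C \<subseteq> {g \<in> carrier G. g x = s x} \<or> disjnt C {g \<in> carrier G. g x = s x}"
        by (intro connectedin_clopen_cases[OF C(1)] closedin_value openin_value x)
      then show False using C s t x by (auto simp: disjnt_def)
    qed
  qed
  show "{s} \<subseteq> connected_component_of_set (topo G) s"
    using s by (simp add: connected_component_of_refl topspace_G)
qed

text \<open>The group is closed in the product of the finite discrete sets
  \<open>conj_set x\<close>, which is compact by Tychonoff's theorem. A limit of automorphisms is
  again an automorphism, because each defining condition can be tested on finitely many
  elements.\<close>

lemma compact_space_G: "compact_space (topo G)"
proof -
  define T where "T = product_topology (\<lambda>x. discrete_topology (conj_set x)) (carrier L)"
  have ts: "topspace T = PiE (carrier L) conj_set" by (simp add: T_def)
  have "compact_space T"
    unfolding T_def by (rule compact_space_product_topology[THEN iffD2])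
      (auto simp: compact_space_discrete_topology finite_conj_set)
  have sub: "carrier G \<subseteq> topspace T"
    using galD(4) gal_conj_set conj_set_self by (fastforce simp: ts PiE_def)
  define cyl where "cyl Z f = {f' \<in> topspace T. \<forall>z\<in>Z. f' z = f z}" for Z and f :: "'a \<Rightarrow> 'a"
  have cyl_open: "openin T (cyl Z f)" if "finite Z" "Z \<subseteq> carrier L" "f \<in> topspace T" for Z f
  proof -
    have "cyl Z f = PiE (carrier L) (\<lambda>x. if x \<in> Z then {f x} else conj_set x)"
    proof (rule Set.set_eqI)
      fix f'
      have fC: "f x \<in> conj_set x" if "x \<in> carrier L" for x
        using \<open>f \<in> topspace T\<close> that by (auto simp: ts PiE_iff)
      have "(\<forall>x\<in>carrier L. f' x \<in> conj_set x) \<and> (\<forall>z\<in>Z. f' z = f z) \<longleftrightarrow>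
          (\<forall>x\<in>carrier L. f' x \<in> (if x \<in> Z then {f x} else conj_set x))" (is "?l \<longleftrightarrow> ?r")
      proof
        show "?l \<Longrightarrow> ?r" by simp
        assume r: ?r
        have "f' x \<in> conj_set x" if "x \<in> carrier L" for x
          using r fC that by (cases "x \<in> Z") force+
        moreover have "f' z = f z" if "z \<in> Z" for z
          using r that \<open>Z \<subseteq> carrier L\<close> by force
        ultimately show ?l by blast
      qed
      then show "f' \<in> cyl Z f \<longleftrightarrow> f' \<in> PiE (carrier L) (\<lambda>x. if x \<in> Z then {f x} else conj_set x)"
        unfolding cyl_def ts PiE_iff by blast
    qed
    moreover have "openin T (PiE (carrier L) (\<lambda>x. if x \<in> Z then {f x} else conj_set x))"
      unfolding T_def
    proof (rule product_topology_basis)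
      show "openin (discrete_topology (conj_set x)) (if x \<in> Z then {f x} else conj_set x)" for x
        using that by (auto simp: ts)
      have "{i. (if i \<in> Z then {f i} else conj_set i) \<noteq> topspace (discrete_topology (conj_set i))} \<subseteq> Z"
        by auto
      then show "finite {i. (if i \<in> Z then {f i} else conj_set i) \<noteq> topspace (discrete_topology (conj_set i))}"
        using that(1) by (rule finite_subset)
    qed
    ultimately show ?thesis by simp
  qed
  have witness: "\<exists>Z. finite Z \<and> Z \<subseteq> carrier L \<and> cyl Z f \<subseteq> topspace T - carrier G"
    if f: "f \<in> topspace T" "f \<notin> carrier G" for f
  proof (rule ccontr)
    assume no: "\<nexists>Z. finite Z \<and> Z \<subseteq> carrier L \<and> cyl Z f \<subseteq> topspace T - carrier G"
    have ex: "\<exists>s\<in>carrier G. \<forall>z\<in>Z. s z = f z" if "finite Z" "Z \<subseteq> carrier L" for Z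
    proof -
      have "\<not> cyl Z f \<subseteq> topspace T - carrier G" using no that by blast
      then show ?thesis by (auto simp: cyl_def)
    qed
    have fL: "f x \<in> carrier L" if "x \<in> carrier L" for x
      using f(1) that by (auto simp: ts PiE_iff conj_set_def)
    have "f \<in> ring_hom L L"
    proof (rule ring_hom_memI)
      fix x y assume xy: "x \<in> carrier L" "y \<in> carrier L"
      obtain s where s: "s \<in> carrier G" "\<forall>z\<in>{x, y, x \<otimes> y, x \<oplus> y}. s z = f z"
        using ex[of "{x, y, x \<otimes> y, x \<oplus> y}"] xy by auto
      then show "f (x \<otimes> y) = f x \<otimes> f y" "f (x \<oplus> y) = f x \<oplus> f y"
        using gal_hom[OF s(1) xy] by auto
      show "f x \<in> carrier L" using fL xy by blast
    next
      obtain s where s: "s \<in> carrier G" "\<forall>z\<in>{\<one>}. s z = f z" using ex[of "{\<one>}"] by auto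
      then show "f \<one> = \<one>" using ring_hom_one[OF galD(2)] by fastforce
    qed
    moreover have "f x = x" if x: "x \<in> K" for x
    proof -
      obtain s where "s \<in> carrier G" "\<forall>z\<in>{x}. s z = f z" using ex[of "{x}"] x subset by auto
      then show ?thesis using galD(3) x by fastforce
    qed
    moreover have "f \<in> Bij (carrier L)"
    proof -
      have "inj_on f (carrier L)"
      proof (rule inj_onI)
        fix x y assume xy: "x \<in> carrier L" "y \<in> carrier L" "f x = f y"
        obtain s where s: "s \<in> carrier G" "\<forall>z\<in>{x, y}. s z = f z" using ex[of "{x, y}"] xy by auto
        then have "s x = s y" using xy by simp
        then show "x = y" using galD(5)[OF s(1)] xy by (simp add: inj_on_def)
      qed
      moreover have "f ` carrier L = carrier L"
      proof
        show "f ` carrier L \<subseteq> carrier L" using fL by auto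
        show "carrier L \<subseteq> f ` carrier L"
        proof
          fix y assume y: "y \<in> carrier L"
          have cs: "finite (conj_set y)" "conj_set y \<subseteq> carrier L"
            using finite_conj_set[OF y] by (auto simp: conj_set_def)
          \<comment> \<open>Surjectivity is also a finite condition: agreement is imposed on the
            whole finite set \<open>conj_set y\<close>, inside which \<open>s\<close> has its
            preimage of \<open>y\<close>.\<close>
          obtain s where s: "s \<in> carrier G" "\<forall>z\<in>conj_set y. s z = f z" using ex[OF cs] by blast
          have "(inv\<^bsub>G\<^esub> s) y \<in> conj_set y"
            using gal_conj_set[OF G.inv_closed[OF s(1)] y conj_set_self[OF y]] .
          then have "f ((inv\<^bsub>G\<^esub> s) y) = y" "(inv\<^bsub>G\<^esub> s) y \<in> carrier L"
            using s(2) inv_G_apply[OF s(1) y] by auto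
          then show "y \<in> f ` carrier L" by (metis imageI)
        qed
      qed
      ultimately show ?thesis using f(1) by (auto simp: Bij_def bij_betw_def ts PiE_def)
    qed
    ultimately have "f \<in> carrier G" by (simp add: carrier_G galois_auts_def)
    then show False using f(2) by simp
  qed
  have "openin T (topspace T - carrier G)"
    unfolding openin_subopen[of T "topspace T - carrier G"]
  proof
    fix f assume f: "f \<in> topspace T - carrier G"
    then obtain Z where Z: "finite Z" "Z \<subseteq> carrier L" "cyl Z f \<subseteq> topspace T - carrier G"
      using witness by blast
    have "f \<in> cyl Z f" "f \<in> topspace T" using f by (simp_all add: cyl_def)
    then show "\<exists>V. openin T V \<and> f \<in> V \<and> V \<subseteq> topspace T - carrier G"
      using cyl_open[OF Z(1,2)] Z(3) by (intro exI[of _ "cyl Z f"] conjI)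
  qed
  then have "closedin T (carrier G)" using sub by (simp add: closedin_def)
  then have "compactin T (carrier G)" using \<open>compact_space T\<close> by (rule closedin_compact_space[rotated])
  then have cpt: "compactin (subtopology T (carrier G)) (carrier G)"
    by (simp add: compactin_subtopology)
  have "continuous_map (subtopology T (carrier G)) (topo G) id"
    unfolding continuous_map_def
  proof (intro conjI allI impI)
    show "id \<in> topspace (subtopology T (carrier G)) \<rightarrow> topspace (topo G)"
      by (auto simp: topspace_G)
    fix U assume U: "openin (topo G) U"
    have "\<exists>V. openin T V \<and> s \<in> V \<and> V \<inter> carrier G \<subseteq> U" if s: "s \<in> U" for s
    proof -
      have sG: "s \<in> carrier G" using U s openin_G_iff by blast
      obtain Z where Z: "finite Z" "Z \<subseteq> carrier L" "agree Z s \<subseteq> U"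
        using U s unfolding openin_G_iff by blast
      have "s \<in> topspace T" using sub sG by auto
      moreover have "cyl Z s \<inter> carrier G \<subseteq> agree Z s" by (auto simp: cyl_def agree_def)
      ultimately show ?thesis
        using cyl_open[OF Z(1,2)] Z(3) by (intro exI[of _ "cyl Z s"]) (auto simp: cyl_def)
    qed
    then obtain V where V: "\<And>s. s \<in> U \<Longrightarrow> openin T (V s) \<and> s \<in> V s \<and> V s \<inter> carrier G \<subseteq> U" by metis
    have "{x \<in> topspace (subtopology T (carrier G)). id x \<in> U} = \<Union>(V ` U) \<inter> carrier G"
      using V U sub openin_G_iff by auto
    moreover have "openin T (\<Union>(V ` U))" using V by blast
    ultimately show "openin (subtopology T (carrier G)) {x \<in> topspace (subtopology T (carrier G)). id x \<in> U}"
      by (auto simp: openin_subtopology)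
  qed
  from image_compactin[OF cpt this] show ?thesis
    by (simp add: compact_space_def topspace_G)
qed

lemma profinite_group_G: "profinite_group G"
  unfolding profinite_group_def
  using topological_group_G compact_space_G Hausdorff_space_G totally_disconnected_G by blast

end

section \<open>Galois groups that are pro-\<open>l\<close>\<close>

text \<open>A prime \<open>p\<close> dividing the order yields, by Sylow's theorem, a subgroup of
  order \<open>p\<close>, whose nontrivial elements have order \<open>p\<close>. Torsion of
  \<open>l\<close>-power order then leaves only \<open>p = l\<close>.\<close>

lemma (in group) order_eq_power_if_power_torsion:
  assumes l: "Factorial_Ring.prime (l :: nat)" and fin: "finite (carrier G)"
    and tor: "\<And>x. x \<in> carrier G \<Longrightarrow> \<exists>n :: nat. x [^] (l ^ n) = \<one>"
  shows "\<exists>n. Coset.order G = l ^ n"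
proof -
  have only: "p = l" if p: "Factorial_Ring.prime p" "p dvd Coset.order G" for p :: nat
  proof -
    obtain m where "Coset.order G = p ^ 1 * m" using p(2) by (auto elim: dvdE)
    from sylow_thm[OF p(1) group_axioms this fin] obtain H where H: "subgroup H G" "card H = p" by auto
    then have "H \<noteq> {\<one>}" using prime_gt_1_nat[OF p(1)] by auto
    then obtain x where x: "x \<in> H" "x \<noteq> \<one>"
      using subgroup.one_closed[OF H(1)] by blast
    have xG: "x \<in> carrier G" by (rule subgroup.mem_carrier[OF H(1) x(1)])
    have "x [^] p = \<one>"
    proof -
      interpret H: group "G\<lparr>carrier := H\<rparr>" using H(1) by (rule subgroup_imp_group)
      have "x [^]\<^bsub>G\<lparr>carrier := H\<rparr>\<^esub> Coset.order (G\<lparr>carrier := H\<rparr>) = \<one>\<^bsub>G\<lparr>carrier := H\<rparr>\<^esub>"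
        by (rule H.pow_order_eq_1) (use x in simp)
      then show ?thesis using H(2) nat_pow_consistent[of x p H] by (simp add: Coset.order_def)
    qed
    then have "ord x dvd p" using xG by (simp add: pow_eq_id)
    moreover have "ord x \<noteq> 1" using xG x(2) pow_eq_id[OF xG, of 1] by auto
    ultimately have "ord x = p" using p(1) by (metis prime_nat_iff)
    moreover obtain n :: nat where "x [^] (l ^ n) = \<one>" using tor[OF xG] by blast
    then have "ord x dvd l ^ n" using xG by (simp add: pow_eq_id)
    ultimately have "p dvd l" using p(1) prime_dvd_power by blast
    then show ?thesis using p(1) l by (simp add: primes_dvd_imp_eq)
  qed
  have "Coset.order G \<noteq> 0" using fin by (simp add: order_gt_0_iff_finite)
  then obtain m where m: "Coset.order G = l ^ multiplicity l (Coset.order G) * m" "\<not> l dvd m"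
    using l by (metis multiplicity_decompose' not_prime_unit)
  have "m = 1"
  proof (rule ccontr)
    assume "m \<noteq> 1"
    then obtain p where "Factorial_Ring.prime p" "p dvd m" by (metis prime_factor_nat)
    then have "p = l" using only m(1) by (metis dvd_mult)
    then show False using \<open>p dvd m\<close> m(2) by simp
  qed
  then show ?thesis using m(1) by auto
qed

context algebraic_extension
begin

lemma nat_pow_G_fix:
  assumes "s \<in> carrier G" "x \<in> carrier L" "s x = x"
  shows "(s [^]\<^bsub>G\<^esub> (n :: nat)) x = x"
  using assms by (induction n) (auto simp: one_G_apply mult_G_apply)

lemma agree_one_imp_subset:
  assumes N: "open_normal G N"
  obtains Z where "finite Z" "Z \<subseteq> carrier L" "agree Z \<one>\<^bsub>G\<^esub> \<subseteq> N"
proof -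
  have "\<one>\<^bsub>G\<^esub> \<in> N" using N by (auto simp: open_normal_def normal_def intro: subgroup.one_closed)
  then show thesis using N that unfolding open_normal_def openin_G_iff by blast
qed

lemma r_coset_eq_if_agree:
  assumes N: "N \<lhd> G" and sub: "agree Z \<one>\<^bsub>G\<^esub> \<subseteq> N" and Z: "Z \<subseteq> carrier L"
    and gh: "g \<in> carrier G" "h \<in> carrier G" "\<And>z. z \<in> Z \<Longrightarrow> g z = h z"
  shows "N #>\<^bsub>G\<^esub> g = N #>\<^bsub>G\<^esub> h"
proof -
  interpret N: normal N G by fact
  have "inv\<^bsub>G\<^esub> g \<otimes>\<^bsub>G\<^esub> h \<in> agree Z \<one>\<^bsub>G\<^esub>"
    using gh Z by (auto simp: agree_def mult_G_apply one_G_apply inv_G_apply subset_iff simp flip: gh(3))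
  then have "g \<otimes>\<^bsub>G\<^esub> (inv\<^bsub>G\<^esub> g \<otimes>\<^bsub>G\<^esub> h) \<in> g <#\<^bsub>G\<^esub> N"
    using sub by (auto simp: l_coset_def)
  then have "h \<in> N #>\<^bsub>G\<^esub> g"
    using gh N.coset_eq by (simp add: G.m_assoc[symmetric])
  then show ?thesis using G.repr_independence gh(1) N.subgroup_axioms by blast
qed

text \<open>An open normal subgroup contains all automorphisms trivial on some finite
  \<open>Z\<close>. So the quotient is finite, and each coset has a representative in the dense set
  \<open>D\<close>, whose \<open>l\<close>-power torsion on the elements of \<open>Z\<close> becomes
  torsion of the coset.\<close>

lemma pro_group_G:
  assumes l: "Factorial_Ring.prime l" and D: "D \<subseteq> carrier G"
    and dense: "\<And>g Z. g \<in> carrier G \<Longrightarrow> finite Z \<Longrightarrow> Z \<subseteq> carrier L \<Longrightarrow> \<exists>d\<in>D. \<forall>z\<in>Z. d z = g z"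
    and tor: "\<And>d x. d \<in> D \<Longrightarrow> x \<in> carrier L \<Longrightarrow> \<exists>n :: nat. (d [^]\<^bsub>G\<^esub> (l ^ n)) x = x"
  shows "pro_group l G"
  unfolding pro_group_def
proof (intro conjI profinite_group_G allI impI)
  fix N assume oN: "open_normal G N"
  then have nN: "N \<lhd> G" by (simp add: open_normal_def)
  interpret N: normal N G by fact
  obtain Z where Z: "finite Z" "Z \<subseteq> carrier L" "agree Z \<one>\<^bsub>G\<^esub> \<subseteq> N"
    by (rule agree_one_imp_subset[OF oN])
  interpret Q: group "G Mod N" by (rule N.factorgroup_is_group)
  have carrier_Q: "carrier (G Mod N) = rcosets\<^bsub>G\<^esub> N" by (simp add: FactGroup_def)
  interpret h: group_hom G "G Mod N" "\<lambda>a. N #>\<^bsub>G\<^esub> a"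
    by (intro group_hom.intro group_G Q.group_axioms) (simp add: group_hom_axioms_def N.r_coset_hom_Mod)
  define rep where "rep f = (SOME g. g \<in> carrier G \<and> restrict g Z = f)" for f
  have "rcosets\<^bsub>G\<^esub> N \<subseteq> (\<lambda>f. N #>\<^bsub>G\<^esub> rep f) ` PiE Z conj_set"
  proof
    fix q assume "q \<in> rcosets\<^bsub>G\<^esub> N"
    then obtain g where g: "g \<in> carrier G" "q = N #>\<^bsub>G\<^esub> g" by (auto simp: RCOSETS_def)
    have rep: "rep (restrict g Z) \<in> carrier G" "restrict (rep (restrict g Z)) Z = restrict g Z"
      unfolding rep_def using someI[of "\<lambda>h. h \<in> carrier G \<and> restrict h Z = restrict g Z" g] g(1) by auto
    have "q = N #>\<^bsub>G\<^esub> rep (restrict g Z)"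
      unfolding g(2)
    proof (rule r_coset_eq_if_agree[OF nN Z(3,2) g(1) rep(1)])
      fix z assume "z \<in> Z"
      then show "g z = rep (restrict g Z) z" using fun_cong[OF rep(2), of z] by simp
    qed
    moreover have "restrict g Z \<in> PiE Z conj_set"
      using Z(2) gal_conj_set[OF g(1)] conj_set_self by (auto simp: restrict_PiE_iff)
    ultimately show "q \<in> (\<lambda>f. N #>\<^bsub>G\<^esub> rep f) ` PiE Z conj_set" by blast
  qed
  moreover have "finite (PiE Z conj_set)" using Z finite_conj_set by (auto intro: finite_PiE)
  ultimately have fin: "finite (carrier (G Mod N))" unfolding carrier_Q by (meson finite_imageI finite_subset)
  have "\<exists>n :: nat. q [^]\<^bsub>G Mod N\<^esub> (l ^ n) = \<one>\<^bsub>G Mod N\<^esub>" if q: "q \<in> carrier (G Mod N)" for q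
  proof -
    obtain g where g: "g \<in> carrier G" "q = N #>\<^bsub>G\<^esub> g" using q by (auto simp: carrier_Q RCOSETS_def)
    obtain d where d: "d \<in> D" "\<forall>z\<in>Z. d z = g z" using dense[OF g(1) Z(1,2)] by blast
    have dG: "d \<in> carrier G" using d D by auto
    have q': "q = N #>\<^bsub>G\<^esub> d" unfolding g(2) using d Z by (intro r_coset_eq_if_agree[OF nN Z(3,2) g(1) dG]) auto
    obtain n :: "'a \<Rightarrow> nat" where n: "\<And>z. z \<in> Z \<Longrightarrow> (d [^]\<^bsub>G\<^esub> (l ^ n z)) z = z"
      using tor[OF d(1)] Z(2) by (metis subsetD)
    \<comment> \<open>The sum bounds all the exponents \<open>n z\<close>, so a single
      \<open>l\<close>-power fixes every element of \<open>Z\<close>.\<close>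
    define m where "m = sum n Z"
    have "(d [^]\<^bsub>G\<^esub> (l ^ m)) z = z" if z: "z \<in> Z" for z
    proof -
      have "m = n z + (m - n z)" using z Z(1) by (simp add: m_def member_le_sum)
      then have "d [^]\<^bsub>G\<^esub> (l ^ m) = (d [^]\<^bsub>G\<^esub> (l ^ n z)) [^]\<^bsub>G\<^esub> (l ^ (m - n z))"
        using dG by (metis G.nat_pow_pow power_add)
      then show ?thesis using nat_pow_G_fix[of "d [^]\<^bsub>G\<^esub> (l ^ n z)" z "l ^ (m - n z)"] n[OF z] dG z Z(2) by auto
    qed
    then have "d [^]\<^bsub>G\<^esub> (l ^ m) \<in> agree Z \<one>\<^bsub>G\<^esub>"
      using dG Z(2) by (auto simp: agree_def one_G_apply subset_iff)
    then have "d [^]\<^bsub>G\<^esub> (l ^ m) \<in> N" using Z(3) by blast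
    then have "N #>\<^bsub>G\<^esub> (d [^]\<^bsub>G\<^esub> (l ^ m)) = N" using N.rcos_const[OF group_G] by blast
    then have "q [^]\<^bsub>G Mod N\<^esub> (l ^ m) = \<one>\<^bsub>G Mod N\<^esub>"
      unfolding q' using h.hom_nat_pow[OF dG] by (simp add: FactGroup_def)
    then show ?thesis ..
  qed
  from Q.order_eq_power_if_power_torsion[OF l fin this]
  show "\<exists>n. card (rcosets\<^bsub>G\<^esub> N) = l ^ n" by (simp add: Coset.order_def carrier_Q)
qed

text \<open>The pointwise stabiliser of the stable set \<open>conj_set x\<close> is normal, and it
  is open as the set is finite. It excludes \<open>g\<close> as soon as \<open>g\<close> moves
  \<open>x\<close>.\<close>

lemma ex_open_normal_not_mem:
  assumes g: "g \<in> carrier G" "g \<noteq> \<one>\<^bsub>G\<^esub>"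
  obtains N where "open_normal G N" "g \<notin> N"
proof -
  have "\<one>\<^bsub>G\<^esub> \<in> carrier G" by simp
  then obtain x where x: "x \<in> carrier L" "g x \<noteq> \<one>\<^bsub>G\<^esub> x" by (rule gal_neq[OF g(1) _ g(2)])
  define N where "N = agree (conj_set x) \<one>\<^bsub>G\<^esub>"
  have cs: "finite (conj_set x)" "conj_set x \<subseteq> carrier L"
    using finite_conj_set[OF x(1)] by (auto simp: conj_set_def)
  have N: "h \<in> N \<longleftrightarrow> h \<in> carrier G \<and> (\<forall>y\<in>conj_set x. h y = y)" for h
    using cs(2) by (auto simp: N_def agree_def one_G_apply subset_iff)
  have "subgroup N G"
  proof (rule G.subgroupI)
    show "N \<subseteq> carrier G" using N by blast
    have "\<one>\<^bsub>G\<^esub> \<in> N" using cs(2) by (auto simp: N one_G_apply subset_iff)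
    then show "N \<noteq> {}" by blast
    show "inv\<^bsub>G\<^esub> h \<in> N" if "h \<in> N" for h
      using that inv_G_apply(2)[of h] cs(2) unfolding N by (metis G.inv_closed subsetD)
    show "h \<otimes>\<^bsub>G\<^esub> k \<in> N" if "h \<in> N" "k \<in> N" for h k
      using that cs(2) unfolding N by (auto simp: mult_G_apply subset_iff)
  qed
  moreover have "h \<otimes>\<^bsub>G\<^esub> k \<otimes>\<^bsub>G\<^esub> inv\<^bsub>G\<^esub> h \<in> N" if h: "h \<in> carrier G" and k: "k \<in> N" for h k
  proof -
    have kG: "k \<in> carrier G" using k N by blast
    have "(h \<otimes>\<^bsub>G\<^esub> k \<otimes>\<^bsub>G\<^esub> inv\<^bsub>G\<^esub> h) y = y" if y: "y \<in> conj_set x" for y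
    proof -
      have yL: "y \<in> carrier L" using y cs by auto
      have "(inv\<^bsub>G\<^esub> h) y \<in> conj_set x" using gal_conj_set[OF G.inv_closed[OF h] x(1) y] .
      then have "k ((inv\<^bsub>G\<^esub> h) y) = (inv\<^bsub>G\<^esub> h) y" using k N by blast
      then show ?thesis using h kG yL by (simp add: mult_G_apply inv_G_apply galD(6))
    qed
    then show ?thesis using h kG by (simp add: N)
  qed
  ultimately have "N \<lhd> G" by (simp add: G.normal_inv_iff)
  moreover have "openin (topo G) N" unfolding N_def using cs by (rule openin_agree)
  moreover have "g \<notin> N" using x conj_set_self[OF x(1)] N by (auto simp: one_G_apply)
  ultimately show thesis using that by (simp add: open_normal_def)
qed

lemma Inter_open_normal_pro_group:
  assumes "pro_group l G"
  shows "\<Inter>{N. open_normal G N \<and> (\<exists>n. card (rcosets\<^bsub>G\<^esub> N) = l ^ n)} = {\<one>\<^bsub>G\<^esub>}"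
proof -
  have eq: "{N. open_normal G N \<and> (\<exists>n. card (rcosets\<^bsub>G\<^esub> N) = l ^ n)} = {N. open_normal G N}"
    using assms by (auto simp: pro_group_def)
  have "open_normal G (carrier G)"
    using openin_topspace[of "topo G"] by (simp add: open_normal_def topspace_G G.normal_inv_iff G.subgroup_self)
  moreover have "\<one>\<^bsub>G\<^esub> \<in> N" if "open_normal G N" for N
    using that by (auto simp: open_normal_def normal_def intro: subgroup.one_closed)
  ultimately show ?thesis
    unfolding eq using ex_open_normal_not_mem by blast
qed

text \<open>In characteristic 0 the derivative \<open>q\<close> of the monic irreducible
  \<open>p\<close> is nonzero of smaller degree, so it lies outside the maximal ideal generated by
  \<open>p\<close>. The two polynomials then generate the unit ideal.\<close>

lemma separable_Irr:
  assumes char: "\<And>n :: nat. n > 0 \<Longrightarrow> add_pow L n \<one> \<noteq> \<zero>" and x: "x \<in> carrier L"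
  shows "separable_poly K (Irr K x)"
proof -
  note sr = subfieldE(1)[OF subfield_axioms]
  define p where "p = Irr K x"
  have p: "p \<in> carrier (K[X])" "pirreducible K p" "hd p = \<one>"
    using IrrE[OF subfield_axioms x algebraic[OF x]] by (auto simp: p_def)
  have pK: "set p \<subseteq> K" "p \<noteq> []" using Irr_K[OF x] by (auto simp: p_def)
  \<comment> \<open>The degree of \<open>p\<close> is \<open>d + 1\<close>. The leading coefficient
    of the derivative is \<open>d + 1\<close> times \<one>, nonzero by \<open>char\<close>, so
    normalisation leaves the derivative unchanged.\<close>
  obtain d where d: "length p = Suc (Suc d)"
    using pirreducible_degree[OF subfield_axioms p(1,2)] pK(2) by (cases p; cases "tl p") auto
  define q where "q = map2 (\<lambda>i a. add_pow L i a) (rev [1..<length p]) p"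
  obtain p' where p': "p = \<one> # p'" using p(3) pK(2) by (cases p) auto
  have "rev [1..<length p] = Suc d # rev [1..<Suc d]" by (simp add: d)
  then have q_Cons: "q = add_pow L (Suc d) \<one> # map2 (\<lambda>i a. add_pow L i a) (rev [1..<Suc d]) p'"
    unfolding q_def by (simp add: p')
  then have hdq: "q \<noteq> []" "hd q = add_pow L (Suc d) \<one>" by simp_all
  have mulK: "add_pow L n a \<in> K" if "a \<in> K" for n :: nat and a
    using that by (induction n) (auto intro: subringE(2,7)[OF sr])
  have qK: "set q \<subseteq> K"
    using pK(1) mulK by (auto simp: q_def dest!: set_zip_rightD)
  have "polynomial K q"
    using hdq qK char[of "Suc d"] by (simp add: polynomial_def)
  then have q: "q \<in> carrier (K[X])" by (simp add: univ_poly_carrier)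
  have "local.normalize q = q"
    using hdq char[of "Suc d"] by (cases q) auto
  then have dq: "poly_deriv p = q" by (simp add: poly_deriv_def q_def)
  have len: "length q = Suc d" by (simp add: q_def d)
  interpret UP: principal_domain "K[X]" using univ_poly_is_principal[OF subfield_axioms] .
  have max: "maximalideal (PIdl\<^bsub>K[X]\<^esub> p) (K[X])"
    using UP.irreducible_imp_maximalideal p(1,2) by blast
  define J where "J = PIdl\<^bsub>K[X]\<^esub> p <+>\<^bsub>K[X]\<^esub> PIdl\<^bsub>K[X]\<^esub> q"
  have J: "ideal J (K[X])"
    unfolding J_def by (intro UP.add_ideals UP.cgenideal_ideal p q)
  have z: "\<zero>\<^bsub>K[X]\<^esub> \<in> PIdl\<^bsub>K[X]\<^esub> p" "\<zero>\<^bsub>K[X]\<^esub> \<in> PIdl\<^bsub>K[X]\<^esub> q"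
    by (intro additive_subgroup.zero_closed ideal.axioms(1) UP.cgenideal_ideal p q)+
  have pJ: "PIdl\<^bsub>K[X]\<^esub> p \<subseteq> J"
  proof
    fix a assume a: "a \<in> PIdl\<^bsub>K[X]\<^esub> p"
    then have "a \<in> carrier (K[X])" using ideal.Icarr[OF UP.cgenideal_ideal[OF p(1)]] by blast
    then have "a \<oplus>\<^bsub>K[X]\<^esub> \<zero>\<^bsub>K[X]\<^esub> = a" by simp
    then show "a \<in> J" using a z unfolding J_def set_add_def' by force
  qed
  have qJ: "q \<in> J"
  proof -
    have "\<zero>\<^bsub>K[X]\<^esub> \<oplus>\<^bsub>K[X]\<^esub> q = q" using q by simp
    then show ?thesis using UP.cgenideal_self[OF q] z unfolding J_def set_add_def' by force
  qed
  have "q \<notin> PIdl\<^bsub>K[X]\<^esub> p"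
  proof
    assume "q \<in> PIdl\<^bsub>K[X]\<^esub> p"
    then have "p divides\<^bsub>K[X]\<^esub> q"
      using UP.to_contain_is_to_divide p(1) q by (meson UP.cgenideal_ideal UP.cgenideal_minimal)
    then have "p pdivides q" using pdivides_iff_shell[OF subfield_axioms p(1) q] by simp
    then have "Polynomials.degree p \<le> Polynomials.degree q"
      using pdivides_imp_degree_le[OF sr p(1) q] hdq(1) by simp
    then show False using d len by simp
  qed
  then have "J \<noteq> PIdl\<^bsub>K[X]\<^esub> p" using qJ by blast
  moreover have "J = PIdl\<^bsub>K[X]\<^esub> p \<or> J = carrier (K[X])"
    using maximalideal.I_maximal[OF max J pJ] ideal.Icarr[OF J] by blast
  ultimately have "\<one>\<^bsub>K[X]\<^esub> \<in> J" by simp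
  then obtain a b where "a \<in> PIdl\<^bsub>K[X]\<^esub> p" "b \<in> PIdl\<^bsub>K[X]\<^esub> q" "\<one>\<^bsub>K[X]\<^esub> = a \<oplus>\<^bsub>K[X]\<^esub> b"
    by (auto simp: J_def set_add_def')
  then obtain u v where "u \<in> carrier (K[X])" "v \<in> carrier (K[X])"
    "\<one>\<^bsub>K[X]\<^esub> = (u \<otimes>\<^bsub>K[X]\<^esub> p) \<oplus>\<^bsub>K[X]\<^esub> (v \<otimes>\<^bsub>K[X]\<^esub> q)"
    by (auto simp: cgenideal_def)
  then show ?thesis
    unfolding separable_poly_def using p(1) dq by (metis p_def)
qed

end

section \<open>A criterion for non-freeness\<close>

lemma finite_discrete_pro_group:
  fixes G :: "('a, 'b) topgroup_scheme" (structure)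
  assumes l: "Factorial_Ring.prime l" and G: "group G" "Coset.order G = l ^ k" and top: "topo G = discrete_topology (carrier G)"
  shows "pro_group l G"
proof -
  interpret group G by fact
  have "Coset.order G > 0" using G(2) prime_gt_0_nat[OF l] by simp
  then have fin: "finite (carrier G)" by (simp add: order_gt_0_iff_finite)
  have "connected_component_of_set (topo G) x = {x}" if x: "x \<in> carrier G" for x
  proof
    show "connected_component_of_set (topo G) x \<subseteq> {x}"
    proof
      fix y assume "y \<in> connected_component_of_set (topo G) x"
      then obtain C where C: "connectedin (topo G) C" "x \<in> C" "y \<in> C"
        by (auto simp: connected_component_of_def)
      have "C \<subseteq> {x} \<or> disjnt C {x}"
        by (rule connectedin_clopen_cases[OF C(1)]) (use x in \<open>auto simp: top\<close>)
      then show "y \<in> {x}" using C by (auto simp: disjnt_def)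
    qed
    show "{x} \<subseteq> connected_component_of_set (topo G) x"
      using x by (simp add: connected_component_of_refl top)
  qed
  then have "profinite_group G"
    using G(1) fin
    by (auto simp: profinite_group_def topological_group_def top compact_space_discrete_topology
        prod_topology_discrete_topology[symmetric])
  moreover have "\<exists>n. card (rcosets N) = l ^ n" if "open_normal G N" for N
  proof -
    have "subgroup N G" using that by (simp add: open_normal_def normal_def)
    then have "card (rcosets N) dvd l ^ k" using lagrange[of N] G(2) by (metis dvd_triv_left)
    then show ?thesis using l divides_primepow_nat by blast
  qed
  ultimately show ?thesis by (simp add: pro_group_def)
qed

text \<open>The group on triples modulo \<open>l\<close> with product
  \<open>(x, y, z) (x', y', z') = (x + x', y + y', z + z' + c x y')\<close>: for \<open>c = 1\<close> the Heisenberg group, for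
  \<open>c = 0\<close> an elementary abelian group. Its elements are encoded as singletons of type \<open>nat set\<close>,
  the carrier type of the test groups in the definition of freeness.\<close>

definition triple_code :: "nat \<times> nat \<times> nat \<Rightarrow> nat set" where
  "triple_code p = {to_nat p}"

definition triple_decode :: "nat set \<Rightarrow> nat \<times> nat \<times> nat" where
  "triple_decode A = from_nat (the_elem A)"

lemma triple_decode_code [simp]: "triple_decode (triple_code p) = p"
  by (simp add: triple_decode_def triple_code_def)

definition triple_mult :: "nat \<Rightarrow> nat \<Rightarrow> nat \<times> nat \<times> nat \<Rightarrow> nat \<times> nat \<times> nat \<Rightarrow> nat \<times> nat \<times> nat" where
  "triple_mult c l = (\<lambda>(x, y, z) (x', y', z').
     ((x + x') mod l, (y + y') mod l, (z + z' + c * x * y') mod l))"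

definition heisenberg :: "nat \<Rightarrow> nat \<Rightarrow> nat set topgroup" where
  "heisenberg c l = \<lparr>carrier = triple_code ` ({..<l} \<times> {..<l} \<times> {..<l}),
     monoid.mult = (\<lambda>A B. triple_code (triple_mult c l (triple_decode A) (triple_decode B))),
     one = triple_code (0, 0, 0),
     topo = discrete_topology (triple_code ` ({..<l} \<times> {..<l} \<times> {..<l}))\<rparr>"

lemma triple_mult_assoc:
  "triple_mult c l (triple_mult c l p q) r = triple_mult c l p (triple_mult c l q r)"
proof -
  obtain x y z x' y' z' x'' y'' z'' where "p = (x, y, z)" "q = (x', y', z')" "r = (x'', y'', z'')"
    by (metis prod.exhaust)
  moreover have "((z + z' + c * x * y') mod l + z'' + c * ((x + x') mod l) * y'') mod l =
      (z + (z' + z'' + c * x' * y'') mod l + c * x * ((y' + y'') mod l)) mod l"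
  proof -
    have "((z + z' + c * x * y') mod l + z'' + c * ((x + x') mod l) * y'') mod l =
        (z + z' + c * x * y' + z'' + c * (x + x') * y'') mod l"
      by (metis (no_types, opaque_lifting) mod_add_left_eq mod_add_right_eq mod_mult_left_eq mod_mult_right_eq)
    moreover have "(z + (z' + z'' + c * x' * y'') mod l + c * x * ((y' + y'') mod l)) mod l =
        (z + (z' + z'' + c * x' * y'') + c * x * (y' + y'')) mod l"
      by (metis (no_types, opaque_lifting) mod_add_left_eq mod_add_right_eq mod_mult_right_eq)
    ultimately show ?thesis by (simp add: algebra_simps)
  qed
  ultimately show ?thesis
    by (simp add: triple_mult_def mod_add_left_eq mod_add_right_eq add.assoc)
qed

lemma heisenberg_carrier:
  "carrier (heisenberg c l) = triple_code ` ({..<l} \<times> {..<l} \<times> {..<l})"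
  by (simp add: heisenberg_def)

lemma heisenberg_mult:
  "triple_code p \<otimes>\<^bsub>heisenberg c l\<^esub> triple_code q = triple_code (triple_mult c l p q)"
  by (simp add: heisenberg_def)

lemma heisenberg_one: "\<one>\<^bsub>heisenberg c l\<^esub> = triple_code (0, 0, 0)"
  by (simp add: heisenberg_def)

lemma triple_code_mem: "triple_code (x, y, z) \<in> carrier (heisenberg c l) \<longleftrightarrow> x < l \<and> y < l \<and> z < l"
  unfolding heisenberg_carrier
  by (auto simp: image_iff) (metis prod.inject triple_decode_code)+

lemma heisenberg_cases:
  assumes "A \<in> carrier (heisenberg c l)"
  obtains x y z where "A = triple_code (x, y, z)" "x < l" "y < l" "z < l"
  using assms by (auto simp: heisenberg_carrier)

lemma group_heisenberg:
  assumes "l > 0"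
  shows "group (heisenberg c l)"
proof (rule groupI)
  show "A \<otimes>\<^bsub>heisenberg c l\<^esub> B \<in> carrier (heisenberg c l)"
    if "A \<in> carrier (heisenberg c l)" "B \<in> carrier (heisenberg c l)" for A B
    using that assms by (elim heisenberg_cases) (simp add: heisenberg_mult triple_mult_def triple_code_mem)
  show "\<one>\<^bsub>heisenberg c l\<^esub> \<in> carrier (heisenberg c l)"
    using assms by (simp add: heisenberg_one triple_code_mem)
  show "A \<otimes>\<^bsub>heisenberg c l\<^esub> B \<otimes>\<^bsub>heisenberg c l\<^esub> C = A \<otimes>\<^bsub>heisenberg c l\<^esub> (B \<otimes>\<^bsub>heisenberg c l\<^esub> C)"
    if "A \<in> carrier (heisenberg c l)" "B \<in> carrier (heisenberg c l)" "C \<in> carrier (heisenberg c l)" for A B C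
    using that by (elim heisenberg_cases) (simp add: heisenberg_mult triple_mult_assoc)
  show "\<one>\<^bsub>heisenberg c l\<^esub> \<otimes>\<^bsub>heisenberg c l\<^esub> A = A" if "A \<in> carrier (heisenberg c l)" for A
    using that by (elim heisenberg_cases) (simp add: heisenberg_one heisenberg_mult triple_mult_def)
  show "\<exists>B\<in>carrier (heisenberg c l). B \<otimes>\<^bsub>heisenberg c l\<^esub> A = \<one>\<^bsub>heisenberg c l\<^esub>"
    if A: "A \<in> carrier (heisenberg c l)" for A
  proof -
    obtain x y z where xyz: "A = triple_code (x, y, z)" "x < l" "y < l" "z < l"
      using A by (rule heisenberg_cases)
    \<comment> \<open>The inverse has first coordinates \<open>- x\<close> and \<open>- y\<close>
      modulo \<open>l\<close>; its third coordinate must also cancel the cross term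
      \<open>c x' y\<close>.\<close>
    define x' where "x' = (l - x) mod l"
    define y' where "y' = (l - y) mod l"
    define z' where "z' = (l - (z + c * x' * y) mod l) mod l"
    have neg: "((l - a mod l) mod l + a) mod l = 0" for a
    proof -
      have "((l - a mod l) mod l + a) mod l = (l - a mod l + a mod l) mod l"
        by (simp add: mod_add_left_eq mod_add_right_eq)
      then show ?thesis using assms by (simp add: less_imp_le)
    qed
    have "(x' + x) mod l = 0" "(y' + y) mod l = 0" "(z' + (z + c * x' * y)) mod l = 0"
      using neg[of x] neg[of y] neg[of "z + c * x' * y"] xyz by (simp_all add: x'_def y'_def z'_def)
    then have "triple_code (x', y', z') \<otimes>\<^bsub>heisenberg c l\<^esub> A = \<one>\<^bsub>heisenberg c l\<^esub>"
      by (simp add: xyz heisenberg_mult triple_mult_def heisenberg_one add.assoc)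
    moreover have "triple_code (x', y', z') \<in> carrier (heisenberg c l)"
      using assms by (simp add: triple_code_mem x'_def y'_def z'_def)
    ultimately show ?thesis by blast
  qed
qed

lemma inj_triple_code: "inj triple_code"
  by (metis injI triple_decode_code)

lemma pro_group_heisenberg:
  assumes l: "Factorial_Ring.prime l"
  shows "pro_group l (heisenberg c l)"
proof (rule finite_discrete_pro_group[OF l])
  show "group (heisenberg c l)" using group_heisenberg prime_gt_0_nat[OF l] by blast
  have "card (carrier (heisenberg c l)) = l * (l * l)"
    unfolding heisenberg_carrier using inj_triple_code
    by (subst card_image) (auto intro: inj_on_subset)
  then show "Coset.order (heisenberg c l) = l ^ 3"
    by (simp add: Coset.order_def power3_eq_cube)
  show "topo (heisenberg c l) = discrete_topology (carrier (heisenberg c l))"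
    by (simp add: heisenberg_def)
qed

text \<open>Freeness would lift the homomorphism \<open>(a, b)\<close> onto \<open>(\<int>/l)\<^sup>2\<close> to the Heisenberg group, where the
  images of the commuting elements \<open>s\<close> and \<open>t\<close> do not commute.\<close>

lemma not_free_if_commuting:
  fixes A :: "'a topgroup"
  assumes l: "Factorial_Ring.prime l"
    and st: "s \<in> carrier A" "t \<in> carrier A" "s \<otimes>\<^bsub>A\<^esub> t = t \<otimes>\<^bsub>A\<^esub> s"
    and a: "\<And>x y. x \<in> carrier A \<Longrightarrow> y \<in> carrier A \<Longrightarrow> a (x \<otimes>\<^bsub>A\<^esub> y) = (a x + a y) mod l"
      "\<And>x. x \<in> carrier A \<Longrightarrow> a x < l" "\<And>n. openin (topo A) {x \<in> carrier A. a x = n}"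
    and b: "\<And>x y. x \<in> carrier A \<Longrightarrow> y \<in> carrier A \<Longrightarrow> b (x \<otimes>\<^bsub>A\<^esub> y) = (b x + b y) mod l"
      "\<And>x. x \<in> carrier A \<Longrightarrow> b x < l" "\<And>n. openin (topo A) {x \<in> carrier A. b x = n}"
    and val: "a s = 1" "b s = 0" "a t = 0" "b t = 1"
  shows "\<not> free_pro_group l A"
proof
  note One_nat_def [simp del]
  assume "free_pro_group l A"
  then obtain B where "free_pro_group_on l A B" by (auto simp: free_pro_group_def)
  then have proA: "pro_group l A" and B: "converges_to_one B (\<lambda>x. x) A"
    and univ: "\<And>(H :: nat set topgroup) f. pro_group l H \<Longrightarrow> converges_to_one B f H \<Longrightarrow>
        \<exists>!h. h \<in> hom A H \<and> h \<in> extensional (carrier A) \<and> continuous_map (topo A) (topo H) h \<and> (\<forall>x\<in>B. h x = f x)"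
    by (auto simp: free_pro_group_on_def)
  have top: "topspace (topo A) = carrier A" and "group A"
    using proA by (auto simp: pro_group_def profinite_group_def topological_group_def)
  interpret A: group A by fact
  have l0: "l > 0" using prime_gt_0_nat[OF l] .
  let ?H0 = "heisenberg 0 l" and ?H1 = "heisenberg 1 l"
  interpret H1: group ?H1 by (rule group_heisenberg[OF l0])
  define f where "f x = triple_code (a x, b x, 0)" for x
  have f_mem: "f x \<in> carrier (heisenberg c l)" if "x \<in> carrier A" for x c
    using a(2) b(2) l0 that by (simp add: f_def triple_code_mem)
  have f_mult: "f (x \<otimes>\<^bsub>A\<^esub> y) = f x \<otimes>\<^bsub>?H0\<^esub> f y" if "x \<in> carrier A" "y \<in> carrier A" for x y
    using a(1)[OF that] b(1)[OF that] by (simp add: f_def heisenberg_mult triple_mult_def)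
  have open_f: "openin (topo A) {x \<in> carrier A. f x \<in> U}" for U
  proof -
    have "{x \<in> carrier A. f x \<in> U} =
        (\<Union>(m, n)\<in>{(m, n). triple_code (m, n, 0) \<in> U}. {x \<in> carrier A. a x = m} \<inter> {x \<in> carrier A. b x = n})"
      by (auto simp: f_def)
    then show ?thesis using a(3) b(3) by (auto intro!: openin_Union openin_Int)
  qed
  define Ker where "Ker = {x \<in> carrier A. f x \<in> {triple_code (0, 0, 0)}}"
  interpret fh: group_hom A ?H0 f
    by (intro group_hom.intro A.group_axioms group_heisenberg[OF l0])
       (simp add: group_hom_axioms_def hom_def f_mem f_mult)
  have "open_normal A Ker"
  proof -
    have "Ker = kernel A ?H0 f" by (auto simp: Ker_def kernel_def heisenberg_one)
    then have "Ker \<lhd> A" using fh.normal_kernel by simp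
    then show ?thesis unfolding open_normal_def using open_f[of "{triple_code (0, 0, 0)}"]
      by (simp only: Ker_def simp_thms)
  qed
  then have fin: "finite {x \<in> B. x \<notin> Ker}" using B by (simp add: converges_to_one_def)
  have BA: "B \<subseteq> carrier A" using B by (auto simp: converges_to_one_def)
  \<comment> \<open>For \<open>c = 1\<close> the map \<open>f\<close> need not be a homomorphism.
    But it sends \<open>Ker\<close> to the identity in either group, so convergence concerns just
    the finitely many basis elements outside \<open>Ker\<close>.\<close>
  have conv: "converges_to_one B f (heisenberg c l)" for c
    unfolding converges_to_one_def
  proof (intro conjI allI impI)
    show "f \<in> B \<rightarrow> carrier (heisenberg c l)" using BA f_mem by auto
    fix N assume N: "open_normal (heisenberg c l) N"
    have "triple_code (0, 0, 0) \<in> N"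
      using N subgroup.one_closed[of N "heisenberg c l"] by (simp add: open_normal_def normal_def heisenberg_one)
    then have "{x \<in> B. f x \<notin> N} \<subseteq> {x \<in> B. x \<notin> Ker}"
      by (auto simp: Ker_def)
    then show "finite {x \<in> B. f x \<notin> N}" using fin by (rule finite_subset)
  qed
  obtain h where h: "h \<in> hom A ?H1" "h \<in> extensional (carrier A)"
    "continuous_map (topo A) (topo ?H1) h" "\<And>x. x \<in> B \<Longrightarrow> h x = f x"
    using univ[OF pro_group_heisenberg[OF l] conv] by blast
  \<comment> \<open>The projection of the Heisenberg group modulo its centre, viewed inside the
    elementary abelian group of triples. It makes \<open>h\<close> and \<open>f\<close>
    comparable.\<close>
  define \<pi> where "\<pi> P = (case triple_decode P of (x, y, z) \<Rightarrow> triple_code (x, y, 0))" for P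
  define h' where "h' = restrict (\<lambda>x. \<pi> (h x)) (carrier A)"
  define f' where "f' = restrict f (carrier A)"
  have \<pi>_mem: "\<pi> P \<in> carrier ?H0" if "P \<in> carrier ?H1" for P
    using that l0 by (elim heisenberg_cases) (simp add: \<pi>_def triple_code_mem)
  have \<pi>_mult: "\<pi> (P \<otimes>\<^bsub>?H1\<^esub> Q) = \<pi> P \<otimes>\<^bsub>?H0\<^esub> \<pi> Q" if "P \<in> carrier ?H1" "Q \<in> carrier ?H1" for P Q
    using that by (elim heisenberg_cases) (simp add: \<pi>_def heisenberg_mult triple_mult_def)
  have h_mem: "h x \<in> carrier ?H1" if "x \<in> carrier A" for x using h(1) that by (auto simp: hom_def)
  have h_mult: "h (x \<otimes>\<^bsub>A\<^esub> y) = h x \<otimes>\<^bsub>?H1\<^esub> h y" if "x \<in> carrier A" "y \<in> carrier A" for x y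
    using h(1) that by (simp add: hom_mult)
  have P1: "h' \<in> hom A ?H0 \<and> h' \<in> extensional (carrier A) \<and> continuous_map (topo A) (topo ?H0) h' \<and> (\<forall>x\<in>B. h' x = f x)"
  proof (intro conjI ballI)
    show "h' \<in> hom A ?H0"
      unfolding h'_def by (rule homI) (simp_all add: h_mem h_mult \<pi>_mem \<pi>_mult)
    show "h' \<in> extensional (carrier A)" by (simp add: h'_def)
    show "continuous_map (topo A) (topo ?H0) h'"
      unfolding continuous_map_def
    proof (intro conjI allI impI)
      show "h' \<in> topspace (topo A) \<rightarrow> topspace (topo ?H0)"
        using \<pi>_mem h_mem by (auto simp: top h'_def heisenberg_def)
      fix U
      have "{x \<in> topspace (topo A). h' x \<in> U} = {x \<in> topspace (topo A). h x \<in> {P \<in> carrier ?H1. \<pi> P \<in> U}}"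
        using h_mem by (auto simp: top h'_def)
      moreover have "openin (topo ?H1) {P \<in> carrier ?H1. \<pi> P \<in> U}"
        by (auto simp: heisenberg_def)
      ultimately show "openin (topo A) {x \<in> topspace (topo A). h' x \<in> U}"
        using openin_continuous_map_preimage[OF h(3)] by (simp only:)
    qed
    fix x assume "x \<in> B"
    then show "h' x = f x" using BA h(4) by (auto simp: h'_def \<pi>_def f_def)
  qed
  have P2: "f' \<in> hom A ?H0 \<and> f' \<in> extensional (carrier A) \<and> continuous_map (topo A) (topo ?H0) f' \<and> (\<forall>x\<in>B. f' x = f x)"
  proof (intro conjI ballI)
    show "f' \<in> hom A ?H0" unfolding f'_def by (rule homI) (simp_all add: f_mem f_mult)
    show "f' \<in> extensional (carrier A)" by (simp add: f'_def)
    show "continuous_map (topo A) (topo ?H0) f'"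
      unfolding continuous_map_def
    proof (intro conjI allI impI)
      show "f' \<in> topspace (topo A) \<rightarrow> topspace (topo ?H0)"
        using f_mem by (auto simp: top f'_def heisenberg_def)
      fix U
      have "{x \<in> topspace (topo A). f' x \<in> U} = {x \<in> carrier A. f x \<in> U}" by (auto simp: top f'_def)
      then show "openin (topo A) {x \<in> topspace (topo A). f' x \<in> U}" using open_f by simp
    qed
    fix x assume "x \<in> B"
    then show "f' x = f x" using BA by (auto simp: f'_def)
  qed
  \<comment> \<open>Both are continuous homomorphisms into the abelian group with the same values on
    \<open>B\<close>. Uniqueness in the universal property shows that \<open>h\<close> lifts
    \<open>f\<close> on all of \<open>A\<close>.\<close>
  have "h' = f'"
    using univ[OF pro_group_heisenberg[OF l] conv] P1 P2 by blast
  then have \<pi>h: "\<pi> (h x) = f x" if "x \<in> carrier A" for x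
    using that unfolding h'_def f'_def by (metis restrict_apply')
  have l1: "l > 1" using prime_gt_1_nat[OF l] .
  obtain x y z where hs: "h s = triple_code (x, y, z)" "z < l" by (rule heisenberg_cases[OF h_mem[OF st(1)]])
  obtain x' y' z' where ht: "h t = triple_code (x', y', z')" "z' < l" by (rule heisenberg_cases[OF h_mem[OF st(2)]])
  have "(x, y) = (1, 0)" "(x', y') = (0, 1)"
    using \<pi>h[OF st(1)] \<pi>h[OF st(2)] val by (auto simp: \<pi>_def hs ht f_def dest!: injD[OF inj_triple_code])
  moreover have "h s \<otimes>\<^bsub>?H1\<^esub> h t = h t \<otimes>\<^bsub>?H1\<^esub> h s"
    using st h_mult by metis
  \<comment> \<open>With leading coordinates \<open>(1, 0)\<close> and \<open>(0, 1)\<close> the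
    cross term contributes 1 to one of the two products and 0 to the other.\<close>
  ultimately have "(z + z' + 1) mod l = (z' + z) mod l"
    by (auto simp: hs ht heisenberg_mult triple_mult_def dest!: injD[OF inj_triple_code])
  then have "(z + z' + 1) mod l = (z + z') mod l" by (simp add: add.commute)
  then have "l dvd (z + z' + 1) - (z + z')" by (metis mod_eq_dvd_iff_nat le_add1)
  then show False using l1 by simp
qed

text \<open>The characters are only asked for on a closed set \<open>S\<close> containing the
  derived group, and hence its closure. Kummer characters are not homomorphisms on the whole Galois
  group.\<close>

lemma not_free_closed_commutator:
  fixes G :: "'a topgroup" (structure)
  assumes l: "Factorial_Ring.prime l" and G: "group G" "topspace (topo G) = carrier G"
    and S: "closedin (topo G) S" "derived G (carrier G) \<subseteq> S"
    and st: "s \<in> derived G (carrier G)" "t \<in> derived G (carrier G)" "s \<otimes> t = t \<otimes> s"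
    and a: "\<And>x y. x \<in> S \<Longrightarrow> y \<in> S \<Longrightarrow> a (x \<otimes> y) = (a x + a y) mod l"
      "\<And>x. x \<in> S \<Longrightarrow> a x < l" "\<And>n. openin (topo G) {x \<in> S. a x = n}"
    and b: "\<And>x y. x \<in> S \<Longrightarrow> y \<in> S \<Longrightarrow> b (x \<otimes> y) = (b x + b y) mod l"
      "\<And>x. x \<in> S \<Longrightarrow> b x < l" "\<And>n. openin (topo G) {x \<in> S. b x = n}"
    and val: "a s = 1" "b s = 0" "a t = 0" "b t = 1"
  shows "\<not> free_pro_group l (closed_commutator_subgroup G)"
proof -
  define C where "C = Abstract_Topology.closure_of (topo G) (derived G (carrier G))"
  have CS: "C \<subseteq> S" unfolding C_def by (rule closure_of_minimal[OF S(2,1)])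
  have "derived G (carrier G) \<subseteq> carrier G"
    using group.derived_in_carrier[OF G(1)] by blast
  then have DC: "derived G (carrier G) \<subseteq> C"
    unfolding C_def by (intro closure_of_subset) (simp add: G(2))
  have A: "carrier (closed_commutator_subgroup G) = C"
    "monoid.mult (closed_commutator_subgroup G) = monoid.mult G"
    "topo (closed_commutator_subgroup G) = subtopology (topo G) C"
    by (simp_all add: closed_commutator_subgroup_def restrict_topgroup_def C_def)
  have "{x \<in> C. f x = n} = {x \<in> S. f x = n} \<inter> C" for f :: "'a \<Rightarrow> nat" and n
    using CS by auto
  then have op: "openin (subtopology (topo G) C) {x \<in> C. f x = n}"
    if "openin (topo G) {x \<in> S. f x = n}" for f :: "'a \<Rightarrow> nat" and n
    using that by (auto simp: openin_subtopology)
  show ?thesis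
    by (rule not_free_if_commuting[OF l, of s _ t a b])
       (use st DC CS a b val op in \<open>auto simp: A subset_iff\<close>)
qed

section \<open>The quotient by the trivial subgroup\<close>

context
  fixes G :: "'a topgroup" (structure)
  assumes G: "group G" "topspace (topo G) = carrier G"
begin

interpretation group G by (rule G(1))

lemma r_coset_one: "x \<in> carrier G \<Longrightarrow> {\<one>} #> x = {x}"
  by (auto simp: r_coset_def)

lemma quotient_one_simps:
  "carrier (quotient_topgroup G {\<one>}) = (\<lambda>x. {x}) ` carrier G"
  "x \<in> carrier G \<Longrightarrow> y \<in> carrier G \<Longrightarrow> {x} \<otimes>\<^bsub>quotient_topgroup G {\<one>}\<^esub> {y} = {x \<otimes> y}"
  "\<one>\<^bsub>quotient_topgroup G {\<one>}\<^esub> = {\<one>}"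
  by (auto simp: quotient_topgroup_def FactGroup_def RCOSETS_def r_coset_one set_mult_def)

lemma group_quotient_one: "group (quotient_topgroup G {\<one>})"
proof (rule groupI)
  fix A B C
  assume "A \<in> carrier (quotient_topgroup G {\<one>})" "B \<in> carrier (quotient_topgroup G {\<one>})"
    "C \<in> carrier (quotient_topgroup G {\<one>})"
  then show "A \<otimes>\<^bsub>quotient_topgroup G {\<one>}\<^esub> B \<otimes>\<^bsub>quotient_topgroup G {\<one>}\<^esub> C =
      A \<otimes>\<^bsub>quotient_topgroup G {\<one>}\<^esub> (B \<otimes>\<^bsub>quotient_topgroup G {\<one>}\<^esub> C)"
    by (auto simp: quotient_one_simps m_assoc)
next
  fix A assume "A \<in> carrier (quotient_topgroup G {\<one>})"
  then obtain x where x: "x \<in> carrier G" "A = {x}" by (auto simp: quotient_one_simps)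
  then have "{inv x} \<otimes>\<^bsub>quotient_topgroup G {\<one>}\<^esub> A = \<one>\<^bsub>quotient_topgroup G {\<one>}\<^esub>"
    by (simp add: quotient_one_simps)
  then show "\<exists>B\<in>carrier (quotient_topgroup G {\<one>}). B \<otimes>\<^bsub>quotient_topgroup G {\<one>}\<^esub> A = \<one>\<^bsub>quotient_topgroup G {\<one>}\<^esub>"
    using x by (auto simp: quotient_one_simps)
qed (auto simp: quotient_one_simps)

lemma openin_quotient_one:
  assumes "openin (topo G) V"
  shows "openin (topo (quotient_topgroup G {\<one>})) ((\<lambda>x. {x}) ` V)"
proof -
  have V: "V \<subseteq> carrier G" using openin_subset[OF assms] G(2) by simp
  then have "{x \<in> carrier G. {\<one>} #> x \<in> (\<lambda>x. {x}) ` V} = V"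
    by (auto simp: r_coset_one)
  moreover have "(\<lambda>x. {x}) ` V \<subseteq> carrier (G Mod {\<one>})"
    using V by (auto simp: FactGroup_def RCOSETS_def r_coset_one)
  ultimately show ?thesis using assms by (simp add: openin_quotient_topgroup[OF G(2)])
qed

lemma topspace_quotient_one: "topspace (topo (quotient_topgroup G {\<one>})) = (\<lambda>x. {x}) ` carrier G"
proof
  have "openin (topo (quotient_topgroup G {\<one>})) (topspace (topo (quotient_topgroup G {\<one>})))" by simp
  then show "topspace (topo (quotient_topgroup G {\<one>})) \<subseteq> (\<lambda>x. {x}) ` carrier G"
    by (subst (asm) openin_quotient_topgroup[OF G(2)])
       (auto simp: FactGroup_def RCOSETS_def r_coset_one)
  have "openin (topo G) (carrier G)" using openin_topspace[of "topo G"] G(2) by simp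
  then show "(\<lambda>x. {x}) ` carrier G \<subseteq> topspace (topo (quotient_topgroup G {\<one>}))"
    by (intro openin_subset openin_quotient_one)
qed

lemma derived_quotient_one:
  "derived (quotient_topgroup G {\<one>}) (carrier (quotient_topgroup G {\<one>})) = (\<lambda>x. {x}) ` derived G (carrier G)"
proof -
  interpret h: group_hom G "quotient_topgroup G {\<one>}" "\<lambda>x. {x}"
    by (intro group_hom.intro G(1) group_quotient_one)
       (auto simp: group_hom_axioms_def hom_def quotient_one_simps)
  show ?thesis unfolding quotient_one_simps(1) by (rule h.derived_img) simp
qed

end

text \<open>The maximal pro-\<open>l\<close> quotient of a pro-\<open>l\<close> group consists of
  singletons. The data \<open>S\<close>, \<open>s\<close>, \<open>t\<close>, \<open>a\<close>,
  \<open>b\<close> are carried over along \<open>x \<mapsto> {x}\<close> and the criterion is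
  applied again, instead of transferring freeness along an isomorphism.\<close>

lemma not_free_closed_commutator_quotient_one:
  fixes G :: "'a topgroup" (structure)
  assumes l: "Factorial_Ring.prime l" and G: "group G" "topspace (topo G) = carrier G"
    and S: "closedin (topo G) S" "derived G (carrier G) \<subseteq> S"
    and st: "s \<in> derived G (carrier G)" "t \<in> derived G (carrier G)" "s \<otimes> t = t \<otimes> s"
    and a: "\<And>x y. x \<in> S \<Longrightarrow> y \<in> S \<Longrightarrow> a (x \<otimes> y) = (a x + a y) mod l"
      "\<And>x. x \<in> S \<Longrightarrow> a x < l" "\<And>n. openin (topo G) {x \<in> S. a x = n}"
    and b: "\<And>x y. x \<in> S \<Longrightarrow> y \<in> S \<Longrightarrow> b (x \<otimes> y) = (b x + b y) mod l"
      "\<And>x. x \<in> S \<Longrightarrow> b x < l" "\<And>n. openin (topo G) {x \<in> S. b x = n}"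
    and val: "a s = 1" "b s = 0" "a t = 0" "b t = 1"
  shows "\<not> free_pro_group l (closed_commutator_subgroup (quotient_topgroup G {\<one>}))"
proof -
  let ?Q = "quotient_topgroup G {\<one>}"
  note simps = quotient_one_simps[OF G]
  have SG: "S \<subseteq> carrier G" using closedin_subset[OF S(1)] G(2) by simp
  have "derived G (carrier G) \<subseteq> carrier G" using group.derived_in_carrier[OF G(1)] by blast
  then have stG: "s \<in> carrier G" "t \<in> carrier G" using st by auto
  have "openin (topo ?Q) ((\<lambda>x. {x}) ` (carrier G - S))"
    using S(1) G(2) by (intro openin_quotient_one[OF G]) (simp add: closedin_def)
  moreover have "topspace (topo ?Q) - (\<lambda>x. {x}) ` S = (\<lambda>x. {x}) ` (carrier G - S)"
    unfolding topspace_quotient_one[OF G] by auto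
  ultimately have cl: "closedin (topo ?Q) ((\<lambda>x. {x}) ` S)"
    using SG by (auto simp: closedin_def topspace_quotient_one[OF G])
  have "{V \<in> (\<lambda>x. {x}) ` S. f (the_elem V) = n} = (\<lambda>x. {x}) ` {x \<in> S. f x = n}" for f :: "'a \<Rightarrow> nat" and n
    by auto
  then have op: "openin (topo ?Q) {V \<in> (\<lambda>x. {x}) ` S. f (the_elem V) = n}"
    if "openin (topo G) {x \<in> S. f x = n}" for f :: "'a \<Rightarrow> nat" and n
    using openin_quotient_one[OF G that] by simp
  show ?thesis
  proof (rule not_free_closed_commutator[OF l group_quotient_one[OF G] _ cl,
        of "{s}" "{t}" "\<lambda>V. a (the_elem V)" "\<lambda>V. b (the_elem V)"])
    show "topspace (topo ?Q) = carrier ?Q" by (simp add: topspace_quotient_one[OF G] simps)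
    show "derived ?Q (carrier ?Q) \<subseteq> (\<lambda>x. {x}) ` S"
      unfolding derived_quotient_one[OF G] using S(2) by blast
    show "{s} \<in> derived ?Q (carrier ?Q)" "{t} \<in> derived ?Q (carrier ?Q)"
      unfolding derived_quotient_one[OF G] using st by blast+
    show "{s} \<otimes>\<^bsub>?Q\<^esub> {t} = {t} \<otimes>\<^bsub>?Q\<^esub> {s}" using st(3) stG by (simp add: simps)
    show "openin (topo ?Q) {V \<in> (\<lambda>x. {x}) ` S. a (the_elem V) = n}"
      "openin (topo ?Q) {V \<in> (\<lambda>x. {x}) ` S. b (the_elem V) = n}" for n
      using a(3) b(3) by (intro op; simp)+
  qed (use a b val SG in \<open>auto simp: simps subset_iff\<close>)
qed

section \<open>Transport along an injection\<close>

text \<open>A type-class field becomes a ring record over the target type, so that it can live in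
  \<open>universe\<close>. The decoding \<open>inv_into UNIV h\<close> does not depend on
  \<open>S\<close>; two transported subfields therefore share their operations and differ only in
  the carrier.\<close>

definition transport_ring :: "('a :: Fields.field \<Rightarrow> 'b) \<Rightarrow> 'a set \<Rightarrow> 'b ring" where
  "transport_ring h S = \<lparr>carrier = h ` S, monoid.mult = (\<lambda>x y. h (inv_into UNIV h x * inv_into UNIV h y)), one = h 1,
     ring.zero = h 0, add = (\<lambda>x y. h (inv_into UNIV h x + inv_into UNIV h y))\<rparr>"

locale closed_subfield =
  fixes S :: "'a :: Fields.field set"
  assumes closed: "0 \<in> S" "1 \<in> S" "x \<in> S \<Longrightarrow> y \<in> S \<Longrightarrow> x + y \<in> S" "x \<in> S \<Longrightarrow> y \<in> S \<Longrightarrow> x * y \<in> S"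
    "x \<in> S \<Longrightarrow> - x \<in> S" "x \<in> S \<Longrightarrow> inverse x \<in> S"

locale subfield_transport = closed_subfield S for S :: "'a :: Fields.field set" +
  fixes h :: "'a \<Rightarrow> 'b"
  assumes inj_h: "inj h"
begin

abbreviation "R \<equiv> transport_ring h S"

lemma transport_simps:
  "carrier R = h ` S" "h x \<otimes>\<^bsub>R\<^esub> h y = h (x * y)" "\<one>\<^bsub>R\<^esub> = h 1" "\<zero>\<^bsub>R\<^esub> = h 0" "h x \<oplus>\<^bsub>R\<^esub> h y = h (x + y)"
  "h x = h y \<longleftrightarrow> x = y"
  using inj_h by (auto simp: transport_ring_def inj_eq)

lemma field_transport: "field R"
proof -
  have "cring R"
  proof (rule cringI)
    show "abelian_group R"
    proof (rule abelian_groupI)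
      show "\<exists>y\<in>carrier R. y \<oplus>\<^bsub>R\<^esub> x = \<zero>\<^bsub>R\<^esub>" if x: "x \<in> carrier R" for x
      proof -
        obtain u where u: "u \<in> S" "x = h u" using x by (auto simp: transport_simps)
        then show ?thesis using closed by (intro bexI[of _ "h (- u)"]) (auto simp: transport_simps)
      qed
    qed (auto simp: transport_simps closed algebra_simps)
    show "Group.comm_monoid R"
      by (rule comm_monoidI) (auto simp: transport_simps closed algebra_simps)
  qed (auto simp: transport_simps closed algebra_simps)
  then interpret cring R .
  have "Units R = carrier R - {\<zero>\<^bsub>R\<^esub>}"
  proof
    show "Units R \<subseteq> carrier R - {\<zero>\<^bsub>R\<^esub>}"
      unfolding Units_def by (auto simp: transport_simps)
    show "carrier R - {\<zero>\<^bsub>R\<^esub>} \<subseteq> Units R"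
    proof
      fix x assume "x \<in> carrier R - {\<zero>\<^bsub>R\<^esub>}"
      then obtain u where u: "u \<in> S" "x = h u" "u \<noteq> 0" by (auto simp: transport_simps)
      then have "h (inverse u) \<in> carrier R" "h (inverse u) \<otimes>\<^bsub>R\<^esub> x = \<one>\<^bsub>R\<^esub>" "x \<otimes>\<^bsub>R\<^esub> h (inverse u) = \<one>\<^bsub>R\<^esub>"
        using closed by (auto simp: transport_simps)
      moreover have "x \<in> carrier R" using u by (simp add: transport_simps)
      ultimately show "x \<in> Units R" unfolding Units_def by blast
    qed
  qed
  then show ?thesis by (rule cring_fieldI)
qed

sublocale R: field R by (rule field_transport)

lemma transport_pow: "x \<in> S \<Longrightarrow> h x [^]\<^bsub>R\<^esub> (n :: nat) = h (x ^ n)"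
  by (induction n) (auto simp: transport_simps mult.commute)

lemma transport_add_pow: "add_pow R (n :: nat) \<one>\<^bsub>R\<^esub> = h (of_nat n)"
proof (induction n)
  case 0
  then show ?case by (simp add: transport_simps(4))
next
  case (Suc n)
  then show ?case by (simp add: transport_simps(3,5) add.commute)
qed

text \<open>The list reversal reconciles two conventions: coefficient lists of \<open>eval\<close>
  start with the leading coefficient, those of \<open>Poly\<close> with the constant one.\<close>

lemma transport_eval:
  assumes "set cs \<subseteq> S" "x \<in> S"
  shows "R.eval (map h cs) (h x) = h (poly (Poly (rev cs)) x)"
  using assms(1)
proof (induction cs)
  case Nil
  then show ?case by (simp add: transport_simps(4))
next
  case (Cons c cs)
  then have "R.eval (map h (c # cs)) (h x) = h (c * x ^ length cs + poly (Poly (rev cs)) x)"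
    by (simp add: transport_pow[OF assms(2)] transport_simps(2,5))
  also have "c * x ^ length cs + poly (Poly (rev cs)) x = poly (Poly (rev (c # cs))) x"
    by (simp add: Poly_append poly_monom)
  finally show ?case .
qed

end

locale galois_model = embedding_monoid \<Gamma> for \<Gamma> :: "('a :: {field_char_0, alg_closed_field} \<Rightarrow> 'a) set" +
  fixes h :: "'a \<Rightarrow> 'b"
  assumes inj: "inj h"
begin

abbreviation "L \<equiv> transport_ring h fin_part"
abbreviation "F \<equiv> transport_ring h fixed"

sublocale Lt: subfield_transport fin_part h
  by unfold_locales (auto simp: fin_part_closed inj)

sublocale Ft: subfield_transport fixed h
  by unfold_locales (auto simp: fixed_closed inj)

lemma L_restrict: "L\<lparr>carrier := h ` fixed\<rparr> = F"
  by (simp add: transport_ring_def)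

lemma carrier_F: "carrier F = h ` fixed"
  by (simp add: transport_ring_def)

lemma F_incl_L: "F \<lesssim> L"
  by (rule iso_inclI, rule ring_hom_memI) (use fixed_subset in \<open>auto simp: transport_ring_def\<close>)

lemma subfield_F: "subfield (h ` fixed) L"
proof (rule Lt.R.subfield_iff(1))
  show "field (L\<lparr>carrier := h ` fixed\<rparr>)" unfolding L_restrict by (rule Ft.field_transport)
  show "h ` fixed \<subseteq> carrier L" using fixed_subset by (auto simp: Lt.transport_simps)
qed

lemma algebraic_F:
  assumes "x \<in> carrier L"
  shows "(Lt.R.algebraic over (h ` fixed)) x"
proof -
  obtain z where z: "z \<in> fin_part" "x = h z" using assms by (auto simp: Lt.transport_simps)
  define p where "p = map h (rev (coeffs (orb_poly z)))"
  have ne: "coeffs (orb_poly z) \<noteq> []" using orb_poly_root(2)[OF z(1)] by simp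
  have set_c: "set (coeffs (orb_poly z)) \<subseteq> fixed"
    using orb_poly_coeff_fixed[OF z(1)] by (auto simp: coeffs_def)
  have "hd p = h (lead_coeff (orb_poly z))"
    using ne by (simp add: p_def hd_map hd_rev last_coeffs_eq_coeff_degree)
  then have "hd p \<noteq> \<zero>\<^bsub>L\<^esub>" using orb_poly_root(2)[OF z(1)] by (simp add: Lt.transport_simps)
  then have "p \<in> carrier ((h ` fixed)[X]\<^bsub>L\<^esub>)"
    using set_c ne by (auto simp: univ_poly_def polynomial_def p_def)
  moreover have "p \<noteq> []" using ne by (simp add: p_def)
  moreover have "Lt.R.eval p x = \<zero>\<^bsub>L\<^esub>"
  proof -
    have "set (rev (coeffs (orb_poly z))) \<subseteq> fin_part" using set_c fixed_subset by auto
    from Lt.transport_eval[OF this z(1)] have "Lt.R.eval p x = h (poly (orb_poly z) z)"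
      by (simp add: p_def z(2))
    then show ?thesis using orb_poly_root(1)[OF z(1)] self_orb by (simp add: Lt.transport_simps)
  qed
  ultimately show ?thesis by (rule Lt.R.algebraicI)
qed

sublocale algebraic_extension L "h ` fixed"
  by (intro algebraic_extension.intro Lt.field_transport subfield_F)
     (simp add: algebraic_extension_axioms_def algebraic_F)

text \<open>A root exists in the ambient algebraically closed field, and
  \<open>root_in_fin_part\<close> places it in \<open>fin_part\<close>.\<close>

lemma algebraically_closed_L: "algebraically_closed L"
proof (rule Lt.R.algebraically_closedI)
  fix p assume p: "p \<in> carrier (poly_ring L)" "Polynomials.degree p > 1"
  define cs where "cs = map (inv_into UNIV h) p"
  have set_p: "set p \<subseteq> h ` fin_part" and hd_p: "hd p \<noteq> \<zero>\<^bsub>L\<^esub>"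
    using p by (auto simp: univ_poly_def polynomial_def Lt.transport_simps)
  have p_eq: "p = map h cs"
    unfolding cs_def map_map by (rule map_idI[symmetric]) (use set_p in \<open>auto simp: f_inv_into_f\<close>)
  have cs: "set cs \<subseteq> fin_part" "cs \<noteq> []"
    using set_p inj p by (auto simp: cs_def)
  define P where "P = Poly (rev cs)"
  have coeffP: "coeff P i = (if i < length cs then rev cs ! i else 0)" for i
    by (simp add: P_def nth_default_def)
  have "coeff P (length cs - 1) = hd cs"
    using cs(2) by (simp add: coeffP rev_nth hd_conv_nth)
  moreover have "hd cs \<noteq> 0" using hd_p cs(2) by (auto simp: p_eq hd_map Lt.transport_simps)
  ultimately have "length cs - 1 \<le> degree P" by (intro le_degree) simp
  moreover have "length cs - 1 > 1" using p(2) by (simp add: p_eq)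
  ultimately have "degree P > 0" by simp
  then obtain x where x: "poly P x = 0" using alg_closed_imp_poly_has_root by blast
  have "coeff P i \<in> fin_part" for i
  proof (cases "i < length cs")
    case True
    then have "rev cs ! i \<in> set (rev cs)" by (intro nth_mem) simp
    then show ?thesis using True cs(1) by (auto simp: coeffP)
  qed (simp add: coeffP fin_part_closed)
  moreover have "P \<noteq> 0" using \<open>degree P > 0\<close> by auto
  ultimately have "x \<in> fin_part" using root_in_fin_part x by blast
  moreover have "Lt.R.eval p (h x) = \<zero>\<^bsub>L\<^esub>"
    using Lt.transport_eval[OF cs(1) \<open>x \<in> fin_part\<close>] x by (simp add: p_eq P_def Lt.transport_simps)
  ultimately show "\<exists>x\<in>carrier L. Lt.R.eval p x = \<zero>\<^bsub>L\<^esub>" by (auto simp: Lt.transport_simps)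
qed

lemma separable_closure_L: "separable_closure L (h ` fixed)"
proof (intro separable_closure.intro Lt.field_transport subfield_F separable_closure_axioms.intro)
  fix x assume x: "x \<in> carrier L"
  show "(Lt.R.algebraic over (h ` fixed)) x" by (rule algebraic_F[OF x])
  show "Lt.R.separable_poly (h ` fixed) (Lt.R.Irr (h ` fixed) x)"
    by (rule separable_Irr[OF _ x]) (simp add: Lt.transport_add_pow Lt.transport_simps(4,6))
next
  fix P assume "Lt.R.separable_poly (carrier L) P"
  then have "P \<in> carrier (poly_ring L)" by (simp add: Lt.R.separable_poly_def)
  then show "Lt.R.splitted P" using algebraically_closed.roots_over_carrier[OF algebraically_closed_L] by blast
qed

definition lift :: "('a \<Rightarrow> 'a) \<Rightarrow> 'b \<Rightarrow> 'b" where
  "lift \<gamma> = restrict (\<lambda>x. h (\<gamma> (inv_into UNIV h x))) (h ` fin_part)"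

lemma lift_apply: "z \<in> fin_part \<Longrightarrow> lift \<gamma> (h z) = h (\<gamma> z)"
  using inj by (simp add: lift_def)

lemma lift_in_G:
  assumes "\<gamma> \<in> \<Gamma>"
  shows "lift \<gamma> \<in> carrier G"
proof -
  interpret g: field_embedding \<gamma> by (rule emb[OF assms])
  have bij: "bij_betw \<gamma> fin_part fin_part" by (rule bij_betw_fin_part[OF assms])
  have "bij_betw (lift \<gamma>) (h ` fin_part) (h ` fin_part)"
    unfolding bij_betw_def
  proof
    show "inj_on (lift \<gamma>) (h ` fin_part)"
      by (rule inj_onI) (auto simp: lift_apply Lt.transport_simps g.eq_iff)
    have "lift \<gamma> ` h ` fin_part = h ` \<gamma> ` fin_part" by (auto simp: lift_apply image_iff)
    then show "lift \<gamma> ` h ` fin_part = h ` fin_part" using bij by (simp add: bij_betw_def)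
  qed
  moreover have "lift \<gamma> \<in> extensional (h ` fin_part)" by (simp add: lift_def)
  moreover have "lift \<gamma> \<in> ring_hom L L"
  proof (rule ring_hom_memI)
    fix x y assume "x \<in> carrier L" "y \<in> carrier L"
    then obtain u v where uv: "x = h u" "y = h v" "u \<in> fin_part" "v \<in> fin_part"
      by (auto simp: Lt.transport_simps)
    then have g: "\<gamma> u \<in> fin_part" "\<gamma> v \<in> fin_part" using bij by (auto simp: bij_betw_def)
    show "lift \<gamma> x \<in> carrier L" "lift \<gamma> (x \<otimes>\<^bsub>L\<^esub> y) = lift \<gamma> x \<otimes>\<^bsub>L\<^esub> lift \<gamma> y"
      "lift \<gamma> (x \<oplus>\<^bsub>L\<^esub> y) = lift \<gamma> x \<oplus>\<^bsub>L\<^esub> lift \<gamma> y"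
      using uv g by (simp_all add: lift_apply Lt.transport_simps fin_part_closed g.mult g.add)
  next
    show "lift \<gamma> \<one>\<^bsub>L\<^esub> = \<one>\<^bsub>L\<^esub>" by (simp add: Lt.transport_simps lift_apply fin_part_closed g.one)
  qed
  moreover have "lift \<gamma> x = x" if x: "x \<in> h ` fixed" for x
  proof -
    obtain z where z: "x = h z" "z \<in> fixed" using x by blast
    then have "z \<in> fin_part" "\<gamma> z = z" using fixed_subset assms by (auto simp: fixed_def)
    then show ?thesis by (simp add: z lift_apply)
  qed
  ultimately show ?thesis
    by (simp add: carrier_G galois_auts_def Bij_def Lt.transport_simps(1))
qed

lemma lift_mult:
  assumes "\<gamma> \<in> \<Gamma>" "\<delta> \<in> \<Gamma>"
  shows "lift \<gamma> \<otimes>\<^bsub>G\<^esub> lift \<delta> = lift (\<gamma> \<circ> \<delta>)"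
proof (rule gal_eqI)
  show "lift \<gamma> \<otimes>\<^bsub>G\<^esub> lift \<delta> \<in> carrier G" using lift_in_G assms by simp
  show "lift (\<gamma> \<circ> \<delta>) \<in> carrier G" using lift_in_G comp_mem assms by blast
  fix x assume "x \<in> carrier L"
  then obtain z where z: "x = h z" "z \<in> fin_part" by (auto simp: Lt.transport_simps)
  then have "\<delta> z \<in> fin_part" using bij_betw_fin_part[OF assms(2)] by (auto simp: bij_betw_def)
  then show "(lift \<gamma> \<otimes>\<^bsub>G\<^esub> lift \<delta>) x = lift (\<gamma> \<circ> \<delta>) x"
    using z lift_in_G assms by (simp add: mult_G_apply lift_apply Lt.transport_simps(1))
qed

lemma lift_pow:
  assumes "\<gamma> \<in> \<Gamma>" "z \<in> fin_part"
  shows "(lift \<gamma> [^]\<^bsub>G\<^esub> (n :: nat)) (h z) = h ((\<gamma> ^^ n) z)"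
  using assms(2)
proof (induction n arbitrary: z)
  case 0
  then show ?case by (simp add: one_G_apply Lt.transport_simps(1))
next
  case (Suc n)
  then have "\<gamma> z \<in> fin_part" using bij_betw_fin_part[OF assms(1)] by (auto simp: bij_betw_def)
  then show ?case
    using Suc lift_in_G[OF assms(1)]
    by (simp add: mult_G_apply lift_apply Lt.transport_simps(1) funpow_Suc_right del: funpow.simps)
qed

text \<open>The Galois action moved back to the original type, inverse to \<open>lift\<close> on
  \<open>fin_part\<close>; there the arithmetic of the type-class field is available.\<close>

definition act :: "('b \<Rightarrow> 'b) \<Rightarrow> 'a \<Rightarrow> 'a" where
  "act g z = inv_into UNIV h (g (h z))"

lemma h_mem: "z \<in> fin_part \<Longrightarrow> h z \<in> carrier L"
  by (simp add: Lt.transport_simps(1))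

lemma h_act: "g \<in> carrier G \<Longrightarrow> z \<in> fin_part \<Longrightarrow> h (act g z) = g (h z)"
  using galD(6)[of g "h z"] by (auto simp: act_def Lt.transport_simps(1) f_inv_into_f)

lemma act_hom:
  assumes "g \<in> carrier G" "x \<in> fin_part" "y \<in> fin_part"
  shows "act g (x + y) = act g x + act g y" "act g (x * y) = act g x * act g y"
proof -
  have "h (act g (x + y)) = h (act g x) \<oplus>\<^bsub>L\<^esub> h (act g y)" "h (act g (x * y)) = h (act g x) \<otimes>\<^bsub>L\<^esub> h (act g y)"
    using gal_hom[OF assms(1) h_mem[OF assms(2)] h_mem[OF assms(3)]] assms
    by (simp_all add: h_act fin_part_closed Lt.transport_simps(2,5))
  then show "act g (x + y) = act g x + act g y" "act g (x * y) = act g x * act g y"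
    by (simp_all add: Lt.transport_simps)
qed

lemma act_fixed: "g \<in> carrier G \<Longrightarrow> x \<in> fixed \<Longrightarrow> act g x = x"
  using galD(3)[of g "h x"] inj by (simp add: act_def)

lemma act_mult: "g \<in> carrier G \<Longrightarrow> g' \<in> carrier G \<Longrightarrow> z \<in> fin_part \<Longrightarrow> act (g \<otimes>\<^bsub>G\<^esub> g') z = act g (act g' z)"
  by (simp add: act_def[of "g \<otimes>\<^bsub>G\<^esub> g'"] mult_G_apply h_mem act_def[of g] h_act)

lemma act_lift: "z \<in> fin_part \<Longrightarrow> act (lift \<gamma>) z = \<gamma> z"
  using inj by (simp add: act_def lift_apply)

lemma act_power: "g \<in> carrier G \<Longrightarrow> z \<in> fin_part \<Longrightarrow> act g (z ^ n) = act g z ^ n"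
  by (induction n) (auto simp: act_fixed fixed_closed act_hom fin_part_power)

text \<open>By \<open>ex_agreeing_embedding\<close> the lifts of \<Gamma> are dense in the Galois
  group, so torsion has to be examined for the explicit embeddings only.\<close>

lemma pro_group_G_if_torsion:
  assumes l: "Factorial_Ring.prime l"
    and tor: "\<And>\<gamma> z. \<gamma> \<in> \<Gamma> \<Longrightarrow> z \<in> fin_part \<Longrightarrow> \<exists>n. (\<gamma> ^^ (l ^ n)) z = z"
  shows "pro_group l G"
proof (rule pro_group_G[OF l, of "lift ` \<Gamma>"])
  show "lift ` \<Gamma> \<subseteq> carrier G" using lift_in_G by blast
next
  fix g Z assume g: "g \<in> carrier G" and Z: "finite Z" "Z \<subseteq> carrier L"
  obtain Z' where Z': "Z = h ` Z'" "Z' \<subseteq> fin_part"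
    using Z(2) by (auto simp: Lt.transport_simps(1) subset_image_iff)
  have "inj_on h Z'" using inj by (rule inj_on_subset) simp
  then have "finite Z'" using Z(1) Z'(1) by (simp add: finite_image_iff)
  obtain \<gamma> where \<gamma>: "\<gamma> \<in> \<Gamma>" "\<And>z. z \<in> Z' \<Longrightarrow> act g z = \<gamma> z"
  proof (rule ex_agreeing_embedding[of "act g" Z', OF act_hom[OF g] act_fixed[OF g] \<open>finite Z'\<close> Z'(2)])
    fix \<gamma> assume "\<gamma> \<in> \<Gamma>" "\<And>z. z \<in> Z' \<Longrightarrow> act g z = \<gamma> z"
    then show thesis by (rule that)
  qed
  have "lift \<gamma> z = g z" if z: "z \<in> Z" for z
  proof -
    obtain w where w: "z = h w" "w \<in> Z'" using z Z' by blast
    then have "w \<in> fin_part" using Z' by blast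
    then show ?thesis using w \<gamma>(2)[OF w(2)] h_act[OF g, of w] by (simp add: lift_apply)
  qed
  then show "\<exists>d\<in>lift ` \<Gamma>. \<forall>z\<in>Z. d z = g z" using \<gamma>(1) by blast
next
  fix d x assume "d \<in> lift ` \<Gamma>" "x \<in> carrier L"
  then obtain \<gamma> z where "\<gamma> \<in> \<Gamma>" "d = lift \<gamma>" "x = h z" "z \<in> fin_part" by (auto simp: Lt.transport_simps)
  moreover obtain n where "(\<gamma> ^^ (l ^ n)) z = z" using tor calculation by blast
  ultimately show "\<exists>n :: nat. (d [^]\<^bsub>G\<^esub> (l ^ n)) x = x" using lift_pow by metis
qed

end

subsection \<open>Kummer characters\<close>

text \<open>Since \<open>l\<close> is prime, a nontrivial \<open>l\<close>-th root of unity is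
  primitive: an exponent strictly between 0 and \<open>l\<close> is invertible modulo
  \<open>l\<close>. Its \<open>l\<close> powers exhaust the roots of \<open>X^l - 1\<close>, of
  which there are at most \<open>l\<close>.\<close>

lemma roots_of_unity_prime:
  fixes \<omega> :: "'a :: Fields.field"
  assumes l: "Factorial_Ring.prime l" and \<omega>: "\<omega> ^ l = 1" "\<omega> \<noteq> 1"
  shows "inj_on (\<lambda>n. \<omega> ^ n) {..<l}" and "y ^ l = 1 \<Longrightarrow> \<exists>n<l. y = \<omega> ^ n"
proof -
  have ne: "\<omega> ^ n \<noteq> 1" if n: "0 < n" "n < l" for n
  proof
    assume "\<omega> ^ n = 1"
    have "coprime n l" using n l by (metis coprime_commute nat_dvd_not_less prime_imp_coprime)
    then obtain x y where "n * x = l * y + 1" using bezout_nat[of n l] n(1) by auto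
    then have "(\<omega> ^ n) ^ x = (\<omega> ^ l) ^ y * \<omega>" by (metis power_add power_mult power_one_right)
    then show False using \<open>\<omega> ^ n = 1\<close> \<omega> by simp
  qed
  have "\<omega> \<noteq> 0" using \<omega>(1) prime_gt_0_nat[OF l] by (auto simp: power_0_left)
  show inj: "inj_on (\<lambda>n. \<omega> ^ n) {..<l}"
  proof (rule linorder_inj_onI)
    fix m n assume "m < n" "m \<in> {..<l}" "n \<in> {..<l}"
    then have "\<omega> ^ n = \<omega> ^ m * \<omega> ^ (n - m)" "\<omega> ^ (n - m) \<noteq> 1"
      using ne[of "n - m"] by (auto simp flip: power_add)
    then show "\<omega> ^ m \<noteq> \<omega> ^ n" using \<open>\<omega> \<noteq> 0\<close> by simp
  qed auto
  define p where "p = monom 1 l - (1 :: 'a poly)"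
  have "coeff p l = 1" using prime_gt_0_nat[OF l] by (simp add: p_def coeff_1)
  then have "p \<noteq> 0" by auto
  have root: "poly p y = 0 \<longleftrightarrow> y ^ l = 1" for y by (simp add: p_def poly_monom)
  have "degree p \<le> l" unfolding p_def by (intro degree_diff_le degree_monom_le) simp
  then have "card {y. poly p y = 0} \<le> l"
    using card_poly_roots_bound[OF \<open>p \<noteq> 0\<close>] by linarith
  moreover have "(\<lambda>n. \<omega> ^ n) ` {..<l} \<subseteq> {y. poly p y = 0}"
    using \<omega>(1) by (auto simp: root) (metis mult.commute power_mult power_one)
  moreover have "card ((\<lambda>n. \<omega> ^ n) ` {..<l}) = l" using inj by (simp add: card_image)
  ultimately have "(\<lambda>n. \<omega> ^ n) ` {..<l} = {y. poly p y = 0}"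
    using poly_roots_finite[OF \<open>p \<noteq> 0\<close>] by (intro card_seteq) auto
  then show "y ^ l = 1 \<Longrightarrow> \<exists>n<l. y = \<omega> ^ n" using root by blast
qed

locale kummer_model = galois_model +
  fixes l :: nat and \<omega> :: 'a
  assumes l: "Factorial_Ring.prime l" and \<omega>: "\<omega> ^ l = 1" "\<omega> \<noteq> 1" "\<omega> \<in> fixed"
begin

lemma \<omega>_power_mod: "\<omega> ^ (n mod l) = \<omega> ^ n"
proof -
  have "\<omega> ^ n = (\<omega> ^ l) ^ (n div l) * \<omega> ^ (n mod l)"
    by (metis mult_div_mod_eq power_add power_mult)
  then show ?thesis using \<omega>(1) by simp
qed

lemma \<omega>_power_fixed: "\<omega> ^ n \<in> fixed"
  by (induction n) (auto simp: fixed_closed \<omega>(3))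

lemma \<omega>_power_fin_part: "\<omega> ^ n \<in> fin_part"
  using \<omega>_power_fixed fixed_subset by blast

text \<open>The exponent of the Kummer character, reduced to the range below \<open>l\<close>. It is
  meaningful when \<open>g\<close> fixes \<open>\<alpha>^l\<close> and \<alpha> is nonzero.\<close>

definition kummer :: "'a \<Rightarrow> ('b \<Rightarrow> 'b) \<Rightarrow> nat" where
  "kummer \<alpha> g = (THE n. n < l \<and> act g \<alpha> = \<omega> ^ n * \<alpha>)"

lemma kummer_unique:
  assumes "\<alpha> \<noteq> 0" "n < l" "act g \<alpha> = \<omega> ^ n * \<alpha>"
  shows "kummer \<alpha> g = n"
  unfolding kummer_def
proof (rule the_equality)
  fix m assume "m < l \<and> act g \<alpha> = \<omega> ^ m * \<alpha>"
  then have "m < l" "\<omega> ^ m = \<omega> ^ n" using assms by auto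
  then show "m = n" using roots_of_unity_prime(1)[OF l \<omega>(1,2)] assms(2) by (auto simp: inj_on_def)
qed (use assms in blast)

lemma kummer:
  assumes g: "g \<in> carrier G" and \<alpha>: "\<alpha> \<in> fin_part" "\<alpha> \<noteq> 0" and inv: "act g (\<alpha> ^ l) = \<alpha> ^ l"
  shows "kummer \<alpha> g < l" "act g \<alpha> = \<omega> ^ kummer \<alpha> g * \<alpha>"
proof -
  have "(act g \<alpha> / \<alpha>) ^ l = 1"
    using inv \<alpha> by (simp add: power_divide act_power[OF g \<alpha>(1)])
  then obtain n where n: "n < l" "act g \<alpha> / \<alpha> = \<omega> ^ n"
    using roots_of_unity_prime(2)[OF l \<omega>(1,2)] by blast
  then have "act g \<alpha> = \<omega> ^ n * \<alpha>" using \<alpha>(2) by (simp add: field_simps)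
  then show "kummer \<alpha> g < l" "act g \<alpha> = \<omega> ^ kummer \<alpha> g * \<alpha>"
    using kummer_unique[OF \<alpha>(2) n(1)] n(1) by simp_all
qed

lemma act_\<omega>_mult: "g \<in> carrier G \<Longrightarrow> \<alpha> \<in> fin_part \<Longrightarrow> act g (\<omega> ^ n * \<alpha>) = \<omega> ^ n * act g \<alpha>"
  by (simp add: act_hom \<omega>_power_fin_part act_fixed \<omega>_power_fixed)

definition stab :: "'a \<Rightarrow> ('b \<Rightarrow> 'b) set" where
  "stab \<beta> = {g \<in> carrier G. act g \<beta> = \<beta>}"

text \<open>In general \<open>act g \<alpha> / \<alpha>\<close> is only a cocycle. It is a
  homomorphism here because its values are powers of \<omega>, which lies in the fixed
  field.\<close>

lemma kummer_mult:
  assumes g: "g \<in> stab (\<alpha> ^ l)" "g' \<in> stab (\<alpha> ^ l)" and \<alpha>: "\<alpha> \<in> fin_part" "\<alpha> \<noteq> 0"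
  shows "kummer \<alpha> (g \<otimes>\<^bsub>G\<^esub> g') = (kummer \<alpha> g + kummer \<alpha> g') mod l"
proof (rule kummer_unique[OF \<alpha>(2)])
  show "(kummer \<alpha> g + kummer \<alpha> g') mod l < l" using prime_gt_0_nat[OF l] by simp
  have G: "g \<in> carrier G" "g' \<in> carrier G" "act g (\<alpha> ^ l) = \<alpha> ^ l" "act g' (\<alpha> ^ l) = \<alpha> ^ l"
    using g by (auto simp: stab_def)
  have "act (g \<otimes>\<^bsub>G\<^esub> g') \<alpha> = act g (act g' \<alpha>)"
    using G \<alpha> by (simp add: act_mult)
  also have "act g' \<alpha> = \<omega> ^ kummer \<alpha> g' * \<alpha>"
    by (rule kummer(2)[OF G(2) \<alpha> G(4)])
  also have "act g (\<omega> ^ kummer \<alpha> g' * \<alpha>) = \<omega> ^ kummer \<alpha> g' * act g \<alpha>"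
    by (rule act_\<omega>_mult[OF G(1) \<alpha>(1)])
  also have "act g \<alpha> = \<omega> ^ kummer \<alpha> g * \<alpha>"
    by (rule kummer(2)[OF G(1) \<alpha> G(3)])
  finally show "act (g \<otimes>\<^bsub>G\<^esub> g') \<alpha> = \<omega> ^ ((kummer \<alpha> g + kummer \<alpha> g') mod l) * \<alpha>"
    by (simp add: \<omega>_power_mod power_add mult_ac)
qed

lemma clopen_act:
  assumes "\<alpha> \<in> fin_part"
  shows "openin (topo G) {g \<in> carrier G. act g \<alpha> = \<beta>}" "closedin (topo G) {g \<in> carrier G. act g \<alpha> = \<beta>}"
  unfolding act_def using openin_value[OF h_mem[OF assms]] closedin_value[OF h_mem[OF assms]] by auto

lemma openin_kummer:
  assumes S: "openin (topo G) S" "S \<subseteq> stab (\<alpha> ^ l)" and \<alpha>: "\<alpha> \<in> fin_part" "\<alpha> \<noteq> 0"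
  shows "openin (topo G) {g \<in> S. kummer \<alpha> g = n}"
proof (cases "n < l")
  case True
  have "{g \<in> S. kummer \<alpha> g = n} = S \<inter> {g \<in> carrier G. act g \<alpha> = \<omega> ^ n * \<alpha>}"
    using S(2) kummer[OF _ \<alpha>] kummer_unique[OF \<alpha>(2) True] by (auto simp: stab_def)
  then show ?thesis using S(1) clopen_act(1)[OF \<alpha>(1)] by auto
next
  case False
  then have "{g \<in> S. kummer \<alpha> g = n} = {}" using S(2) kummer(1)[OF _ \<alpha>] by (auto simp: stab_def)
  then show ?thesis by (simp only: openin_empty)
qed

lemma subgroup_stab:
  assumes "\<beta> \<in> fin_part"
  shows "subgroup (stab \<beta>) G"
proof (rule G.subgroupI)
  have "act \<one>\<^bsub>G\<^esub> \<beta> = \<beta>" using inj assms by (simp add: act_def one_G_apply h_mem)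
  then show "stab \<beta> \<noteq> {}" by (auto simp: stab_def)
  fix g assume g: "g \<in> stab \<beta>"
  then have "act (inv\<^bsub>G\<^esub> g \<otimes>\<^bsub>G\<^esub> g) \<beta> = act (inv\<^bsub>G\<^esub> g) \<beta>"
    using assms by (subst act_mult) (auto simp: stab_def)
  then show "inv\<^bsub>G\<^esub> g \<in> stab \<beta>" using g \<open>act \<one>\<^bsub>G\<^esub> \<beta> = \<beta>\<close> by (auto simp: stab_def)
  fix g' assume "g' \<in> stab \<beta>"
  then show "g \<otimes>\<^bsub>G\<^esub> g' \<in> stab \<beta>" using g assms by (auto simp: stab_def act_mult)
qed (auto simp: stab_def)

text \<open>\<open>\<beta> = \<alpha>\<^sup>l\<close> generates an abelian extension of the fixed field if \<open>\<beta>\<^sup>l\<close> lies in it.\<close>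

lemma derived_subset_stab:
  assumes \<beta>: "\<beta> \<in> fin_part" "\<beta> \<noteq> 0" "\<beta> ^ l \<in> fixed"
  shows "derived G (carrier G) \<subseteq> stab \<beta>"
  unfolding derived_def
proof (rule G.generate_subgroup_incl[OF _ subgroup_stab[OF \<beta>(1)]], safe)
  fix g g' assume g: "g \<in> carrier G" "g' \<in> carrier G"
  define c where "c = g \<otimes>\<^bsub>G\<^esub> g' \<otimes>\<^bsub>G\<^esub> inv\<^bsub>G\<^esub> g \<otimes>\<^bsub>G\<^esub> inv\<^bsub>G\<^esub> g'"
  have c: "c \<in> carrier G" using g by (simp add: c_def)
  have st: "k \<in> stab (\<beta> ^ l)" if "k \<in> carrier G" for k
    using that \<beta>(3) by (simp add: stab_def act_fixed)
  \<comment> \<open>Since \<open>\<beta>^l\<close> is fixed, \<open>kummer \<beta>\<close> is a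
    character of the whole group. Applied to this form of the commutator, it gives zero on
    \<open>c\<close>.\<close>
  have "c \<otimes>\<^bsub>G\<^esub> (g' \<otimes>\<^bsub>G\<^esub> g) = g \<otimes>\<^bsub>G\<^esub> g'"
    using g by (simp add: c_def G.m_assoc) (simp add: G.m_assoc[symmetric])
  then have "kummer \<beta> (c \<otimes>\<^bsub>G\<^esub> (g' \<otimes>\<^bsub>G\<^esub> g)) = kummer \<beta> (g' \<otimes>\<^bsub>G\<^esub> g)"
    using kummer_mult[OF st st \<beta>(1,2)] g by (simp add: add.commute)
  then have "(kummer \<beta> c + kummer \<beta> (g' \<otimes>\<^bsub>G\<^esub> g)) mod l = kummer \<beta> (g' \<otimes>\<^bsub>G\<^esub> g)"
    using kummer_mult[OF st[OF c] st \<beta>(1,2)] g by simp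
  then have "(kummer \<beta> c + kummer \<beta> (g' \<otimes>\<^bsub>G\<^esub> g)) mod l = (0 + kummer \<beta> (g' \<otimes>\<^bsub>G\<^esub> g)) mod l"
    using kummer(1)[OF _ \<beta>(1,2), of "g' \<otimes>\<^bsub>G\<^esub> g"] st g by (simp add: stab_def)
  then have "[kummer \<beta> c = 0] (mod l)"
    by (simp only: flip: cong_def) (metis cong_add_rcancel_nat)
  then have "kummer \<beta> c = 0"
    using kummer(1)[OF c \<beta>(1,2)] st[OF c] by (simp add: stab_def cong_def)
  then show "c \<in> stab \<beta>"
    using kummer(2)[OF c \<beta>(1,2)] st[OF c] c by (simp add: stab_def)
qed

text \<open>The commutator relation is stated without inverses, which \<Gamma> need not contain;
  they are taken in the Galois group.\<close>

lemma lift_commutator: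
  assumes "\<gamma> \<in> \<Gamma>" "\<delta> \<in> \<Gamma>" "\<epsilon> \<in> \<Gamma>" "\<gamma> \<circ> \<delta> = \<epsilon> \<circ> \<delta> \<circ> \<gamma>"
  shows "lift \<epsilon> \<in> derived G (carrier G)"
proof -
  note c = lift_in_G[OF assms(1)] lift_in_G[OF assms(2)] lift_in_G[OF assms(3)]
  have "lift \<gamma> \<otimes>\<^bsub>G\<^esub> lift \<delta> = lift \<epsilon> \<otimes>\<^bsub>G\<^esub> (lift \<delta> \<otimes>\<^bsub>G\<^esub> lift \<gamma>)"
    using assms comp_mem by (simp add: lift_mult comp_assoc)
  then have "lift \<epsilon> = lift \<gamma> \<otimes>\<^bsub>G\<^esub> lift \<delta> \<otimes>\<^bsub>G\<^esub> inv\<^bsub>G\<^esub> lift \<gamma> \<otimes>\<^bsub>G\<^esub> inv\<^bsub>G\<^esub> lift \<delta>"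
    using c by (simp add: G.m_assoc)
  then show ?thesis unfolding derived_def using c by (intro generate.incl) blast
qed

text \<open>The commutators \<open>\<sigma>\<close> and \<open>\<tau>\<close> commute, but move the Kummer generators \<open>\<alpha>\<close> and \<open>\<beta>\<close> independently.\<close>

theorem not_free:
  assumes pro: "pro_group l G"
    and mem: "\<phi> \<in> \<Gamma>" "\<delta> \<in> \<Gamma>" "\<epsilon> \<in> \<Gamma>" "\<sigma> \<in> \<Gamma>" "\<tau> \<in> \<Gamma>"
    and comm: "\<phi> \<circ> \<delta> = \<sigma> \<circ> \<delta> \<circ> \<phi>" "\<phi> \<circ> \<epsilon> = \<tau> \<circ> \<epsilon> \<circ> \<phi>" "\<sigma> \<circ> \<tau> = \<tau> \<circ> \<sigma>"
    and \<alpha>: "\<alpha> \<in> fin_part" "\<alpha> \<noteq> 0" "(\<alpha> ^ l) ^ l \<in> fixed" "\<sigma> \<alpha> = \<omega> * \<alpha>" "\<tau> \<alpha> = \<alpha>"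
    and \<beta>: "\<beta> \<in> fin_part" "\<beta> \<noteq> 0" "(\<beta> ^ l) ^ l \<in> fixed" "\<sigma> \<beta> = \<beta>" "\<tau> \<beta> = \<omega> * \<beta>"
  shows "\<not> free_pro_group l (closed_commutator_subgroup G)"
    "\<not> free_pro_group l (closed_commutator_subgroup (max_pro_quotient l G))"
proof -
  \<comment> \<open>The subgroup on which both Kummer characters are homomorphisms. The elements
    \<open>\<alpha>^l\<close> and \<open>\<beta>^l\<close> are themselves \<open>l\<close>-th roots
    of fixed elements, so \<open>S\<close> contains all commutators; it is also open and
    closed.\<close>
  define S where "S = stab (\<alpha> ^ l) \<inter> stab (\<beta> ^ l)"
  have Sop: "openin (topo G) S" and Scl: "closedin (topo G) S"
    unfolding S_def stab_def using clopen_act fin_part_power \<alpha>(1) \<beta>(1) by (auto intro!: closedin_Int openin_Int)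
  have der: "derived G (carrier G) \<subseteq> S"
    unfolding S_def using derived_subset_stab \<alpha> \<beta> fin_part_power by auto
  have SG: "g \<in> carrier G" "act g (\<alpha> ^ l) = \<alpha> ^ l" "act g (\<beta> ^ l) = \<beta> ^ l" if "g \<in> S" for g
    using that by (auto simp: S_def stab_def)
  have st: "lift \<sigma> \<in> derived G (carrier G)" "lift \<tau> \<in> derived G (carrier G)"
    using lift_commutator mem comm by blast+
  have stc: "lift \<sigma> \<otimes>\<^bsub>G\<^esub> lift \<tau> = lift \<tau> \<otimes>\<^bsub>G\<^esub> lift \<sigma>" using mem comm by (simp add: lift_mult)
  have l1: "1 < l" using prime_gt_1_nat[OF l] .
  have val: "kummer \<alpha> (lift \<sigma>) = 1" "kummer \<beta> (lift \<sigma>) = 0" "kummer \<alpha> (lift \<tau>) = 0" "kummer \<beta> (lift \<tau>) = 1"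
    using l1 \<alpha> \<beta> by (auto intro!: kummer_unique simp: act_lift)
  note hyps = l group_G topspace_G Scl der st stc
  have k: "kummer \<gamma> (g \<otimes>\<^bsub>G\<^esub> g') = (kummer \<gamma> g + kummer \<gamma> g') mod l" "kummer \<gamma> g < l"
    "openin (topo G) {x \<in> S. kummer \<gamma> x = n}"
    if "\<gamma> = \<alpha> \<or> \<gamma> = \<beta>" "g \<in> S" "g' \<in> S" for \<gamma> g g' n
    using that kummer_mult[of g \<gamma> g'] kummer(1)[of g \<gamma>] openin_kummer[OF Sop, of \<gamma> n] \<alpha> \<beta> SG
    by (auto simp: S_def)
  have "lift \<sigma> \<in> S" using st der by blast
  then have op: "openin (topo G) {x \<in> S. kummer \<alpha> x = n}" "openin (topo G) {x \<in> S. kummer \<beta> x = n}" for n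
    using k(3) by blast+
  show "\<not> free_pro_group l (closed_commutator_subgroup G)"
    by (rule not_free_closed_commutator[OF hyps, of "kummer \<alpha>" "kummer \<beta>"]) (use k op val in auto)
  \<comment> \<open>In a pro-\<open>l\<close> Galois group all open normal subgroups have
    \<open>l\<close>-power index, and they intersect trivially.\<close>
  have "max_pro_quotient l G = quotient_topgroup G {\<one>\<^bsub>G\<^esub>}"
    unfolding max_pro_quotient_def by (simp add: Inter_open_normal_pro_group[OF pro])
  moreover have "\<not> free_pro_group l (closed_commutator_subgroup (quotient_topgroup G {\<one>\<^bsub>G\<^esub>}))"
    by (rule not_free_closed_commutator_quotient_one[OF hyps, of "kummer \<alpha>" "kummer \<beta>"]) (use k op val in auto)
  ultimately show "\<not> free_pro_group l (closed_commutator_subgroup (max_pro_quotient l G))" by simp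
qed

end

section \<open>A pro-\<open>l\<close> group as its own Sylow subgroup\<close>

lemma restrict_topgroup_carrier:
  assumes "topspace (topo G) = carrier G"
  shows "restrict_topgroup G (carrier G) = G"
proof -
  have "subtopology (topo G) (carrier G) = topo G" by (metis assms subtopology_topspace)
  then show ?thesis by (simp add: restrict_topgroup_def)
qed

lemma sylow_pro_subgroup_carrier:
  fixes G :: "'a topgroup"
  assumes l: "Factorial_Ring.prime l" and pro: "pro_group l G"
  shows "sylow_pro_subgroup l G (carrier G)"
  unfolding sylow_pro_subgroup_def
proof (intro conjI allI impI)
  have G: "group G" "topspace (topo G) = carrier G"
    using pro by (auto simp: pro_group_def profinite_group_def topological_group_def)
  interpret group G by (rule G(1))
  show "subgroup (carrier G) G" by (rule subgroup_self)
  show "closedin (topo G) (carrier G)" using closedin_topspace[of "topo G"] G(2) by simp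
  show "pro_group l (restrict_topgroup G (carrier G))" using pro by (simp add: restrict_topgroup_carrier G(2))
  fix N assume "open_normal G N"
  then have N: "subgroup N G" by (simp add: open_normal_def normal_def)
  have "carrier G <#>\<^bsub>G\<^esub> N = carrier G"
  proof
    show "carrier G <#>\<^bsub>G\<^esub> N \<subseteq> carrier G" using subgroup.subset[OF N] by (auto simp: set_mult_def)
    show "carrier G \<subseteq> carrier G <#>\<^bsub>G\<^esub> N"
      using subgroup.one_closed[OF N] by (force simp: set_mult_def)
  qed
  moreover have "rcosets\<^bsub>G\<^esub> (carrier G) = {carrier G}"
  proof -
    have "carrier G #>\<^bsub>G\<^esub> x = carrier G" if "x \<in> carrier G" for x
      using that subgroup_self by (simp add: coset_join2)
    then show ?thesis using one_closed by (auto simp: RCOSETS_def)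
  qed
  ultimately show "\<not> l dvd card (rcosets\<^bsub>G\<^esub> (carrier G <#>\<^bsub>G\<^esub> N))"
    using l by (auto simp: not_prime_unit)
qed

section \<open>Automorphisms of Levi-Civita series\<close>

lift_definition twist :: "(real \<Rightarrow> 'a :: comm_ring_1) \<Rightarrow> 'a lc \<Rightarrow> 'a lc" is
  "\<lambda>\<eta> f x. \<eta> x * f x"
  by (erule left_finite_subset) auto

text \<open>The function under \<open>Abs_lc\<close> is a series only if \<phi> preserves zero, so
  the rule for its coefficients carries this condition.\<close>

definition lc_map :: "('a :: comm_ring_1 \<Rightarrow> 'a) \<Rightarrow> 'a lc \<Rightarrow> 'a lc" where
  "lc_map \<phi> f = Abs_lc (\<lambda>x. \<phi> (lc_coeff f x))"

lemma lc_coeff_map: "\<phi> 0 = 0 \<Longrightarrow> lc_coeff (lc_map \<phi> f) x = \<phi> (lc_coeff f x)"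
proof -
  assume "\<phi> 0 = 0"
  then have "left_finite (\<lambda>x. \<phi> (lc_coeff f x))"
    by (intro left_finite_subset[OF left_finite_lc_coeff[of f]]) auto
  then show ?thesis by (simp add: lc_map_def Abs_lc_inverse)
qed

definition is_character :: "(real \<Rightarrow> 'a :: comm_ring_1) \<Rightarrow> bool" where
  "is_character \<eta> \<longleftrightarrow> \<eta> 0 = 1 \<and> (\<forall>x y. \<eta> (x + y) = \<eta> x * \<eta> y)"

lemma field_embedding_twist:
  fixes \<eta> :: "real \<Rightarrow> 'a :: Fields.field"
  assumes "is_character \<eta>"
  shows "field_embedding (twist \<eta>)"
proof
  fix f g :: "'a lc"
  show "twist \<eta> (f + g) = twist \<eta> f + twist \<eta> g"
    by (simp add: lc_eq_iff twist.rep_eq lc_coeff_simps distrib_left)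
  show "twist \<eta> 1 = 1"
    using assms by (auto simp: lc_eq_iff twist.rep_eq lc_coeff_1 is_character_def)
  have "conv (\<lambda>x. \<eta> x * lc_coeff f x) (\<lambda>x. \<eta> x * lc_coeff g x) c = \<eta> c * conv (lc_coeff f) (lc_coeff g) c" for c
  proof -
    let ?A = "{a. lc_coeff f a \<noteq> 0 \<and> lc_coeff g (c - a) \<noteq> 0}"
    have fin: "finite ?A" by (intro conv_support_finite left_finite_lc_coeff)
    have "\<eta> c = \<eta> a * \<eta> (c - a)" for a
      using assms unfolding is_character_def by (metis add.commute diff_add_cancel)
    then have "(\<eta> a * lc_coeff f a) * (\<eta> (c - a) * lc_coeff g (c - a)) = \<eta> c * (lc_coeff f a * lc_coeff g (c - a))" for a
      by (simp add: mult_ac)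
    moreover have "conv (\<lambda>x. \<eta> x * lc_coeff f x) (\<lambda>x. \<eta> x * lc_coeff g x) c =
        (\<Sum>a\<in>?A. (\<eta> a * lc_coeff f a) * (\<eta> (c - a) * lc_coeff g (c - a)))"
      by (rule conv_eq[OF fin]) auto
    ultimately show ?thesis by (simp only: conv_def[of "lc_coeff f"] sum_distrib_left)
  qed
  then show "twist \<eta> (f * g) = twist \<eta> f * twist \<eta> g"
    by (simp add: lc_eq_iff twist.rep_eq times_lc.rep_eq)
qed

lemma field_embedding_lc_map:
  fixes \<phi> :: "'a :: Fields.field \<Rightarrow> 'a"
  assumes "field_embedding \<phi>"
  shows "field_embedding (lc_map \<phi>)"
proof
  interpret \<phi>: field_embedding \<phi> by fact
  fix f g :: "'a lc"
  show "lc_map \<phi> (f + g) = lc_map \<phi> f + lc_map \<phi> g"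
    by (simp add: lc_eq_iff lc_coeff_map lc_coeff_simps \<phi>.zero \<phi>.add)
  show "lc_map \<phi> 1 = 1"
    by (simp add: lc_eq_iff lc_coeff_map lc_coeff_1 \<phi>.zero \<phi>.one)
  have "conv (\<lambda>x. \<phi> (lc_coeff f x)) (\<lambda>x. \<phi> (lc_coeff g x)) c = \<phi> (conv (lc_coeff f) (lc_coeff g) c)" for c
    by (simp add: conv_def \<phi>.eq_0_iff \<phi>.sum \<phi>.mult)
  moreover have "lc_coeff (lc_map \<phi> u) = (\<lambda>x. \<phi> (lc_coeff u x))" for u
    by (simp add: fun_eq_iff lc_coeff_map \<phi>.zero)
  ultimately show "lc_map \<phi> (f * g) = lc_map \<phi> f * lc_map \<phi> g"
    by (simp add: lc_eq_iff times_lc.rep_eq)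
qed

lemma twist_twist: "twist \<eta> (twist \<eta>' f) = twist (\<lambda>x. \<eta> x * \<eta>' x) f"
  by (simp add: lc_eq_iff twist.rep_eq mult.assoc)

lemma lc_map_twist:
  fixes \<phi> :: "'a :: Fields.field \<Rightarrow> 'a"
  assumes "field_embedding \<phi>"
  shows "lc_map \<phi> (twist \<eta> f) = twist (\<lambda>x. \<phi> (\<eta> x)) (lc_map \<phi> f)"
proof -
  interpret \<phi>: field_embedding \<phi> by fact
  show ?thesis by (simp add: lc_eq_iff twist.rep_eq lc_coeff_map \<phi>.zero \<phi>.mult)
qed

lemma lc_map_lc_map:
  "\<phi> 0 = 0 \<Longrightarrow> \<psi> 0 = 0 \<Longrightarrow> lc_map \<phi> (lc_map \<psi> f) = lc_map (\<phi> \<circ> \<psi>) f"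
  by (simp add: lc_eq_iff lc_coeff_map)

lemma twist_lc_monom: "twist \<eta> (lc_monom c r) = lc_monom (\<eta> r * c) r"
  by (simp add: lc_eq_iff twist.rep_eq lc_coeff_monom)

lemma lc_map_lc_monom: "\<phi> 0 = 0 \<Longrightarrow> lc_map \<phi> (lc_monom c r) = lc_monom (\<phi> c) r"
  by (simp add: lc_eq_iff lc_coeff_map lc_coeff_monom)

section \<open>Torsion of maps acting coefficientwise\<close>

lemma funpow_field_embedding:
  fixes f :: "'a :: Fields.field \<Rightarrow> 'a"
  shows "field_embedding f \<Longrightarrow> field_embedding (f ^^ n)"
  by (induction n) (auto simp: field_embedding_def)

lemma funpow_fix_mult:
  fixes f :: "'a \<Rightarrow> 'a"
  shows "(f ^^ p) x = x \<Longrightarrow> p dvd n \<Longrightarrow> (f ^^ n) x = x"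
  using funpow_cong[of p f x n 0] by (simp add: cong_0_iff)

text \<open>A point fixed by the powers \<open>m\<close> and \<open>l^a\<close> of \<open>f\<close>
  is fixed by the power \<open>gcd m (l^a)\<close>, which divides the \<open>l\<close>-part of
  \<open>m\<close>. The exponent \<open>b\<close> depends on \<open>m\<close> alone, not on
  \<open>f\<close>, \<open>x\<close> or \<open>a\<close>.\<close>

lemma funpow_l_part:
  assumes l: "Factorial_Ring.prime (l :: nat)" and m: "m > 0"
  shows "\<exists>b. \<forall>(f :: 'a \<Rightarrow> 'a) x a. (f ^^ m) x = x \<longrightarrow> (f ^^ (l ^ a)) x = x \<longrightarrow> (f ^^ (l ^ b)) x = x"
proof -
  obtain m' where m': "m = l ^ multiplicity l m * m'" "\<not> l dvd m'"
    using l m by (metis multiplicity_decompose' not_prime_unit neq0_conv)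
  have "(f ^^ (l ^ multiplicity l m)) x = x" if f: "(f ^^ m) x = x" "(f ^^ (l ^ a)) x = x" for f :: "'a \<Rightarrow> 'a" and x a
  proof -
    obtain u v where uv: "m * u = l ^ a * v + gcd m (l ^ a)" using bezout_nat[of m "l ^ a"] m by auto
    have "coprime l m'" using l m'(2) by (simp add: prime_imp_coprime)
    then have "coprime (gcd m (l ^ a)) m'"
      by (metis coprime_power_left_iff coprime_divisors dvd_refl gcd_dvd2)
    moreover have "gcd m (l ^ a) dvd l ^ multiplicity l m * m'" using m'(1) by (metis gcd_dvd1)
    ultimately have d: "gcd m (l ^ a) dvd l ^ multiplicity l m" by (simp add: coprime_dvd_mult_left_iff)
    have "x = (f ^^ (m * u)) x" using funpow_fix_mult[OF f(1), of "m * u"] by simp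
    also have "m * u = gcd m (l ^ a) + l ^ a * v" using uv by simp
    also have "(f ^^ (gcd m (l ^ a) + l ^ a * v)) x = (f ^^ gcd m (l ^ a)) x"
      using funpow_fix_mult[OF f(2), of "l ^ a * v"] by (simp add: funpow_add)
    finally show ?thesis using funpow_fix_mult[OF _ d] by metis
  qed
  then show ?thesis by blast
qed

text \<open>Each coefficient has its own \<open>l\<close>-power period, and infinitely many
  coefficients might leave these unbounded. The finite orbit of \<open>z\<close> gives a common
  period \<open>m\<close>, whose \<open>l\<close>-part then works for all coefficients.\<close>

lemma coefficientwise_torsion:
  fixes g :: "'a :: comm_ring_1 lc \<Rightarrow> 'a lc" and c :: "real \<Rightarrow> 'a \<Rightarrow> 'a"
  assumes l: "Factorial_Ring.prime (l :: nat)" and g: "inj g" "finite (range (\<lambda>n :: nat. (g ^^ n) z))"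
    and c: "\<And>f x. lc_coeff (g f) x = c x (lc_coeff f x)" "\<And>x. \<exists>a. (c x ^^ (l ^ a)) (lc_coeff z x) = lc_coeff z x"
  shows "\<exists>b. (g ^^ (l ^ b)) z = z"
proof -
  have pow: "lc_coeff ((g ^^ n) f) x = (c x ^^ n) (lc_coeff f x)" for n f x
    by (induction n) (auto simp: c(1))
  obtain m where m: "m > 0" "(g ^^ m) z = z" by (rule funpow_periodic[OF g])
  from funpow_l_part[OF l m(1)] obtain b where
    b: "\<forall>(f :: 'a \<Rightarrow> 'a) x a. (f ^^ m) x = x \<longrightarrow> (f ^^ (l ^ a)) x = x \<longrightarrow> (f ^^ (l ^ b)) x = x" ..
  have "(c x ^^ (l ^ b)) (lc_coeff z x) = lc_coeff z x" for x
  proof -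
    obtain a where a: "(c x ^^ (l ^ a)) (lc_coeff z x) = lc_coeff z x" using c(2) by blast
    have "(c x ^^ m) (lc_coeff z x) = lc_coeff z x" using pow[of m z x] m(2) by simp
    then show ?thesis using b[rule_format, OF _ a] by simp
  qed
  then have "(g ^^ (l ^ b)) z = z" by (simp add: lc_eq_iff pow)
  then show ?thesis ..
qed

section \<open>The example\<close>

text \<open>The reals \<open>r\<close> and \<open>s\<close> are the exponents of the two variables
  \<open>x = t^r\<close> and \<open>y = t^s\<close>; \<open>u\<close> and \<open>v\<close> are
  rational coordinate functions on the exponents, dual to them.\<close>

locale lc_example =
  fixes l :: nat and \<phi> :: "qbar \<Rightarrow> qbar" and e :: "rat \<Rightarrow> qbar" and u v :: "real \<Rightarrow> rat" and r s :: real
  assumes l: "Factorial_Ring.prime l"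
    and \<phi>: "field_embedding \<phi>" "\<And>x. \<exists>n. (\<phi> ^^ (l ^ n)) x = x"
    and e: "\<And>p q. e (p + q) = e p * e q" "\<And>q. \<exists>n. e q ^ (l ^ n) = 1" "e 1 = 1" "e (1 / of_nat l) \<noteq> 1"
    and \<phi>e: "\<phi> (e (1 / of_nat l ^ 2)) = e (1 / of_nat l ^ 2) ^ Suc l"
    and u: "\<And>x y. u (x + y) = u x + u y" "\<And>q x. u (of_rat q * x) = q * u x" "u r = 1" "u s = 0"
    and v: "\<And>x y. v (x + y) = v x + v y" "\<And>q x. v (of_rat q * x) = q * v x" "v r = 0" "v s = 1"
begin

sublocale \<phi>: field_embedding \<phi> by (rule \<phi>(1))

text \<open>The inertia part of the group. Triviality at \<open>r\<close> and \<open>s\<close> keeps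
  both variables in the fixed field, and values of \<open>l\<close>-power order keep the Galois
  group pro-\<open>l\<close>.\<close>

definition X_chars :: "(real \<Rightarrow> qbar) set" where
  "X_chars = {\<eta>. is_character \<eta> \<and> (\<forall>x. \<exists>n. \<eta> x ^ (l ^ n) = 1) \<and> \<eta> r = 1 \<and> \<eta> s = 1}"

definition \<Gamma> :: "(qbar lc \<Rightarrow> qbar lc) set" where
  "\<Gamma> = {\<lambda>f. twist \<eta> (lc_map (\<phi> ^^ i) f) | \<eta> i. \<eta> \<in> X_chars}"

lemma l0: "l > 0" by (rule prime_gt_0_nat[OF l])

lemma \<phi>_pow: "field_embedding (\<phi> ^^ i)" "(\<phi> ^^ i) 0 = 0" "(\<phi> ^^ i) 1 = 1"
  using funpow_field_embedding[OF \<phi>(1), of i] field_embedding.zero field_embedding.one by blast+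

lemma e_of_nat: "e (of_nat n * q) = e q ^ n"
proof (induction n)
  case 0
  have "e 0 * e 1 = e 1" using e(1)[of 0 1] by simp
  then show ?case by (simp add: e(3))
next
  case (Suc n)
  then show ?case by (simp add: e(1) distrib_right)
qed

lemma e_0: "e 0 = 1" using e_of_nat[of 0 1] by simp

definition \<zeta> :: qbar where "\<zeta> = e (1 / of_nat l ^ 2)"

lemma \<zeta>: "\<zeta> ^ (l ^ 2) = 1" "\<zeta> ^ l \<noteq> 1" "\<phi> \<zeta> = \<zeta> ^ Suc l" "\<phi> (\<zeta> ^ l) = \<zeta> ^ l" "\<zeta> \<noteq> 0"
proof -
  show 1: "\<zeta> ^ (l ^ 2) = 1" "\<zeta> ^ l \<noteq> 1"
    using e_of_nat[of "l ^ 2" "1 / of_nat l ^ 2"] e_of_nat[of l "1 / of_nat l ^ 2"] e(3,4) l0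
    by (auto simp: \<zeta>_def power2_eq_square)
  show 2: "\<phi> \<zeta> = \<zeta> ^ Suc l" using \<phi>e by (simp add: \<zeta>_def)
  have "\<phi> (\<zeta> ^ l) = (\<zeta> ^ Suc l) ^ l" by (simp only: \<phi>.power 2)
  also have "\<dots> = \<zeta> ^ l * \<zeta> ^ (l ^ 2)" by (simp add: power_mult_distrib power2_eq_square power_mult)
  finally show "\<phi> (\<zeta> ^ l) = \<zeta> ^ l" using 1 by simp
  show "\<zeta> \<noteq> 0" using 1 l0 by (auto simp: power_0_left)
qed

lemma X_nonzero: "\<eta> \<in> X_chars \<Longrightarrow> \<eta> x \<noteq> 0"
proof -
  assume "\<eta> \<in> X_chars"
  then obtain n where "\<eta> x ^ (l ^ n) = 1" unfolding X_chars_def by blast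
  then show ?thesis using l0 by (auto simp: power_0_left)
qed

lemma X_mult:
  assumes "\<eta> \<in> X_chars" "\<eta>' \<in> X_chars"
  shows "(\<lambda>x. \<eta> x * \<eta>' x) \<in> X_chars"
proof -
  have "\<exists>n. (\<eta> x * \<eta>' x) ^ (l ^ n) = 1" for x
  proof -
    obtain m n where mn: "\<eta> x ^ (l ^ m) = 1" "\<eta>' x ^ (l ^ n) = 1"
      using assms unfolding X_chars_def by blast
    have "(\<eta> x * \<eta>' x) ^ (l ^ (m + n)) = (\<eta> x ^ (l ^ m)) ^ (l ^ n) * (\<eta>' x ^ (l ^ n)) ^ (l ^ m)"
      by (simp add: power_mult_distrib power_add mult.commute flip: power_mult)
    then show ?thesis using mn by (metis mult_1 power_one)
  qed
  then show ?thesis using assms by (auto simp: X_chars_def is_character_def)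
qed

lemma X_\<phi>:
  assumes "\<eta> \<in> X_chars"
  shows "(\<lambda>x. (\<phi> ^^ i) (\<eta> x)) \<in> X_chars"
proof -
  interpret p: field_embedding "\<phi> ^^ i" by (rule \<phi>_pow)
  have "\<exists>n. (\<phi> ^^ i) (\<eta> x) ^ (l ^ n) = 1" for x
    using assms by (auto simp: X_chars_def p.one simp flip: p.power) (metis p.one)
  then show ?thesis using assms by (auto simp: X_chars_def is_character_def p.one p.mult)
qed

lemma X_inverse:
  assumes "\<eta> \<in> X_chars"
  shows "(\<lambda>x. inverse (\<eta> x)) \<in> X_chars"
proof -
  have "\<exists>n. inverse (\<eta> x) ^ (l ^ n) = 1" for x
    using assms unfolding X_chars_def by (auto simp: power_inverse)
  then show ?thesis using assms by (auto simp: X_chars_def is_character_def)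
qed

lemma X_one: "(\<lambda>_. 1) \<in> X_chars"
  by (simp add: X_chars_def is_character_def)

text \<open>The multiplication law of the semidirect product of the characters by the powers of
  \<phi>.\<close>

lemma \<Gamma>_comp:
  "twist \<eta> (lc_map (\<phi> ^^ i) (twist \<eta>' (lc_map (\<phi> ^^ j) f))) =
   twist (\<lambda>x. \<eta> x * (\<phi> ^^ i) (\<eta>' x)) (lc_map (\<phi> ^^ (i + j)) f)"
  by (simp add: lc_map_twist \<phi>_pow lc_map_lc_map twist_twist funpow_add)

lemma twist_mem: "\<eta> \<in> X_chars \<Longrightarrow> twist \<eta> \<in> \<Gamma>"
proof -
  assume "\<eta> \<in> X_chars"
  moreover have "twist \<eta> = (\<lambda>f. twist \<eta> (lc_map (\<phi> ^^ 0) f))"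
    by (rule ext) (simp add: lc_eq_iff twist.rep_eq lc_coeff_map)
  ultimately show ?thesis unfolding \<Gamma>_def by blast
qed

lemma lc_map_mem: "lc_map (\<phi> ^^ i) \<in> \<Gamma>"
proof -
  have "lc_map (\<phi> ^^ i) = (\<lambda>f. twist (\<lambda>_. 1) (lc_map (\<phi> ^^ i) f))"
    by (rule ext) (simp add: lc_eq_iff twist.rep_eq)
  then show ?thesis unfolding \<Gamma>_def using X_one by blast
qed

sublocale embedding_monoid \<Gamma>
proof (rule embedding_monoid.intro)
  fix \<gamma> assume "\<gamma> \<in> \<Gamma>"
  then obtain \<eta> i where g: "\<gamma> = (\<lambda>f. twist \<eta> (lc_map (\<phi> ^^ i) f))" "\<eta> \<in> X_chars" by (auto simp: \<Gamma>_def)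
  interpret t: field_embedding "twist \<eta>" using g(2) by (intro field_embedding_twist) (simp add: X_chars_def)
  interpret m: field_embedding "lc_map (\<phi> ^^ i)" by (intro field_embedding_lc_map \<phi>_pow)
  show "field_embedding \<gamma>"
    by standard (simp_all add: g(1) t.add t.mult t.one m.add m.mult m.one)
next
  fix \<gamma> \<delta> assume "\<gamma> \<in> \<Gamma>"
  then obtain \<eta> i where g: "\<gamma> = (\<lambda>f. twist \<eta> (lc_map (\<phi> ^^ i) f))" "\<eta> \<in> X_chars" by (auto simp: \<Gamma>_def)
  assume "\<delta> \<in> \<Gamma>"
  then obtain \<eta>' j where d: "\<delta> = (\<lambda>f. twist \<eta>' (lc_map (\<phi> ^^ j) f))" "\<eta>' \<in> X_chars" by (auto simp: \<Gamma>_def)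
  have "\<gamma> \<circ> \<delta> = (\<lambda>f. twist (\<lambda>x. \<eta> x * (\<phi> ^^ i) (\<eta>' x)) (lc_map (\<phi> ^^ (i + j)) f))"
    by (simp add: g(1) d(1) fun_eq_iff \<Gamma>_comp)
  moreover have "(\<lambda>x. \<eta> x * (\<phi> ^^ i) (\<eta>' x)) \<in> X_chars" by (intro X_mult X_\<phi> g(2) d(2))
  ultimately show "\<gamma> \<circ> \<delta> \<in> \<Gamma>" unfolding \<Gamma>_def by blast
next
  have "id = (twist (\<lambda>_. 1) :: qbar lc \<Rightarrow> qbar lc)"
    by (rule ext) (simp add: lc_eq_iff twist.rep_eq)
  then show "id \<in> \<Gamma>" using twist_mem[OF X_one] by simp
qed

lemma funpow_mem: "\<gamma> \<in> \<Gamma> \<Longrightarrow> \<gamma> ^^ n \<in> \<Gamma>"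
  by (induction n) (auto simp: id_mem[unfolded id_def] id_def[symmetric] id_mem comp_mem)

lemma finite_range_funpow: "\<gamma> \<in> \<Gamma> \<Longrightarrow> z \<in> fin_part \<Longrightarrow> finite (range (\<lambda>n :: nat. (\<gamma> ^^ n) z))"
proof -
  assume "\<gamma> \<in> \<Gamma>" "z \<in> fin_part"
  then have "range (\<lambda>n :: nat. (\<gamma> ^^ n) z) \<subseteq> orb z" "finite (orb z)"
    using funpow_mem orb_apply by (auto simp: fin_part_def)
  then show ?thesis by (rule finite_subset)
qed

lemma lc_map_torsion:
  assumes "z \<in> fin_part"
  shows "\<exists>b. lc_map (\<phi> ^^ (l ^ b)) z = z"
proof -
  have mem: "lc_map \<phi> \<in> \<Gamma>" using lc_map_mem[of 1] by simp
  have pow: "(lc_map \<phi> ^^ n) f = lc_map (\<phi> ^^ n) f" for n f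
  proof (induction n)
    case 0
    show ?case by (simp add: lc_eq_iff lc_coeff_map)
  next
    case (Suc n)
    then show ?case by (simp add: lc_map_lc_map \<phi>_pow \<phi>.zero o_def)
  qed
  have "\<exists>b. (lc_map \<phi> ^^ (l ^ b)) z = z"
    by (rule coefficientwise_torsion[OF l _ finite_range_funpow[OF mem assms], of "\<lambda>_. \<phi>"])
       (use field_embedding.inj[OF emb[OF mem]] \<phi>(2) in \<open>auto simp: lc_coeff_map \<phi>.zero\<close>)
  then show ?thesis by (simp add: pow)
qed

lemma twist_torsion:
  assumes \<eta>: "\<eta> \<in> X_chars" and z: "z \<in> fin_part"
  shows "\<exists>b. (twist \<eta> ^^ (l ^ b)) z = z"
proof (rule coefficientwise_torsion[OF l _ finite_range_funpow[OF twist_mem[OF \<eta>] z], of "\<lambda>x y. \<eta> x * y"])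
  show "inj (twist \<eta>)" by (rule field_embedding.inj[OF emb[OF twist_mem[OF \<eta>]]])
  fix x
  obtain n where n: "\<eta> x ^ (l ^ n) = 1" using \<eta> by (auto simp: X_chars_def)
  have "((\<lambda>y. \<eta> x * y) ^^ k) y = \<eta> x ^ k * y" for k y
    by (induction k) (auto simp: mult.assoc)
  then show "\<exists>a. ((\<lambda>y. \<eta> x * y) ^^ (l ^ a)) (lc_coeff z x) = lc_coeff z x" using n by (metis mult_1)
qed (simp add: twist.rep_eq)

text \<open>An \<open>l\<close>-power of \<gamma> removes the action on coefficients for all
  elements of the finite orbit of \<open>z\<close>. What remains there is a pure twist, which has
  \<open>l\<close>-power torsion at \<open>z\<close> by \<open>twist_torsion\<close>.\<close>

lemma \<Gamma>_torsion:
  assumes \<gamma>: "\<gamma> \<in> \<Gamma>" and z: "z \<in> fin_part"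
  shows "\<exists>n. (\<gamma> ^^ (l ^ n)) z = z"
proof -
  obtain \<eta> i where g: "\<gamma> = (\<lambda>f. twist \<eta> (lc_map (\<phi> ^^ i) f))" "\<eta> \<in> X_chars" using \<gamma> by (auto simp: \<Gamma>_def)
  have pow: "\<exists>\<eta>'\<in>X_chars. \<forall>f. (\<gamma> ^^ n) f = twist \<eta>' (lc_map (\<phi> ^^ (n * i)) f)" for n
  proof (induction n)
    case 0
    show ?case by (rule bexI[OF _ X_one]) (simp add: lc_eq_iff twist.rep_eq lc_coeff_map)
  next
    case (Suc n)
    then obtain \<eta>' where c: "\<eta>' \<in> X_chars" "\<forall>f. (\<gamma> ^^ n) f = twist \<eta>' (lc_map (\<phi> ^^ (n * i)) f)" by blast
    then have "\<forall>f. (\<gamma> ^^ Suc n) f = twist (\<lambda>x. \<eta> x * (\<phi> ^^ i) (\<eta>' x)) (lc_map (\<phi> ^^ (Suc n * i)) f)"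
      by (simp add: g(1) \<Gamma>_comp)
    moreover have "(\<lambda>x. \<eta> x * (\<phi> ^^ i) (\<eta>' x)) \<in> X_chars" by (intro X_mult X_\<phi> g(2) c(1))
    ultimately show ?case by blast
  qed
  have O: "finite (orb z)" "\<And>w. w \<in> orb z \<Longrightarrow> w \<in> fin_part"
    using z orb_fin_part by (auto simp: fin_part_def)
  obtain b where b: "\<And>w. w \<in> orb z \<Longrightarrow> lc_map (\<phi> ^^ (l ^ b w)) w = w"
    using lc_map_torsion O(2) by metis
  define B where "B = sum b (orb z)"
  obtain \<eta>' where \<eta>': "\<eta>' \<in> X_chars" "\<And>f. (\<gamma> ^^ (l ^ B)) f = twist \<eta>' (lc_map (\<phi> ^^ (l ^ B * i)) f)"
    using pow[of "l ^ B"] by blast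
  have fixw: "(\<gamma> ^^ (l ^ B)) w = twist \<eta>' w" if w: "w \<in> orb z" for w
  proof -
    have d: "l ^ b w dvd l ^ B * i"
      using w O(1) by (intro dvd_mult2 le_imp_power_dvd) (simp add: B_def member_le_sum)
    have f: "(\<phi> ^^ (l ^ b w)) (lc_coeff w x) = lc_coeff w x" for x
      using b[OF w] lc_coeff_map[of "\<phi> ^^ (l ^ b w)" w x] \<phi>_pow(2) by simp
    have "(\<phi> ^^ (l ^ B * i)) (lc_coeff w x) = lc_coeff w x" for x
      by (rule funpow_fix_mult[OF f d])
    then have "lc_map (\<phi> ^^ (l ^ B * i)) w = w"
      by (simp add: lc_eq_iff lc_coeff_map \<phi>_pow)
    then show ?thesis using \<eta>'(2) by simp
  qed
  obtain c where c: "(twist \<eta>' ^^ (l ^ c)) z = z" using twist_torsion[OF \<eta>'(1) z] by blast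
  \<comment> \<open>The iterates of the twist move \<open>z\<close> within its orbit. That is why
    \<open>B\<close> was chosen for the whole orbit and not for \<open>z\<close> alone.\<close>
  have "(\<gamma> ^^ (l ^ B * k)) z = (twist \<eta>' ^^ k) z \<and> (twist \<eta>' ^^ k) z \<in> orb z" for k
  proof (induction k)
    case 0
    show ?case using self_orb by simp
  next
    case (Suc k)
    then have "(\<gamma> ^^ (l ^ B * Suc k)) z = twist \<eta>' ((twist \<eta>' ^^ k) z)"
      by (simp add: funpow_add fixw)
    moreover have "twist \<eta>' ((twist \<eta>' ^^ k) z) \<in> orb z"
      using Suc orb_mono orb_apply[OF twist_mem[OF \<eta>'(1)]] by blast
    ultimately show ?case by simp
  qed
  then have "(\<gamma> ^^ (l ^ (B + c))) z = z" using c by (simp add: power_add)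
  then show ?thesis ..
qed

text \<open>These are the two inertia generators: the first multiplies \<open>t^(r/n)\<close> by
  \<open>e (1/n)\<close> and fixes \<open>t^(s/n)\<close>, the second does the opposite.\<close>

lemma u_character: "(\<lambda>x. e (u x)) \<in> X_chars" "(\<lambda>x. e (v x)) \<in> X_chars"
proof -
  have "u 0 = 0" "v 0 = 0" using u(1)[of 0 0] v(1)[of 0 0] by simp_all
  then show "(\<lambda>x. e (u x)) \<in> X_chars" "(\<lambda>x. e (v x)) \<in> X_chars"
    using e u v e_0 by (auto simp: X_chars_def is_character_def)
qed

lemma \<Gamma>_monom: "twist \<eta> (lc_map (\<phi> ^^ i) (lc_monom 1 x)) = lc_monom (\<eta> x) x"
  by (simp add: lc_map_lc_monom twist_lc_monom \<phi>_pow)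

lemma character_power: "is_character \<eta> \<Longrightarrow> \<eta> (of_nat n * x) = \<eta> x ^ n"
  by (induction n) (auto simp: is_character_def distrib_right)

lemma monom_fin_part:
  assumes "t = r \<or> t = s" "n > 0"
  shows "lc_monom 1 (t / of_nat n) \<in> fin_part"
proof -
  have "orb (lc_monom 1 (t / of_nat n)) \<subseteq> (\<lambda>c. lc_monom c (t / of_nat n)) ` {c :: qbar. c ^ n = 1}"
  proof
    fix y assume "y \<in> orb (lc_monom 1 (t / of_nat n))"
    then obtain \<gamma> where \<gamma>: "\<gamma> \<in> \<Gamma>" "y = \<gamma> (lc_monom 1 (t / of_nat n))" by (auto simp: orb_def)
    then obtain \<eta> where y: "\<eta> \<in> X_chars" "y = lc_monom (\<eta> (t / of_nat n)) (t / of_nat n)"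
      by (auto simp: \<Gamma>_def \<Gamma>_monom)
    have "\<eta> (t / of_nat n) ^ n = \<eta> (of_nat n * (t / of_nat n))"
      using y(1) by (subst character_power) (auto simp: X_chars_def)
    also have "\<dots> = 1" using assms y(1) by (auto simp: X_chars_def)
    finally show "y \<in> (\<lambda>c. lc_monom c (t / of_nat n)) ` {c :: qbar. c ^ n = 1}" using y(2) by blast
  qed
  moreover have "finite {c :: qbar. c ^ n = 1}"
  proof -
    have "coeff (monom 1 n - (1 :: qbar poly)) n = 1" using assms by (simp add: coeff_1)
    then have "monom 1 n - (1 :: qbar poly) \<noteq> 0" by (metis coeff_0 zero_neq_one)
    from poly_roots_finite[OF this] show ?thesis by (simp add: poly_monom)
  qed
  ultimately show ?thesis by (auto simp: fin_part_def intro: finite_subset)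
qed

lemma const_fixed: "\<phi> c = c \<Longrightarrow> lc_monom c 0 \<in> fixed"
proof -
  assume "\<phi> c = c"
  then have c: "(\<phi> ^^ i) c = c" for i by (induction i) auto
  have "\<gamma> (lc_monom c 0) = lc_monom c 0" if \<gamma>: "\<gamma> \<in> \<Gamma>" for \<gamma>
  proof -
    obtain \<eta> i where "\<gamma> = (\<lambda>f. twist \<eta> (lc_map (\<phi> ^^ i) f))" "\<eta> 0 = 1"
      using \<gamma> by (auto simp: \<Gamma>_def X_chars_def is_character_def)
    then show ?thesis by (simp add: lc_map_lc_monom \<phi>_pow twist_lc_monom c)
  qed
  then show ?thesis by (simp add: fixed_def)
qed

lemma monom_fixed:
  assumes "t = r \<or> t = s"
  shows "lc_monom 1 t \<in> fixed"
proof -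
  have "\<gamma> (lc_monom 1 t) = lc_monom 1 t" if \<gamma>: "\<gamma> \<in> \<Gamma>" for \<gamma>
  proof -
    obtain \<eta> i where "\<gamma> = (\<lambda>f. twist \<eta> (lc_map (\<phi> ^^ i) f))" "\<eta> r = 1" "\<eta> s = 1"
      using \<gamma> by (auto simp: \<Gamma>_def X_chars_def)
    then show ?thesis using assms by (auto simp: \<Gamma>_monom)
  qed
  then show ?thesis by (simp add: fixed_def)
qed

lemma not_free_example:
  fixes h :: "qbar lc \<Rightarrow> 'c"
  assumes h: "inj h"
  defines "F \<equiv> transport_ring h fixed" and "L \<equiv> transport_ring h fin_part"
  defines "G \<equiv> galois_group L (carrier F)"
  shows "Ring.field F" "iso_incl F L" "separable_closure L (carrier F)" "pro_group l G"
    "\<not> free_pro_group l (closed_commutator_subgroup G)"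
    "\<not> free_pro_group l (closed_commutator_subgroup (max_pro_quotient l G))"
proof -
  \<comment> \<open>The constant series of an \<open>l\<close>-th root of unity that \<phi> fixes,
    so that Kummer theory is available over the fixed field.\<close>
  define \<omega> where "\<omega> = lc_monom (\<zeta> ^ l) 0"
  interpret K: kummer_model \<Gamma> h l \<omega>
  proof
    show "\<omega> ^ l = 1" using \<zeta>(1) by (simp add: \<omega>_def lc_monom_power one_lc_def power2_eq_square power_mult)
    show "\<omega> \<noteq> 1" using \<zeta>(2) by (simp add: \<omega>_def one_lc_def lc_eq_iff lc_coeff_monom)
    show "\<omega> \<in> fixed" unfolding \<omega>_def by (rule const_fixed[OF \<zeta>(4)])
  qed (use h l in auto)
  have G: "G = K.G" by (simp add: G_def F_def L_def K.carrier_F)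
  show "Ring.field F" unfolding F_def by (rule K.Ft.field_transport)
  show "iso_incl F L" unfolding F_def L_def by (rule K.F_incl_L)
  show "separable_closure L (carrier F)"
    unfolding F_def L_def K.carrier_F by (rule K.separable_closure_L)
  show pro: "pro_group l G" unfolding G by (rule K.pro_group_G_if_torsion[OF l \<Gamma>_torsion])
  define U where "U = (\<lambda>x. e (u x))"
  define V where "V = (\<lambda>x. e (v x))"
  have UV: "U \<in> X_chars" "V \<in> X_chars" using u_character by (simp_all add: U_def V_def)
  \<comment> \<open>The commutator of \<phi> with the twist by \<eta>: moving \<phi> past the twist
    applies \<phi> to the values of \<eta>.\<close>
  define D where "D \<eta> x = \<phi> (\<eta> x) * inverse (\<eta> x)" for \<eta> :: "real \<Rightarrow> qbar" and x
  have D: "D \<eta> \<in> X_chars" if "\<eta> \<in> X_chars" for \<eta>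
    using X_mult[OF X_\<phi>[OF that, of 1] X_inverse[OF that]] by (simp add: D_def[abs_def])
  have comm: "lc_map \<phi> \<circ> twist \<eta> = twist (D \<eta>) \<circ> twist \<eta> \<circ> lc_map \<phi>" if "\<eta> \<in> X_chars" for \<eta>
    using X_nonzero[OF that]
    by (simp add: fun_eq_iff lc_map_twist \<phi>(1) twist_twist D_def mult.assoc)
  have mem: "lc_map \<phi> \<in> \<Gamma>" "twist U \<in> \<Gamma>" "twist V \<in> \<Gamma>" "twist (D U) \<in> \<Gamma>" "twist (D V) \<in> \<Gamma>"
    using lc_map_mem[of 1] twist_mem UV D by simp_all
  have tt: "twist (D U) \<circ> twist (D V) = twist (D V) \<circ> twist (D U)"
    by (simp add: fun_eq_iff twist_twist mult.commute)
  \<comment> \<open>The denominator is \<open>l^2\<close>, since at \<open>r/l\<close> the character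
    \<open>D U\<close> is \<open>\<phi>(\<zeta>^l)/\<zeta>^l = 1\<close>, whereas at
    \<open>r/l^2\<close> it is \<open>\<phi>(\<zeta>)/\<zeta> = \<zeta>^l\<close>. The same holds
    for \<open>V\<close> and \<open>s\<close>.\<close>
  define \<alpha> where "\<alpha> t = lc_monom (1 :: qbar) (t / of_nat (l ^ 2))" for t
  have \<alpha>_fin: "\<alpha> t \<in> fin_part" if "t = r \<or> t = s" for t
    unfolding \<alpha>_def using that l0 by (intro monom_fin_part) auto
  have \<alpha>0: "\<alpha> t \<noteq> 0" for t by (simp add: \<alpha>_def lc_monom_eq_0_iff)
  have \<alpha>_pow: "(\<alpha> t ^ l) ^ l \<in> fixed" if "t = r \<or> t = s" for t
    using monom_fixed[OF that] l0 by (simp add: \<alpha>_def lc_monom_power power2_eq_square)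
  have tw: "twist \<eta> (\<alpha> t) = lc_monom (\<eta> (t / of_nat (l ^ 2))) 0 * \<alpha> t" for \<eta> t
    by (simp add: \<alpha>_def twist_lc_monom lc_monom_mult)
  have div: "t / of_nat (l ^ 2) = of_rat (1 / of_nat l ^ 2) * t" for t :: real
    by (simp add: of_rat_divide of_rat_power)
  have val: "U (r / of_nat (l ^ 2)) = \<zeta>" "U (s / of_nat (l ^ 2)) = 1" "V (r / of_nat (l ^ 2)) = 1" "V (s / of_nat (l ^ 2)) = \<zeta>"
    unfolding U_def V_def div u(2) v(2) u(3,4) v(3,4) by (simp_all add: e_0 \<zeta>_def)
  have D\<zeta>: "\<phi> \<zeta> * inverse \<zeta> = \<zeta> ^ l" using \<zeta>(3,5) by simp
  have one: "lc_monom 1 0 = (1 :: qbar lc)" by (simp add: one_lc_def)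
  have act: "twist (D U) (\<alpha> r) = \<omega> * \<alpha> r" "twist (D V) (\<alpha> r) = \<alpha> r"
    "twist (D U) (\<alpha> s) = \<alpha> s" "twist (D V) (\<alpha> s) = \<omega> * \<alpha> s"
    unfolding tw D_def val by (simp_all add: D\<zeta> \<omega>_def \<phi>.one one)
  have *: "\<not> free_pro_group l (closed_commutator_subgroup K.G)"
    "\<not> free_pro_group l (closed_commutator_subgroup (max_pro_quotient l K.G))"
    using K.not_free[OF pro[unfolded G] mem comm[OF UV(1)] comm[OF UV(2)] tt
        \<alpha>_fin[of r] \<alpha>0 \<alpha>_pow[of r] act(1,2) \<alpha>_fin[of s] \<alpha>0 \<alpha>_pow[of s] act(3,4)] by simp_all
  show "\<not> free_pro_group l (closed_commutator_subgroup G)"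
    "\<not> free_pro_group l (closed_commutator_subgroup (max_pro_quotient l G))"
    unfolding G by (fact *)+
qed

end

section \<open>Existence of the coordinates and of an embedding into the universe\<close>

text \<open>Take \<open>r = 1\<close> and \<open>s\<close> irrational. They are linearly independent
  over \<rat>, so their dual functionals extend to all of \<real>.\<close>

lemma ex_dual_coordinates:
  obtains u v :: "real \<Rightarrow> rat" and r s :: real where
    "\<And>x y. u (x + y) = u x + u y" "\<And>q x. u (of_rat q * x) = q * u x" "u r = 1" "u s = 0"
    "\<And>x y. v (x + y) = v x + v y" "\<And>q x. v (of_rat q * x) = q * v x" "v r = 0" "v s = 1"
proof -
  interpret V: vector_space_pair "\<lambda>(q :: rat) (x :: real). of_rat q * x" "\<lambda>(q :: rat) (x :: rat). q * x"
    by unfold_locales (simp_all add: algebra_simps of_rat_add of_rat_mult)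
  have "\<rat> \<noteq> (UNIV :: real set)" using countable_rat uncountable_UNIV_real by metis
  then obtain s :: real where s: "s \<notin> \<rat>" by blast
  have "s \<noteq> 0" "s \<noteq> 1" using s by auto
  have ind: "V.vs1.independent {1, s}"
  proof -
    have "1 \<notin> V.vs1.span {s}"
    proof
      assume "1 \<in> V.vs1.span {s}"
      then obtain q where q: "1 = of_rat q * s" by (auto simp: V.vs1.span_singleton)
      then have "q \<noteq> 0" by auto
      then have "s = of_rat (inverse q)" using q by (metis inverse_unique of_rat_inverse)
      then show False using s by simp
    qed
    moreover have "V.vs1.independent {s}" using \<open>s \<noteq> 0\<close> by simp
    ultimately show ?thesis using V.vs1.independent_insertI by blast
  qed
  obtain u where u: "Vector_Spaces.linear (\<lambda>(q :: rat) (x :: real). of_rat q * x) (*) u"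
    "\<forall>x\<in>{1, s}. u x = (if x = 1 then 1 else 0)"
    using V.linear_independent_extend[OF ind, of "\<lambda>x. if x = 1 then 1 else 0"] by blast
  obtain v where v: "Vector_Spaces.linear (\<lambda>(q :: rat) (x :: real). of_rat q * x) (*) v"
    "\<forall>x\<in>{1, s}. v x = (if x = 1 then 0 else 1)"
    using V.linear_independent_extend[OF ind, of "\<lambda>x. if x = 1 then 0 else 1"] by blast
  interpret u: Vector_Spaces.linear "\<lambda>(q :: rat) (x :: real). of_rat q * x" "(*)" u by (rule u(1))
  interpret v: Vector_Spaces.linear "\<lambda>(q :: rat) (x :: real). of_rat q * x" "(*)" v by (rule v(1))
  show thesis
    by (rule that[of u 1 s v]) (use u(2) v(2) \<open>s \<noteq> 1\<close> in \<open>simp_all add: u.add u.scale v.add v.scale\<close>)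
qed

text \<open>A real number is coded by its Dedekind cut, a set of naturals. An exponent with its
  algebraic coefficient amounts to three reals and is again a set of naturals, and a series is the
  set of codes of its graph.\<close>

lemma ex_inj_lc_universe:
  obtains h :: "qbar lc \<Rightarrow> nat set set" where "inj h"
proof -
  obtain j :: "qbar \<Rightarrow> complex" where j: "field_embedding j" by (rule ex_embedding_into_complex)
  define cut where "cut x = to_nat ` {q :: rat. of_rat q < (x :: real)}" for x
  have cut: "inj cut"
  proof (rule linorder_injI)
    fix x y :: real assume "x < y"
    then obtain q where q: "x < of_rat q" "of_rat q < y" using of_rat_dense by blast
    then have "to_nat q \<in> cut y" "to_nat q \<notin> cut x"
      by (auto simp: cut_def)
    then show "cut x \<noteq> cut y" by blast
  qed
  \<comment> \<open>Tagging by \<open>k\<close> makes a disjoint union, from which the three cuts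
    can be recovered.\<close>
  define tag where "tag k A = (\<lambda>n :: nat. prod_encode (k, n)) ` A" for k :: nat and A
  have tag: "prod_encode (k, n) \<in> tag k' A \<longleftrightarrow> k = k' \<and> n \<in> A" for k k' n A
    by (auto simp: tag_def)
  define code where "code x c = tag 0 (cut x) \<union> tag 1 (cut (Re (j c))) \<union> tag 2 (cut (Im (j c)))" for x c
  have code: "x = y \<and> c = d" if "code x c = code y d" for x y c d
  proof -
    have m: "prod_encode (0, n) \<in> code x c \<longleftrightarrow> n \<in> cut x" "prod_encode (1, n) \<in> code x c \<longleftrightarrow> n \<in> cut (Re (j c))"
      "prod_encode (2, n) \<in> code x c \<longleftrightarrow> n \<in> cut (Im (j c))" for n x c
      by (simp_all add: code_def tag)
    have "cut x = cut y" "cut (Re (j c)) = cut (Re (j d))" "cut (Im (j c)) = cut (Im (j d))"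
      using that m[of _ x c] m[of _ y d] by auto
    then have "x = y" "j c = j d" using cut by (auto simp: inj_eq complex_eq_iff)
    then show ?thesis using field_embedding.inj[OF j] by (simp add: inj_eq)
  qed
  define h where "h f = {code x (lc_coeff f x) | x. True}" for f
  have "inj h"
  proof (rule injI)
    fix f g assume "h f = h g"
    then have "\<exists>y. code x (lc_coeff f x) = code y (lc_coeff g y)" for x
      unfolding h_def by blast
    then have "lc_coeff f x = lc_coeff g x" for x using code by blast
    then show "f = g" by (simp add: lc_eq_iff)
  qed
  then show thesis by (rule that)
qed

theorem mainTheorem4:
  fixes l :: nat
  assumes "Factorial_Ring.prime l"
  shows "(\<exists>(F :: universe ring) (L :: universe ring).
            field F \<and> F \<lesssim> L \<and> separable_closure L (carrier F) \<and>
            \<not> free_pro_group l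
                (closed_commutator_subgroup
                  (max_pro_quotient l (galois_group L (carrier F))))) \<and>
         (\<exists>(F :: universe ring) (L :: universe ring) P.
            field F \<and> F \<lesssim> L \<and> separable_closure L (carrier F) \<and>
            sylow_pro_subgroup l (galois_group L (carrier F)) P \<and>
            \<not> free_pro_group l
                (closed_commutator_subgroup
                  (restrict_topgroup (galois_group L (carrier F)) P)))"
proof -
  obtain \<phi> :: "qbar \<Rightarrow> qbar" and e :: "rat \<Rightarrow> qbar" where \<phi>e: "field_embedding \<phi>" "\<And>x. \<exists>n. (\<phi> ^^ (l ^ n)) x = x"
    "\<And>q r. e (q + r) = e q * e r" "\<And>q. \<exists>n. e q ^ (l ^ n) = 1" "e 1 = 1" "e (1 / of_nat l) \<noteq> 1"
    "\<phi> (e (1 / of_nat l ^ 2)) = e (1 / of_nat l ^ 2) ^ Suc l"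
    by (rule ex_automorphism_and_character[OF assms]) blast
  obtain u v :: "real \<Rightarrow> rat" and r s where uv:
    "\<And>x y. u (x + y) = u x + u y" "\<And>q x. u (of_rat q * x) = q * u x" "u r = 1" "u s = 0"
    "\<And>x y. v (x + y) = v x + v y" "\<And>q x. v (of_rat q * x) = q * v x" "v r = 0" "v s = 1"
    by (rule ex_dual_coordinates) blast
  obtain h :: "qbar lc \<Rightarrow> universe" where h: "inj h" by (rule ex_inj_lc_universe)
  interpret lc_example l \<phi> e u v r s
    by (rule lc_example.intro) (fact assms \<phi>e uv)+
  define F where "F = transport_ring h fixed"
  define L where "L = transport_ring h fin_part"
  note ex = not_free_example[OF h, folded F_def L_def]
  \<comment> \<open>The Galois group is pro-\<open>l\<close>, so the whole group serves as Sylow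
    subgroup, and the field of the first claim also proves the second.\<close>
  have "sylow_pro_subgroup l (galois_group L (carrier F)) (carrier (galois_group L (carrier F)))"
    by (rule sylow_pro_subgroup_carrier[OF assms ex(4)])
  moreover have "restrict_topgroup (galois_group L (carrier F)) (carrier (galois_group L (carrier F))) = galois_group L (carrier F)"
    using ex(4) by (intro restrict_topgroup_carrier) (simp add: pro_group_def profinite_group_def topological_group_def)
  ultimately show ?thesis using ex by metis
qed

end
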